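(* If $x$ is the standard orbital representative for an orbit with type (rm rm ur), then $\mathrm{vol}(K_v\cap G_{x\,k_v}^{\circ})=(1+q_v^{-1})^{-1}q_v^{-\tilde\delta_v}$. If $x$ is the standard orbital representative for an orbit with type (rm rm rm), then $\mathrm{vol}(K_v\cap G_{x\,k_v}^{\circ})=q_v^{-i}$ where $i=\mathrm{lev}(k_v(x),\tilde k_v)$.
   Context: $k$ is a number field, $\tilde k/k$ a quadratic extension, $v$ a dyadic place of $k$ such that $\tilde k_v=\tilde k\otimes_k k_v$ is a ramified quadratic field extension of $k_v$; $\sigma$ is the nontrivial automorphism of $\tilde k_v/k_v$. $\mathcal{O}_v,\tilde{\mathcal{O}}_v$ are the rings of integers of $k_v,\tilde k_v$, with prime ideals $\mathfrak{p}_v,\tilde{\mathfrak{p}}_v$; $q_v=\#(\mathcal{O}_v/\mathfrak{p}_v)$; $\Delta_{\tilde k_v/k_v}=\mathfrak{p}_v^{\tilde\delta_v}$. $G_{k_v}=\mathrm{GL}_2(\tilde k_v)\times\mathrm{GL}_2(k_v)$ and $K_v=\mathrm{GL}_2(\tilde{\mathcal{O}}_v)\times\mathrm{GL}_2(\mathcal{O}_v)$. $V_{k_v}$ is the space of pairs $x=(x_1,x_2)$ of Hermitian $2\times2$ matrices over $\tilde k_v$ (with respect to $\sigma$). Writing $M_x(u)=u_1x_1+u_2x_2$ for a row vector $u=(u_1,u_2)$, $g=(g_1,g_2)$ acts by $M_{gx}(u)=g_1M_x(ug_2)\,{}^tg_1^{\sigma}$. Put $F_x(u)=-\det M_x(u)$,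 and let $V^{\mathrm{ss}}_{k_v}$ be the set of $x$ for which $F_x$ has distinct roots; for such $x$, $k_v(x)$ is the splitting field of $F_x$. The map $x\mapsto k_v(x)$ induces a bijection from $G_{k_v}\backslash V^{\mathrm{ss}}_{k_v}$ to extensions of $k_v$ of degree at most $2$. If $k_v(x)\neq k_v,\tilde k_v$, let $\tilde k_v(x)=\tilde k_v\cdot k_v(x)$. An orbit has type (rm rm ur) if $k_v(x)/k_v$ is ramified quadratic, $k_v(x)\ne\tilde k_v$ and $\tilde k_v(x)/\tilde k_v$ is unramified; it has type (rm rm rm) if $k_v(x)/k_v$ is ramified quadratic, $k_v(x)\neq\tilde k_v$ and $\tilde k_v(x)/\tilde k_v$ is ramified. The standard representative of such an orbit is $$x=w_p=\left(\begin{pmatrix}0&1\\ 1&a_1\end{pmatrix},\begin{pmatrix}1&a_1\\ a_1&a_1^2-a_2\end{pmatrix}\right),$$ where $p(z)=z^2+a_1z+a_2$ is an Eisenstein polynomial over $\mathcal{O}_v$ whose roots $\alpha_1,\alpha_2$ generate $k_v(x)$ (then $F_{w_p}(z,1)=p(z)$). $G_x^\circ$ is the identity component of the stabilizer of $x$. For $x=w_p$ with $p(z)=z^2+a_1z+a_2$ an Eisenstein polynomial over $\mathcal{O}_v$ whose roots $\alpha_1,\alpha_2$ generate $k_v(x)$, put $A_p(c,d)=\begin{pmatrix}c&-d\\ a_2d&c-a_1d\end{pmatrix}$; then $G_{x\,k_v}^\circ$ consists of the pairs $(A_p(c_1,d_1),A_p(c_2,d_2))$ with $c_1,d_1\in\tilde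 k_v$, $\det A_p(c_1,d_1)\neq0$ and $A_p(c_2,d_2)=A_p(c_1,d_1)^{-1}A_p(c_1^\sigma,d_1^\sigma)^{-1}$, and $(A_p(c_1,d_1),A_p(c_2,d_2))\mapsto c_1+d_1\alpha_1$ is an isomorphism $G_{x\,k_v}^\circ\cong\tilde k_v(x)^\times$. The Haar measure on $G_{x\,k_v}^\circ$ is the one corresponding to the Haar measure on $\tilde k_v(x)^\times$ giving the unit group of its ring of integers volume $1$; under it $\mathrm{vol}(K_v\cap G_{x\,k_v}^\circ)=\mathrm{vol}(\tilde{\mathcal{O}}_v[\alpha_1]^\times)$. For distinct ramified quadratic extensions $k_1,k_2$ of $k_v$, $\mathrm{lev}(k_1,k_2)$ is the largest integer $i$ for which there is $\eta$ in the ring of integers of $k_2$ with $\mathrm{Tr}_{k_2/k_v}(\eta)\equiv b_1\ (\mathfrak{p}_v^i)$ and $\mathrm{N}_{k_2/k_v}(\eta)\equiv b_2\ (\mathfrak{p}_v^i)$, where $z^2+b_1z+b_2$ is any Eisenstein polynomial whose roots generate $k_1$ (the value is independent of this choice). *)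

theory Defs
  imports
    "HOL-Analysis.Analysis"
    "HOL-Algebra.Algebra"
    "HOL-Algebra.Algebraic_Closure_Type"
begin

text \<open>
  All fields are subfields of one algebraically closed field of characteristic zero, given by a
  type \<open>'a\<close> and carrying a non-archimedean absolute value \<open>av\<close>.  The absolute value of a local field
  extends uniquely to its algebraic extensions, so for a local field \<open>K\<close> in \<open>'a\<close> and \<open>L / K\<close> finite
  the ring of integers of \<open>L\<close> is the closed unit ball of \<open>L\<close>.
\<close>

abbreviation ambient :: "'a::field ring" (\<open>\<Omega>\<close>)
  where "\<Omega> \<equiv> ring_of_type_algebra"

definition nonarch_abs_value :: "('a::field \<Rightarrow> real) \<Rightarrow> bool" where
  "nonarch_abs_value av \<longleftrightarrow>
     (\<forall>x. av x \<ge> 0) \<and> (\<forall>x. av x = 0 \<longleftrightarrow> x = 0) \<and>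
     (\<forall>x y. av (x * y) = av x * av y) \<and> (\<forall>x y. av (x + y) \<le> max (av x) (av y))"

definition av_dist :: "('a::field \<Rightarrow> real) \<Rightarrow> 'a \<Rightarrow> 'a \<Rightarrow> real" where
  "av_dist av x y = av (x - y)"

definition int_ring :: "('a::field \<Rightarrow> real) \<Rightarrow> 'a set \<Rightarrow> 'a ring" where
  "int_ring av K = \<Omega>\<lparr>carrier := {x \<in> K. av x \<le> 1}\<rparr>"

definition max_ideal :: "('a::field \<Rightarrow> real) \<Rightarrow> 'a set \<Rightarrow> 'a set" where
  "max_ideal av K = {x \<in> K. av x < 1}"

definition max_ideal_pow :: "('a::field \<Rightarrow> real) \<Rightarrow> 'a set \<Rightarrow> nat \<Rightarrow> 'a set" where
  "max_ideal_pow av K n = max_ideal av K [^]\<^bsub>ideals_set (int_ring av K)\<^esub> n"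

definition residue_card :: "('a::field \<Rightarrow> real) \<Rightarrow> 'a set \<Rightarrow> nat" where
  "residue_card av K = card (carrier (int_ring av K Quot max_ideal av K))"

definition local_field :: "('a::field \<Rightarrow> real) \<Rightarrow> 'a set \<Rightarrow> bool" where
  "local_field av K \<longleftrightarrow>
     subfield K \<Omega> \<and>
     Metric_space.mcomplete K (av_dist av) \<and>
     (\<exists>\<pi>\<in>K. 0 < av \<pi> \<and> av \<pi> < 1 \<and> (\<forall>x\<in>K - {0}. \<exists>n::int. av x = av \<pi> powi n)) \<and>
     finite (carrier (int_ring av K Quot max_ideal av K))"

definition number_field :: "'a::field_char_0 set \<Rightarrow> bool" where
  "number_field k \<longleftrightarrow> subfield k \<Omega> \<and> ring.finite_dimension \<Omega> \<rat> k"

definition quadratic_ext :: "'a::field set \<Rightarrow> 'a set \<Rightarrow> bool" where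
  "quadratic_ext K L \<longleftrightarrow> subfield K \<Omega> \<and> subfield L \<Omega> \<and> K \<subseteq> L \<and> ring.dimension \<Omega> 2 K L"

text \<open>Ramification index one; residue fields are finite here, so the residue extension is
  automatically separable.\<close>

definition unramified :: "('a::field \<Rightarrow> real) \<Rightarrow> 'a set \<Rightarrow> 'a set \<Rightarrow> bool" where
  "unramified av K L \<longleftrightarrow> Idl\<^bsub>int_ring av L\<^esub> (max_ideal av K) = max_ideal av L"

text \<open>The nontrivial automorphism of a quadratic extension \<open>L / K\<close>; \<open>extensional\<close> makes it unique
  as a total function.\<close>

definition quad_conj :: "'a::field set \<Rightarrow> 'a set \<Rightarrow> 'a \<Rightarrow> 'a" where
  "quad_conj K L =
     (THE s. s \<in> extensional L \<and> s \<in> ring_iso (\<Omega>\<lparr>carrier := L\<rparr>) (\<Omega>\<lparr>carrier := L\<rparr>) \<and>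
             (\<forall>x\<in>K. s x = x) \<and> (\<exists>x\<in>L. s x \<noteq> x))"

definition quad_trace :: "'a::field set \<Rightarrow> 'a set \<Rightarrow> 'a \<Rightarrow> 'a" where
  "quad_trace K L x = x + quad_conj K L x"

definition quad_norm :: "'a::field set \<Rightarrow> 'a set \<Rightarrow> 'a \<Rightarrow> 'a" where
  "quad_norm K L x = x * quad_conj K L x"

text \<open>Discriminant ideal of a quadratic extension: generated by the discriminants
  \<open>det (\<sigma>\<^sub>i \<omega>\<^sub>j)\<^sup>2\<close> of pairs of integral elements.\<close>

definition discriminant :: "('a::field \<Rightarrow> real) \<Rightarrow> 'a set \<Rightarrow> 'a set \<Rightarrow> 'a set" where
  "discriminant av K L =
     Idl\<^bsub>int_ring av K\<^esub>
       {(\<omega>\<^sub>1 * quad_conj K L \<omega>\<^sub>2 - \<omega>\<^sub>2 * quad_conj K L \<omega>\<^sub>1)\<^sup>2 | \<omega>\<^sub>1 \<omega>\<^sub>2.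
          \<omega>\<^sub>1 \<in> carrier (int_ring av L) \<and> \<omega>\<^sub>2 \<in> carrier (int_ring av L)}"

text \<open>\<open>eisenstein av K b1 b2\<close>: the polynomial \<open>z\<^sup>2 + b1 z + b2\<close> is Eisenstein over the integers of \<open>K\<close>.\<close>

definition eisenstein :: "('a::field \<Rightarrow> real) \<Rightarrow> 'a set \<Rightarrow> 'a \<Rightarrow> 'a \<Rightarrow> bool" where
  "eisenstein av K b1 b2 \<longleftrightarrow>
     b1 \<in> max_ideal av K \<and> b2 \<in> max_ideal av K \<and> b2 \<notin> max_ideal_pow av K 2"

text \<open>The level \<open>lev(L1, L2)\<close> over \<open>K\<close>.  Exponents range over \<open>nat\<close>, since \<open>i = 0\<close> is always
  admissible.  The definite description says that the value is the same for every admissible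
  Eisenstein polynomial.\<close>

definition level_poly :: "('a::field \<Rightarrow> real) \<Rightarrow> 'a set \<Rightarrow> 'a set \<Rightarrow> 'a \<Rightarrow> 'a \<Rightarrow> nat" where
  "level_poly av K L2 b1 b2 =
     (GREATEST i. \<exists>\<eta>\<in>carrier (int_ring av L2).
        quad_trace K L2 \<eta> - b1 \<in> max_ideal_pow av K i \<and>
        quad_norm K L2 \<eta> - b2 \<in> max_ideal_pow av K i)"

definition level :: "('a::field \<Rightarrow> real) \<Rightarrow> 'a set \<Rightarrow> 'a set \<Rightarrow> 'a set \<Rightarrow> nat" where
  "level av K L1 L2 =
     (THE n. \<forall>b1 b2. eisenstein av K b1 b2 \<and>
               generate_field \<Omega> (K \<union> {z. poly [:b2, b1, 1:] z = 0}) = L1 \<longrightarrow>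
               n = level_poly av K L2 b1 b2)"


section \<open>Pairs of Hermitian forms\<close>

type_synonym 'a mat2 = "'a^2^2"

definition map_mat2 :: "('a \<Rightarrow> 'a) \<Rightarrow> 'a mat2 \<Rightarrow> 'a mat2" where
  "map_mat2 s A = (\<chi> i j. s (A $ i $ j))"

definition mat2 :: "'a::zero \<Rightarrow> 'a \<Rightarrow> 'a \<Rightarrow> 'a \<Rightarrow> 'a mat2" where
  "mat2 a b c d = vector [vector [a, b], vector [c, d]]"

definition GL2 :: "'a::field set \<Rightarrow> 'a mat2 set" where
  "GL2 S = {A. (\<forall>i j. A $ i $ j \<in> S) \<and>
               (\<exists>B. (\<forall>i j. B $ i $ j \<in> S) \<and> A ** B = mat 1 \<and> B ** A = mat 1)}"

definition herm_pairs :: "'a::field set \<Rightarrow> 'a set \<Rightarrow> ('a mat2 \<times> 'a mat2) set" where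
  "herm_pairs K L =
     (let H = {A. (\<forall>i j. A $ i $ j \<in> L) \<and> transpose (map_mat2 (quad_conj K L) A) = A} in H \<times> H)"

definition pencil :: "'a::field mat2 \<times> 'a mat2 \<Rightarrow> 'a^2 \<Rightarrow> 'a mat2" where
  "pencil x u = (\<chi> i j. u $ 1 * fst x $ i $ j + u $ 2 * snd x $ i $ j)"

definition disc_form :: "'a::field mat2 \<times> 'a mat2 \<Rightarrow> 'a^2 \<Rightarrow> 'a" where
  "disc_form x u = - det (pencil x u)"

text \<open>A binary quadratic form has distinct roots iff it is a product of two non-proportional linear
  forms over the algebraically closed field.\<close>

definition herm_pairs_ss :: "'a::field set \<Rightarrow> 'a set \<Rightarrow> ('a mat2 \<times> 'a mat2) set" where
  "herm_pairs_ss K L =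
     {x \<in> herm_pairs K L. \<exists>a b c d. a * d - b * c \<noteq> 0 \<and>
        (\<forall>u. disc_form x u = (a * u $ 1 + b * u $ 2) * (c * u $ 1 + d * u $ 2))}"

text \<open>The splitting field over \<open>K\<close> of the form \<open>disc_form x\<close>; the root \<open>(1 : 0)\<close> of the form is
  always rational.\<close>

definition splitting_field :: "'a::field set \<Rightarrow> 'a mat2 \<times> 'a mat2 \<Rightarrow> 'a set" where
  "splitting_field K x =
     generate_field \<Omega> (K \<union> {u $ 1 / u $ 2 | u. u $ 2 \<noteq> 0 \<and> disc_form x u = 0})"

definition ext_splitting_field :: "'a::field set \<Rightarrow> 'a set \<Rightarrow> 'a mat2 \<times> 'a mat2 \<Rightarrow> 'a set" where
  "ext_splitting_field K L x = generate_field \<Omega> (L \<union> splitting_field K x)"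

definition type_rm_rm_ur ::
    "('a::field \<Rightarrow> real) \<Rightarrow> 'a set \<Rightarrow> 'a set \<Rightarrow> 'a mat2 \<times> 'a mat2 \<Rightarrow> bool" where
  "type_rm_rm_ur av K L x \<longleftrightarrow>
     x \<in> herm_pairs_ss K L \<and>
     quadratic_ext K (splitting_field K x) \<and> \<not> unramified av K (splitting_field K x) \<and>
     splitting_field K x \<noteq> L \<and> unramified av L (ext_splitting_field K L x)"

definition type_rm_rm_rm ::
    "('a::field \<Rightarrow> real) \<Rightarrow> 'a set \<Rightarrow> 'a set \<Rightarrow> 'a mat2 \<times> 'a mat2 \<Rightarrow> bool" where
  "type_rm_rm_rm av K L x \<longleftrightarrow>
     x \<in> herm_pairs_ss K L \<and>
     quadratic_ext K (splitting_field K x) \<and> \<not> unramified av K (splitting_field K x) \<and>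
     splitting_field K x \<noteq> L \<and> \<not> unramified av L (ext_splitting_field K L x)"

definition std_rep :: "'a::field \<Rightarrow> 'a \<Rightarrow> 'a mat2 \<times> 'a mat2" where
  "std_rep a1 a2 = (mat2 0 1 1 a1, mat2 1 a1 a1 (a1\<^sup>2 - a2))"


section \<open>The identity component of the stabilizer\<close>

text \<open>
  Over the algebraically closed field, the restriction of scalars of \<open>GL\<^sub>2\<close> along \<open>L / K\<close> becomes
  \<open>GL\<^sub>2 \<times> GL\<^sub>2\<close>, a \<open>K\<close>-point \<open>g\<close> going to \<open>(g, g\<^sup>\<sigma>)\<close>, and the Hermitian matrices become all
  matrices.  So a geometric point of \<open>G\<close> is a triple \<open>(g, g', h)\<close>, acting by
  \<open>M\<^sub>x(u) \<mapsto> g M\<^sub>x(u h) \<^sup>tg'\<close>, and \<open>(g\<^sub>1, g\<^sub>2) \<in> G(K)\<close> is the triple \<open>(g\<^sub>1, g\<^sub>1\<^sup>\<sigma>, g\<^sub>2)\<close>.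
\<close>

type_synonym 'a geom = "'a mat2 \<times> 'a mat2 \<times> 'a mat2"

definition geom_stabilizer :: "'a::field mat2 \<times> 'a mat2 \<Rightarrow> 'a geom set" where
  "geom_stabilizer x =
     {(g, g', h). g \<in> GL2 UNIV \<and> g' \<in> GL2 UNIV \<and> h \<in> GL2 UNIV \<and>
        (\<forall>u. g ** pencil x (u v* h) ** transpose g' = pencil x u)}"

inductive_set polynomial_funs :: "('a::field geom \<Rightarrow> 'a) set" where
  const: "(\<lambda>_. c) \<in> polynomial_funs"
| coord1: "(\<lambda>(g, g', h). g $ i $ j) \<in> polynomial_funs"
| coord2: "(\<lambda>(g, g', h). g' $ i $ j) \<in> polynomial_funs"
| coord3: "(\<lambda>(g, g', h). h $ i $ j) \<in> polynomial_funs"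
| add: "f1 \<in> polynomial_funs \<Longrightarrow> f2 \<in> polynomial_funs \<Longrightarrow> (\<lambda>t. f1 t + f2 t) \<in> polynomial_funs"
| mult: "f1 \<in> polynomial_funs \<Longrightarrow> f2 \<in> polynomial_funs \<Longrightarrow> (\<lambda>t. f1 t * f2 t) \<in> polynomial_funs"

definition zariski :: "'a::field geom topology" where
  "zariski = topology_generated_by {{t. f t \<noteq> 0} | f. f \<in> polynomial_funs}"

definition geom_stabilizer_0 :: "'a::field mat2 \<times> 'a mat2 \<Rightarrow> 'a geom set" where
  "geom_stabilizer_0 x =
     connected_component_of_set (subtopology zariski (geom_stabilizer x)) (mat 1, mat 1, mat 1)"

definition stabilizer_0 ::
    "'a::field set \<Rightarrow> 'a set \<Rightarrow> 'a mat2 \<times> 'a mat2 \<Rightarrow> ('a mat2 \<times> 'a mat2) set" where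
  "stabilizer_0 K L x =
     {(g1, g2). g1 \<in> GL2 L \<and> g2 \<in> GL2 K \<and>
        (g1, map_mat2 (quad_conj K L) g1, g2) \<in> geom_stabilizer_0 x}"

definition max_compact ::
    "('a::field \<Rightarrow> real) \<Rightarrow> 'a set \<Rightarrow> 'a set \<Rightarrow> ('a mat2 \<times> 'a mat2) set" where
  "max_compact av K L = GL2 (carrier (int_ring av L)) \<times> GL2 (carrier (int_ring av K))"


section \<open>Haar measure\<close>

definition haar_measure :: "('g, 'm) monoid_scheme \<Rightarrow> 'g topology \<Rightarrow> 'g measure \<Rightarrow> bool" where
  "haar_measure G T \<mu> \<longleftrightarrow>
     space \<mu> = carrier G \<and> sets \<mu> = sigma_sets (carrier G) {U. openin T U} \<and>
     emeasure \<mu> (carrier G) \<noteq> 0 \<and>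
     (\<forall>g\<in>carrier G. \<forall>A\<in>sets \<mu>. emeasure \<mu> ((\<lambda>h. g \<otimes>\<^bsub>G\<^esub> h) ` A) = emeasure \<mu> A) \<and>
     (\<forall>C. compactin T C \<longrightarrow> emeasure \<mu> C < \<infinity>) \<and>
     (\<forall>A\<in>sets \<mu>. emeasure \<mu> A = (INF U\<in>{U. openin T U \<and> A \<subseteq> U}. emeasure \<mu> U)) \<and>
     (\<forall>U. openin T U \<longrightarrow> emeasure \<mu> U = (SUP C\<in>{C. compactin T C \<and> C \<subseteq> U}. emeasure \<mu> C))"

text \<open>The Haar measure on the multiplicative group of \<open>L\<close> giving the unit group of its ring of
  integers volume one.\<close>

definition normalized_haar :: "('a::field \<Rightarrow> real) \<Rightarrow> 'a set \<Rightarrow> 'a measure \<Rightarrow> bool" where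
  "normalized_haar av L \<mu> \<longleftrightarrow>
     haar_measure (mult_of (\<Omega>\<lparr>carrier := L\<rparr>)) (Metric_space.mtopology (L - {0}) (av_dist av)) \<mu> \<and>
     emeasure \<mu> (Units (int_ring av L)) = 1"

text \<open>
  For \<open>x = std_rep a1 a2\<close> the elements of the identity component have first component
  \<open>mat2 c (- d) (a2 * d) (c - a1 * d)\<close>, and \<open>stab_iso \<alpha>\<close> sends such an element to \<open>c + d * \<alpha>\<close>, where
  \<open>\<alpha>\<close> is a root of \<open>z\<^sup>2 + a1 z + a2\<close>.
\<close>

definition stab_iso :: "'a::field \<Rightarrow> 'a mat2 \<times> 'a mat2 \<Rightarrow> 'a" where
  "stab_iso \<alpha> = (\<lambda>(g1, g2). g1 $ 1 $ 1 - g1 $ 1 $ 2 * \<alpha>)"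

text \<open>Volume of a set of elements of the identity component, for the measure corresponding to
  \<open>\<mu>\<close> under \<open>stab_iso \<alpha>\<close>.\<close>

definition stab_vol :: "'a::field measure \<Rightarrow> 'a \<Rightarrow> ('a mat2 \<times> 'a mat2) set \<Rightarrow> real" where
  "stab_vol \<mu> \<alpha> S = measure \<mu> (stab_iso \<alpha> ` S)"

end

theory Submission
  imports Defs
begin

text \<open>
  Write \<open>K\<close>, \<open>L\<close>, \<open>E\<close> for \<open>kv\<close>, \<open>ktv\<close> and \<open>L(\<alpha>)\<close>, and \<open>q\<close> for the residue cardinality of \<open>K\<close>.  The
  volume is that of \<open>\<O>\<^sub>L[\<alpha>]\<^sup>\<times>\<close>, that is, the reciprocal of its index in \<open>\<O>\<^sub>E\<^sup>\<times>\<close>.  Let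
  \<open>\<O>\<^sub>E = \<O>\<^sub>L[t]\<close> and \<open>\<alpha> = a + b t\<close>, and let \<open>j\<close> be the valuation of \<open>b\<close> in \<open>L\<close>.  Then \<open>\<O>\<^sub>L[\<alpha>]\<close> is
  the order of conductor exponent \<open>j\<close>, and the index is \<open>q\<^sup>j (1 + 1/q)\<close> if \<open>E / L\<close> is unramified
  and \<open>q\<^sup>j\<close> otherwise.

  If \<open>E / L\<close> is unramified, then \<open>j\<close> is the valuation of the difference of \<open>\<alpha>\<close> and its conjugate.  Both
  \<open>\<alpha>\<close> and a uniformizer of \<open>L\<close> are uniformizers of \<open>E\<close>, which is totally ramified over the third
  quadratic subfield, so the differences of the two with their conjugates have the same valuation, and
  \<open>j\<close> is the discriminant exponent of \<open>L / K\<close>.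

  If \<open>E / L\<close> is ramified, then \<open>\<bar>\<alpha> - \<eta>\<bar>\<^sup>2 = \<bar>p(\<eta>)\<bar>\<close> for \<open>\<eta>\<close> in \<open>L\<close>, where \<open>p\<close> is the polynomial of \<open>\<alpha>\<close>, and
  the minimum of the left-hand side has valuation \<open>j + 1/2\<close> over \<open>K\<close>.  Reducing \<open>p(\<eta>)\<close> modulo the
  characteristic polynomial of \<open>\<eta>\<close> translates the right-hand side into congruences for trace and
  norm, so that \<open>j\<close> is the level.
\<close>

section \<open>Quadratic extensions of subfields\<close>

text \<open>The absolute value is given on the whole ambient field, so nothing says in advance that
  conjugations preserve it. Completeness of the base field forces this and yields |x|^2 = |N(x)|, on
  which the valuation arguments rest. The element t comes from a best approximation of a generator
  of E by elements of L. Scaled by a power of the uniformizer, its error is either a unit whose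
  residue is new or has the square root of the value of the uniformizer. In both cases |a + b t| is
  the larger of |a| and |b t|, which gives O_E = O_L[t] and all coordinate estimates.

  Residue characteristic two enters through (x - c)^2 = x^2 - c^2 modulo the maximal ideal: every
  residue is a square, so the residue extensions are separable. For E / L unramified, the
  conjugations of E over L and over M = K(\<alpha>) therefore both move the residue field, and their
  product \<rho> acts trivially on it. The third subfield is never formed: \<rho> and one generator
  fixed by it stand in for it.

  L and M are totally ramified over K, so one set \<open>R\<close> of residue representatives serves
  all three fields, and \<open>card R\<close> is q throughout.\<close>

lemma field_ambient: "field (\<Omega> :: 'a::field ring)"
  by (rule field_from_type_algebra)

lemma ambient_simps [simp]:
  "carrier \<Omega> = (UNIV :: 'a::field set)" "\<one>\<^bsub>\<Omega>\<^esub> = (1::'a)" "\<zero>\<^bsub>\<Omega>\<^esub> = (0::'a)"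
  "x \<oplus>\<^bsub>\<Omega>\<^esub> y = x + (y::'a)" "x \<otimes>\<^bsub>\<Omega>\<^esub> y = x * (y::'a)"
  by (auto simp: ring_of_type_algebra_def)

lemma ambient_uminus [simp]: "\<ominus>\<^bsub>\<Omega>\<^esub> x = - (x::'a::field)"
proof -
  interpret field "\<Omega> :: 'a ring" by (rule field_ambient)
  show ?thesis using minus_equality[of "- x" x] by simp
qed

lemma ambient_inverse: "x \<noteq> 0 \<Longrightarrow> inv\<^bsub>\<Omega>\<^esub> x = inverse (x::'a::field)"
proof -
  interpret field "\<Omega> :: 'a ring" by (rule field_ambient)
  assume "x \<noteq> 0"
  then show ?thesis using comm_inv_char[of x "inverse x"] by simp
qed

section \<open>Elementwise closure properties of subfields\<close>

context
  fixes F :: "'a::field set"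
  assumes sf: "subfield F \<Omega>"
begin

lemma subfield_0: "0 \<in> F" and subfield_1: "1 \<in> F"
  and subfield_add: "x \<in> F \<Longrightarrow> y \<in> F \<Longrightarrow> x + y \<in> F"
  and subfield_mult: "x \<in> F \<Longrightarrow> y \<in> F \<Longrightarrow> x * y \<in> F"
  and subfield_uminus: "x \<in> F \<Longrightarrow> - x \<in> F"
  using subringE[OF subfieldE(1)[OF sf]] by simp_all

lemma subfield_diff: "x \<in> F \<Longrightarrow> y \<in> F \<Longrightarrow> x - y \<in> F"
  using subfield_add[of x "- y"] subfield_uminus by simp

lemma subfield_inverse: "x \<in> F \<Longrightarrow> inverse x \<in> F"
proof -
  interpret field "\<Omega> :: 'a ring" by (rule field_ambient)
  assume "x \<in> F"
  then show ?thesis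
    using subfield_m_inv(1)[OF sf, of x] ambient_inverse[of x] subfield_0 by (cases "x = 0") auto
qed

lemma subfield_divide: "x \<in> F \<Longrightarrow> y \<in> F \<Longrightarrow> x / y \<in> F"
  by (simp add: divide_inverse subfield_mult subfield_inverse)

lemma subfield_power: "x \<in> F \<Longrightarrow> x ^ n \<in> F"
  by (induction n) (auto intro: subfield_mult subfield_1)

lemma subfield_powi: "x \<in> F \<Longrightarrow> x powi n \<in> F"
  by (auto simp: power_int_def intro: subfield_power subfield_inverse)

lemma subfield_numeral: "numeral n \<in> F"
proof -
  have "of_nat m \<in> F" for m by (induction m) (auto intro: subfield_0 subfield_1 subfield_add)
  from this[of "numeral n"] show ?thesis by simp
qed

lemmas subfield_closed = subfield_0 subfield_1 subfield_add subfield_mult subfield_uminus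
  subfield_diff subfield_inverse subfield_divide subfield_power subfield_powi subfield_numeral

end

lemma subfield_ambientI:
  fixes F :: "'a::field set"
  assumes "1 \<in> F" "\<And>x y. x \<in> F \<Longrightarrow> y \<in> F \<Longrightarrow> x + y \<in> F"
    "\<And>x y. x \<in> F \<Longrightarrow> y \<in> F \<Longrightarrow> x * y \<in> F" "\<And>x. x \<in> F \<Longrightarrow> - x \<in> F"
    "\<And>x. x \<in> F \<Longrightarrow> inverse x \<in> F"
  shows "subfield F \<Omega>"
proof -
  interpret field "\<Omega> :: 'a ring" by (rule field_ambient)
  show ?thesis
    by (rule subfieldI', rule subringI) (auto simp: ambient_inverse assms)
qed

lemma generate_field_subset:
  "subfield E \<Omega> \<Longrightarrow> H \<subseteq> E \<Longrightarrow> generate_field \<Omega> H \<subseteq> (E :: 'a::field set)"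
  by (rule field.generate_field_min_subfield1[OF field_ambient]) auto

lemma subfield_generate_field: "subfield (generate_field \<Omega> H) (\<Omega> :: 'a::field ring)"
  by (rule field.generate_field_is_subfield[OF field_ambient]) auto

text \<open>The map \<open>s\<close> is a parameter because \<open>quad_conj\<close> is a definite
  description: a conjugation is first built explicitly, and \<open>quad_conj_eq\<close> then
  identifies it with \<open>quad_conj\<close>.\<close>

locale quad_conjugation =
  fixes F E :: "'a::field_char_0 set" and s :: "'a \<Rightarrow> 'a"
  assumes subfield_base: "subfield F \<Omega>" and subfield_ext: "subfield E \<Omega>"
    and base_subset: "F \<subseteq> E" and base_neq: "F \<noteq> E"
    and conj_in: "x \<in> E \<Longrightarrow> s x \<in> E"
    and conj_add: "x \<in> E \<Longrightarrow> y \<in> E \<Longrightarrow> s (x + y) = s x + s y"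
    and conj_mult: "x \<in> E \<Longrightarrow> y \<in> E \<Longrightarrow> s (x * y) = s x * s y"
    and conj_conj: "x \<in> E \<Longrightarrow> s (s x) = x"
    and conj_fix_iff: "x \<in> E \<Longrightarrow> s x = x \<longleftrightarrow> x \<in> F"
begin

lemmas base_closed = subfield_closed[OF subfield_base]
lemmas ext_closed = subfield_closed[OF subfield_ext]

lemma base_in [intro]: "x \<in> F \<Longrightarrow> x \<in> E"
  using base_subset by auto

lemma conj_base: "x \<in> F \<Longrightarrow> s x = x"
  using conj_fix_iff by auto

lemma conj_uminus: "x \<in> E \<Longrightarrow> s (- x) = - s x"
  using conj_mult[of "-1" x] conj_base[of "-1"] base_closed(1-5) ext_closed(1-5) by auto

lemma conj_diff: "x \<in> E \<Longrightarrow> y \<in> E \<Longrightarrow> s (x - y) = s x - s y"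
  using conj_add[of x "- y"] conj_uminus[of y] ext_closed(5) by auto

lemma conj_eq_0_iff: "x \<in> E \<Longrightarrow> s x = 0 \<longleftrightarrow> x = 0"
  using conj_conj[of x] conj_base[of 0] base_closed(1) by auto

lemma conj_inverse: "x \<in> E \<Longrightarrow> s (inverse x) = inverse (s x)"
proof (cases "x = 0")
  case True then show ?thesis using conj_base[of 0] base_closed(1) by simp
next
  case False
  assume x: "x \<in> E"
  have "s (inverse x) * s x = s (inverse x * x)" using x ext_closed(7)[of x] conj_mult by metis
  also have "\<dots> = 1" using False conj_base[of 1] base_closed(2) by simp
  finally show ?thesis by (metis inverse_unique mult.commute)
qed

lemma conj_divide: "x \<in> E \<Longrightarrow> y \<in> E \<Longrightarrow> s (x / y) = s x / s y"
  by (simp add: divide_inverse conj_mult conj_inverse ext_closed(7))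

lemma conj_power: "x \<in> E \<Longrightarrow> s (x ^ n) = s x ^ n"
  by (induction n) (auto simp: conj_mult ext_closed(9) conj_base base_closed(2))

lemma trace_in: "x \<in> E \<Longrightarrow> x + s x \<in> F"
  using conj_fix_iff[of "x + s x"] conj_add[of x "s x"] conj_conj conj_in ext_closed(3)
  by (auto simp: add.commute)

lemma norm_in: "x \<in> E \<Longrightarrow> x * s x \<in> F"
  using conj_fix_iff[of "x * s x"] conj_mult[of x "s x"] conj_conj conj_in ext_closed(4)
  by (auto simp: mult.commute)

lemma conj_neq: "t \<in> E \<Longrightarrow> t \<notin> F \<Longrightarrow> t - s t \<noteq> 0"
  using conj_fix_iff[of t] by (metis eq_iff_diff_eq_0)

text \<open>Galois descent: the coordinates of \<open>x\<close> in the basis \<open>1, t\<close> are fixed by the conjugation.\<close>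

lemma basis_coords:
  assumes "x \<in> E" "t \<in> E" "t \<notin> F"
  obtains a b where "a \<in> F" "b \<in> F" "x = a + b * t" "b = (x - s x) / (t - s t)"
proof -
  define b where "b = (x - s x) / (t - s t)"
  note [simp] = conj_in conj_divide conj_diff conj_conj conj_mult ext_closed
  have n: "t - s t \<noteq> 0" by (rule conj_neq[OF assms(2,3)])
  have bE: "b \<in> E" using assms by (simp add: b_def)
  have "s b = (s x - x) / (s t - t)" using assms by (simp add: b_def)
  also have "\<dots> = b" using n unfolding b_def by (metis minus_diff_eq minus_divide_divide)
  finally have b: "b \<in> F" using bE conj_fix_iff by auto
  have "s (x - b * t) = s x - b * s t" using assms bE b conj_base by simp
  also have "\<dots> = x - b * t" using n by (simp add: b_def field_simps)
  finally have "x - b * t \<in> F" using conj_fix_iff[of "x - b * t"] assms bE by simp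
  with b show ?thesis using that[of "x - b * t" b] b_def by simp
qed

lemma basis_unique:
  assumes "a \<in> F" "b \<in> F" "c \<in> F" "d \<in> F" "t \<notin> F" "a + b * t = c + d * t"
  shows "a = c" "b = d"
proof -
  have "(b - d) * t = c - a" using assms(6) by (simp add: algebra_simps)
  then have "b \<noteq> d \<Longrightarrow> t = (c - a) / (b - d)" by (simp add: nonzero_eq_divide_eq mult.commute)
  then have "b = d"
    using assms base_closed(6)[of c a] base_closed(6)[of b d] base_closed(8)[of "c - a" "b - d"] by auto
  then show "a = c" "b = d" using assms(6) by auto
qed

lemma ext_eq: "t \<in> E \<Longrightarrow> t \<notin> F \<Longrightarrow> E = {a + b * t | a b. a \<in> F \<and> b \<in> F}"
proof (intro equalityI subsetI)
  fix x assume t: "t \<in> E" "t \<notin> F" and "x \<in> E"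
  then obtain a b where "a \<in> F" "b \<in> F" "x = a + b * t" using basis_coords by metis
  then show "x \<in> {a + b * t | a b. a \<in> F \<and> b \<in> F}" by blast
qed (auto intro: ext_closed(3,4))

text \<open>Both \<open>t\<close> and \<open>s t\<close> satisfy z^2 = T z - N. Subtracting the two
  equations leaves a factor t - s t, which is nonzero.\<close>

lemma conj_root:
  assumes "t \<in> E" "t \<notin> F" "T \<in> F" "N \<in> F" "t * t = T * t - N"
  shows "s t = T - t"
proof -
  have st: "s t * s t = T * s t - N"
    using assms conj_mult[of t t] conj_diff[of "T * t" N] conj_mult[of T t] conj_base ext_closed(4)
      base_in by simp
  have "(t - s t) * (t + s t - T) = (t * t - s t * s t) - T * (t - s t)"
    by (simp add: algebra_simps)
  also have "\<dots> = 0" unfolding assms(5) st by (simp add: algebra_simps)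
  finally have "(t - s t) * (t + s t - T) = 0" .
  then have "t + s t - T = 0" using conj_neq[OF assms(1,2)] by (metis mult_eq_0_iff)
  then show ?thesis by (simp add: algebra_simps)
qed

text \<open>An automorphism fixing \<open>F\<close> is determined by the image of a generator, and
  this image is a root of the same quadratic polynomial: either the generator itself, which gives
  the identity, or its conjugate.\<close>

lemma quad_conj_eq: "x \<in> E \<Longrightarrow> quad_conj F E x = s x"
proof -
  assume x: "x \<in> E"
  define P where "P r \<longleftrightarrow> r \<in> extensional E \<and> r \<in> ring_iso (\<Omega>\<lparr>carrier := E\<rparr>) (\<Omega>\<lparr>carrier := E\<rparr>) \<and>
             (\<forall>x\<in>F. r x = x) \<and> (\<exists>x\<in>E. r x \<noteq> x)" for r
  obtain \<theta> where \<theta>: "\<theta> \<in> E" "\<theta> \<notin> F" using base_subset base_neq by auto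
  have iso: "restrict s E \<in> ring_iso (\<Omega>\<lparr>carrier := E\<rparr>) (\<Omega>\<lparr>carrier := E\<rparr>)"
  proof (rule ring_iso_memI)
    show "bij_betw (restrict s E) (carrier (\<Omega>\<lparr>carrier := E\<rparr>)) (carrier (\<Omega>\<lparr>carrier := E\<rparr>))"
      by (rule bij_betw_byWitness[where f' = s]) (auto simp: conj_conj conj_in)
  qed (auto simp: conj_add conj_mult conj_in ext_closed conj_base base_closed)
  have "P (restrict s E)"
    unfolding P_def using iso \<theta> conj_fix_iff by (auto simp: conj_base)
  moreover have "r = restrict s E" if "P r" for r
  proof -
    from that have rext: "r \<in> extensional E" and hom: "r \<in> ring_hom (\<Omega>\<lparr>carrier := E\<rparr>) (\<Omega>\<lparr>carrier := E\<rparr>)"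
      and rF: "\<And>x. x \<in> F \<Longrightarrow> r x = x" and nid: "\<exists>x\<in>E. r x \<noteq> x"
      by (auto simp: P_def ring_iso_def)
    have radd: "r (x + y) = r x + r y" and rmult: "r (x * y) = r x * r y" if "x \<in> E" "y \<in> E" for x y
      using ring_hom_add[OF hom, of x y] ring_hom_mult[OF hom, of x y] that by auto
    have rval: "r (a + b * \<theta>) = a + b * r \<theta>" if "a \<in> F" "b \<in> F" for a b
      using that radd[of a "b * \<theta>"] rmult[of b \<theta>] rF \<theta> ext_closed(4) base_in by simp
    define T N where "T = \<theta> + s \<theta>" and "N = \<theta> * s \<theta>"
    have TN: "T \<in> F" "N \<in> F" "\<theta> * \<theta> = - N + T * \<theta>"
      using trace_in norm_in \<theta> by (auto simp: T_def N_def algebra_simps)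
    have "r \<theta> * r \<theta> = - N + T * r \<theta>"
      using rval[of "-N" T] TN rmult[of \<theta> \<theta>] \<theta> base_closed(5) by metis
    then have "(r \<theta> - \<theta>) * (r \<theta> - s \<theta>) = 0" by (simp add: T_def N_def algebra_simps)
    moreover have "r \<theta> \<noteq> \<theta>"
    proof
      assume eq: "r \<theta> = \<theta>"
      from nid obtain y where y: "y \<in> E" "r y \<noteq> y" by auto
      from basis_coords[OF y(1) \<theta>] obtain a b where "a \<in> F" "b \<in> F" "y = a + b * \<theta>" by metis
      with rval y eq show False by auto
    qed
    ultimately have r\<theta>: "r \<theta> = s \<theta>" by simp
    show ?thesis
    proof
      fix y
      show "r y = restrict s E y"
      proof (cases "y \<in> E")
        case True
        from basis_coords[OF True \<theta>] obtain a b where ab: "a \<in> F" "b \<in> F" "y = a + b * \<theta>" by metis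
        then have "s y = a + b * s \<theta>"
          using \<theta> conj_add[of a "b * \<theta>"] conj_mult[of b \<theta>] conj_base ext_closed(4) base_in by simp
        with rval ab r\<theta> True show ?thesis by auto
      next
        case False with rext show ?thesis by (auto simp: extensional_def)
      qed
    qed
  qed
  ultimately have "(THE r. P r) = restrict s E" by (rule the_equality)
  with x show ?thesis unfolding quad_conj_def P_def by simp
qed

lemma quad_conj_is_conjugation: "quad_conjugation F E (quad_conj F E)"
  using base_subset base_neq subfield_base subfield_ext
  by (intro quad_conjugation.intro)
    (simp_all add: quad_conj_eq conj_in conj_add conj_mult conj_conj conj_fix_iff ext_closed)

end

text \<open>The conjugation sends \<open>t\<close> to the other root T - t; independence of 1 and
  \<open>t\<close> makes this well defined. Inverses exist because x times its conjugate lies in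
  \<open>F\<close>. Only elements of \<open>F\<close> are fixed: otherwise \<open>t\<close> would be
  T / 2, an element of \<open>F\<close> in characteristic zero.\<close>

lemma quad_conjugation_adjoin:
  fixes F :: "'a::field_char_0 set"
  assumes F: "subfield F \<Omega>" and t: "t \<notin> F" "T \<in> F" "N \<in> F" "t * t = T * t - N"
  defines "E \<equiv> {a + b * t | a b. a \<in> F \<and> b \<in> F}"
  shows "quad_conjugation F E (quad_conj F E)"
proof -
  note cl = subfield_closed[OF F]
  have uniq: "a = c \<and> b = d" if "a \<in> F" "b \<in> F" "c \<in> F" "d \<in> F" "a + b * t = c + d * t" for a b c d
  proof -
    have "(b - d) * t = c - a" using that(5) by (simp add: algebra_simps)
    then have "b \<noteq> d \<Longrightarrow> t = (c - a) / (b - d)" by (simp add: nonzero_eq_divide_eq mult.commute)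
    then have "b = d"
      using that t(1) cl(6)[of c a] cl(6)[of b d] cl(8)[of "c - a" "b - d"] by auto
    then show ?thesis using that(5) by auto
  qed
  define s where "s x = (THE y. \<exists>a\<in>F. \<exists>b\<in>F. x = a + b * t \<and> y = a + b * (T - t))" for x
  have s: "s (a + b * t) = a + b * (T - t)" if "a \<in> F" "b \<in> F" for a b
    unfolding s_def
  proof (rule the_equality)
    fix y assume "\<exists>c\<in>F. \<exists>d\<in>F. a + b * t = c + d * t \<and> y = c + d * (T - t)"
    then obtain c d where cd: "c \<in> F" "d \<in> F" "a + b * t = c + d * t" "y = c + d * (T - t)" by blast
    with uniq[OF that cd(1-3)] show "y = a + b * (T - t)" by simp
  qed (use that in blast)
  have mul: "(a + b * t) * (c + d * t) = (a * c - b * d * N) + (a * d + b * c + b * d * T) * t" for a b c d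
  proof -
    have "(a + b * t) * (c + d * t) = a * c + (a * d + b * c) * t + b * d * (t * t)"
      by (simp add: algebra_simps)
    also have "\<dots> = (a * c - b * d * N) + (a * d + b * c + b * d * T) * t"
      unfolding t(4) by (simp add: algebra_simps)
    finally show ?thesis .
  qed
  have mul': "(a + b * (T - t)) * (c + d * (T - t)) = (a * c - b * d * N) + (a * d + b * c + b * d * T) * (T - t)" for a b c d
  proof -
    have "(T - t) * (T - t) = T * (T - t) - N" using t(4) by (simp add: algebra_simps)
    then have "b * d * ((T - t) * (T - t)) = b * d * (T * (T - t) - N)" by simp
    then show ?thesis by (simp add: algebra_simps)
  qed
  have EI: "a + b * t \<in> E" if "a \<in> F" "b \<in> F" for a b using that by (auto simp: E_def)
  have EE: "\<exists>a\<in>F. \<exists>b\<in>F. x = a + b * t" if "x \<in> E" for x using that by (auto simp: E_def)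
  have conjE: "a + b * (T - t) \<in> E" if "a \<in> F" "b \<in> F" for a b
    using EI[of "a + b * T" "- b"] that t cl by (simp add: algebra_simps)
  have FE: "x \<in> E" if "x \<in> F" for x using EI[of x 0] that cl by simp
  have nrm: "(a + b * t) * (a + b * (T - t)) \<in> F" if "a \<in> F" "b \<in> F" for a b
  proof -
    have "(a + b * t) * (a + b * (T - t)) = a * a + a * b * T + b * b * (T * t - t * t)"
      by (simp add: algebra_simps)
    also have "\<dots> = a * a + a * b * T + b * b * N" using t(4) by simp
    finally show ?thesis using that t cl by simp
  qed
  have mulE: "x * y \<in> E" if "x \<in> E" "y \<in> E" for x y
  proof -
    from EE[OF that(1)] EE[OF that(2)] obtain a b c d where
      "a \<in> F" "b \<in> F" "c \<in> F" "d \<in> F" "x = a + b * t" "y = c + d * t" by metis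
    then show ?thesis using EI[of "a * c - b * d * N" "a * d + b * c + b * d * T"] t cl mul[of a b c d] by simp
  qed
  have sfE: "subfield E \<Omega>"
  proof (rule subfield_ambientI)
    show "1 \<in> E" using FE cl by simp
    show "x + y \<in> E" if "x \<in> E" "y \<in> E" for x y
    proof -
      from EE[OF that(1)] EE[OF that(2)] obtain a b c d where
        "a \<in> F" "b \<in> F" "c \<in> F" "d \<in> F" "x = a + b * t" "y = c + d * t" by metis
      then show ?thesis using EI[of "a + c" "b + d"] cl by (simp add: algebra_simps)
    qed
    show "- x \<in> E" if "x \<in> E" for x
    proof -
      from EE[OF that] obtain a b where "a \<in> F" "b \<in> F" "x = a + b * t" by metis
      then show ?thesis using EI[of "- a" "- b"] cl by (simp add: algebra_simps)
    qed
    show "inverse x \<in> E" if "x \<in> E" for x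
    proof (cases "x = 0")
      case True then show ?thesis using that by simp
    next
      case False
      from EE[OF that] obtain a b where ab: "a \<in> F" "b \<in> F" "x = a + b * t" by metis
      have "a + b * (T - t) \<noteq> 0"
      proof
        assume "a + b * (T - t) = 0"
        then have "(a + b * T) + (- b) * t = 0 + 0 * t" by (simp add: algebra_simps)
        from uniq[OF _ _ _ _ this] ab t cl have "a + b * T = 0" "b = 0" by auto
        then have "a = 0" by simp
        then show False using False ab \<open>b = 0\<close> by simp
      qed
      moreover have "inverse x = y * inverse (x * y)" if "y \<noteq> 0" for y
        using False that by (simp add: field_simps)
      ultimately have "inverse x = (a + b * (T - t)) * inverse (x * (a + b * (T - t)))" by blast
      with nrm[OF ab(1,2)] conjE[OF ab(1,2)] show ?thesis
        using ab(3) mulE FE cl by metis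
    qed
  qed (use mulE in auto)
  have "quad_conjugation F E s"
  proof (rule quad_conjugation.intro)
    show "F \<noteq> E" using EI[of 0 1] cl t by auto
    fix x assume x: "x \<in> E"
    from EE[OF x] obtain a b where ab: "a \<in> F" "b \<in> F" "x = a + b * t" by metis
    show "s x \<in> E" using ab s conjE by simp
    show "s (s x) = x"
    proof -
      have sx: "s x = (a + b * T) + (- b) * t" using s ab by (simp add: algebra_simps)
      have "s (s x) = (a + b * T) + (- b) * (T - t)" unfolding sx by (rule s) (use ab t cl in auto)
      then show ?thesis using ab by (simp add: algebra_simps)
    qed
    show "s x = x \<longleftrightarrow> x \<in> F"
    proof
      assume "s x = x"
      then have "b * (T - 2 * t) = 0" using ab s by (simp add: algebra_simps)
      then have "b = 0 \<or> t = T / 2" by (auto simp: field_simps)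
      moreover have "t \<noteq> T / 2" using t(1) cl(8)[OF t(2) cl(11)] by metis
      ultimately show "x \<in> F" using ab by auto
    next
      assume "x \<in> F" then show "s x = x" using s[of x 0] cl by simp
    qed
    fix y assume y: "y \<in> E"
    from EE[OF y] obtain c d where cd: "c \<in> F" "d \<in> F" "y = c + d * t" by metis
    have sx: "s x = a + b * (T - t)" and sy: "s y = c + d * (T - t)" using s ab cd by auto
    have xy: "x + y = (a + c) + (b + d) * t" using ab cd by (simp add: algebra_simps)
    have "s (x + y) = (a + c) + (b + d) * (T - t)" unfolding xy by (rule s) (use ab cd cl in auto)
    then show "s (x + y) = s x + s y" unfolding sx sy by (simp add: algebra_simps)
    have xy': "x * y = (a * c - b * d * N) + (a * d + b * c + b * d * T) * t"
      using mul ab cd by simp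
    show "s (x * y) = s x * s y"
      unfolding sx sy mul' xy' by (rule s) (use ab cd t cl in auto)
  qed (use F sfE FE in blast)+
  then show ?thesis by (rule quad_conjugation.quad_conj_is_conjugation)
qed

text \<open>Any \<open>t\<close> outside \<open>K\<close> is independent of 1, so the two elements
  exhaust dimension two and L = K + K t, where the explicit conjugation exists.\<close>

lemma quad_conjugation_quadratic_ext:
  fixes K :: "'a::field_char_0 set"
  assumes "quadratic_ext K L"
  shows "quad_conjugation K L (quad_conj K L)"
proof -
  interpret field "\<Omega> :: 'a ring" by (rule field_ambient)
  from assms have K: "subfield K \<Omega>" and L: "subfield L \<Omega>" and KL: "K \<subseteq> L" and dim: "dimension 2 K L"
    by (auto simp: quadratic_ext_def)
  note cl = subfield_closed[OF K] and clL = subfield_closed[OF L]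
  have line: "line_extension K v E = {a * v + y | a y. a \<in> K \<and> y \<in> E}" for v E
    by (auto simp: line_extension_def set_add_def set_mult_def r_coset_def)
  have one: "independent K [1]"
    using li_Cons[of 1 K "[]"] by simp
  have "K \<noteq> L"
  proof
    assume "K = L"
    then have "dimension 1 K L" using dimension_one[OF K] by simp
    with dimension_is_inj[OF K dim, of 1] show False by simp
  qed
  then obtain t where t: "t \<in> L" "t \<notin> K" using KL by auto
  have sp: "x \<in> Span K [t, 1] \<longleftrightarrow> (\<exists>a\<in>K. \<exists>b\<in>K. x = a * t + b)" for x
    by (auto simp: line)
  have "1 \<notin> Span K []" by simp
  have "t \<notin> Span K [1]" using t by (auto simp: line)
  then have ind: "independent K [t, 1]" using li_Cons[of t K "[1]"] one by simp
  have "Span K [t, 1] = L"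
    by (rule independent_length_eq_dimension[OF K dim ind, THEN iffD1]) (use t clL in auto)
  then have Leq: "L = {a + b * t | a b. a \<in> K \<and> b \<in> K}"
    using sp by (auto simp: add.commute)
  have "t * t \<in> L" using t clL by auto
  then obtain N T where "N \<in> K" "T \<in> K" "t * t = N + T * t" using Leq by blast
  then have "quad_conjugation K {a + b * t | a b. a \<in> K \<and> b \<in> K}
      (quad_conj K {a + b * t | a b. a \<in> K \<and> b \<in> K})"
    by (intro quad_conjugation_adjoin[OF K t(2), of T "- N"]) (auto intro: cl)
  then show ?thesis unfolding Leq[symmetric] .
qed

section \<open>Non-archimedean absolute values\<close>

locale valued =
  fixes av :: "'a::field_char_0 \<Rightarrow> real"
  assumes nonarch: "nonarch_abs_value av"
begin

lemma av_nonneg [simp]: "av x \<ge> 0"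
  and av_eq_0 [simp]: "av x = 0 \<longleftrightarrow> x = 0"
  and av_mult: "av (x * y) = av x * av y"
  and av_add: "av (x + y) \<le> max (av x) (av y)"
  using nonarch by (auto simp: nonarch_abs_value_def)

lemma av_pos [simp]: "av x > 0 \<longleftrightarrow> x \<noteq> 0"
  using av_nonneg[of x] av_eq_0[of x] by linarith

lemma av_0 [simp]: "av 0 = 0" by simp

lemma av_1 [simp]: "av 1 = 1"
  using av_mult[of 1 1] av_eq_0[of 1] by (simp del: av_eq_0)

lemma av_minus [simp]: "av (- x) = av x"
proof -
  have "av (- 1) * av (- 1) = 1" using av_mult[of "-1" "-1"] by simp
  then have "(av (- 1))\<^sup>2 = 1\<^sup>2" by (simp add: power2_eq_square)
  then have "av (- 1) = 1" using av_nonneg[of "-1"] by (simp add: power2_eq_1_iff)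
  then show ?thesis using av_mult[of "-1" x] by simp
qed

lemma av_diff: "av (x - y) \<le> max (av x) (av y)"
  using av_add[of x "- y"] by simp

lemma av_diff_commute: "av (x - y) = av (y - x)"
  using av_minus[of "x - y"] by simp

lemma av_inverse: "av (inverse x) = inverse (av x)"
proof (cases "x = 0")
  case False
  then have "av x * av (inverse x) = 1" using av_mult[of x "inverse x"] by simp
  then show ?thesis by (metis inverse_unique)
qed simp

lemma av_divide: "av (x / y) = av x / av y"
  by (simp add: divide_inverse av_mult av_inverse)

lemma av_power: "av (x ^ n) = av x ^ n"
  by (induction n) (auto simp: av_mult)

lemma av_powi: "av (x powi n) = av x powi n"
  by (auto simp: power_int_def av_power av_inverse)

lemma av_add_le: "av x \<le> c \<Longrightarrow> av y \<le> c \<Longrightarrow> av (x + y) \<le> c"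
  using av_add[of x y] by linarith

lemma av_add_less: "av x < c \<Longrightarrow> av y < c \<Longrightarrow> av (x + y) < c"
  using av_add[of x y] by linarith

lemma av_diff_le: "av x \<le> c \<Longrightarrow> av y \<le> c \<Longrightarrow> av (x - y) \<le> c"
  using av_diff[of x y] by linarith

lemma av_diff_less: "av x < c \<Longrightarrow> av y < c \<Longrightarrow> av (x - y) < c"
  using av_diff[of x y] by linarith

lemma av_mult_le_1: "av x \<le> c \<Longrightarrow> av y \<le> 1 \<Longrightarrow> av (x * y) \<le> c"
  using mult_mono[of "av x" c "av y" 1] av_nonneg[of x] av_nonneg[of y] unfolding av_mult by linarith

lemma av_mult_less_1: "av x < c \<Longrightarrow> av y \<le> 1 \<Longrightarrow> av (x * y) < c"
  using av_mult_le_1[of x "av x" y] by simp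

lemma av_add_eq_right: "av x < av y \<Longrightarrow> av (x + y) = av y"
  using av_add[of x y] av_diff[of "x + y" x] by auto

lemma av_add_eq: "av x \<noteq> av y \<Longrightarrow> av (x + y) = max (av x) (av y)"
  using av_add_eq_right[of x y] av_add_eq_right[of y x] by (auto simp: add.commute max_def)

lemma Metric_space_av: "Metric_space F (av_dist av)"
proof
  show "av_dist av x z \<le> av_dist av x y + av_dist av y z" for x y z
    using av_add_le[of "x - y" "av (x - y) + av (y - z)" "y - z"] by (simp add: av_dist_def)
qed (auto simp: av_dist_def av_diff_commute)

lemma mcomplete_av_iff:
  "Metric_space.mcomplete F (av_dist av) \<longleftrightarrow>
     (\<forall>u. (\<forall>n::nat. u n \<in> F) \<and> (\<forall>e>0. \<exists>N. \<forall>m\<ge>N. \<forall>n\<ge>N. av (u m - u n) < e)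
        \<longrightarrow> (\<exists>l\<in>F. (\<lambda>n. av (u n - l)) \<longlonglongrightarrow> 0))"
proof -
  interpret Metric_space F "av_dist av" by (rule Metric_space_av)
  have lim: "limitin mtopology u l sequentially \<longleftrightarrow> l \<in> F \<and> (\<lambda>n. av (u n - l)) \<longlonglongrightarrow> 0"
    if "\<forall>n. u n \<in> F" for u l
    using that by (simp add: limit_metric_sequentially lim_sequentially av_dist_def dist_real_def) 
  have cau: "MCauchy u \<longleftrightarrow> (\<forall>n. u n \<in> F) \<and> (\<forall>e>0. \<exists>N. \<forall>m\<ge>N. \<forall>n\<ge>N. av (u m - u n) < e)" for u
    unfolding MCauchy_def av_dist_def image_subset_iff by simp
  show ?thesis
    unfolding mcomplete_def cau by (intro all_cong1 imp_cong refl) (auto simp: lim)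
qed

text \<open>The point \<open>z\<close> may lie anywhere in the ambient field. This is how
  approximations from \<open>F\<close> force an element of an extension into
  \<open>F\<close>.\<close>

lemma limit_in_complete:
  assumes "Metric_space.mcomplete F (av_dist av)" "\<And>n::nat. u n \<in> F" "(\<lambda>n. av (u n - z)) \<longlonglongrightarrow> 0"
  shows "z \<in> F"
proof -
  have cauchy: "\<forall>e>0. \<exists>N. \<forall>m\<ge>N. \<forall>n\<ge>N. av (u m - u n) < e"
  proof (intro allI impI)
    fix e :: real assume "e > 0"
    with assms(3) obtain N where N: "\<forall>n\<ge>N. av (u n - z) < e"
      by (auto simp: lim_sequentially dist_real_def)
    show "\<exists>N. \<forall>m\<ge>N. \<forall>n\<ge>N. av (u m - u n) < e"
    proof (intro exI allI impI)
      fix m n assume "m \<ge> N" "n \<ge> N"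
      then show "av (u m - u n) < e" using av_diff_less[of "u m - z" e "u n - z"] N by simp
    qed
  qed
  from assms(1)[unfolded mcomplete_av_iff, THEN spec, of u] assms(2) cauchy
  obtain l where l: "l \<in> F" "(\<lambda>n. av (u n - l)) \<longlonglongrightarrow> 0" by auto
  have "(\<lambda>n. av (u n - l) + av (u n - z)) \<longlonglongrightarrow> 0" using tendsto_add[OF l(2) assms(3)] by simp
  moreover have "av (z - l) \<le> av (u n - l) + av (u n - z)" for n
    using av_diff_le[of "u n - l" "av (u n - l) + av (u n - z)" "u n - z"] by simp
  ultimately have "av (z - l) \<le> 0" by (intro LIMSEQ_le_const) auto
  then show ?thesis using l(1) by (metis av_nonneg av_eq_0 eq_iff_diff_eq_0 order_antisym)
qed

end

lemma powi_less_iff: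
  fixes r :: real assumes "0 < r" "r < 1" shows "r powi m < r powi n \<longleftrightarrow> n < m"
  by (metis assms linorder_neqE_linordered_idom not_less_iff_gr_or_eq power_int_strict_decreasing)

lemma powi_le_iff:
  fixes r :: real assumes "0 < r" "r < 1" shows "r powi m \<le> r powi n \<longleftrightarrow> n \<le> m"
  using powi_less_iff[OF assms, of n m] by linarith

lemma powi_eq_iff:
  fixes r :: real assumes "0 < r" "r < 1" shows "r powi m = r powi n \<longleftrightarrow> n = m"
  using powi_le_iff[OF assms, of n m] powi_le_iff[OF assms, of m n] by force

text \<open>The set \<open>R\<close> represents the residue field.\<close>

locale discrete_valued = valued av for av :: "'a::field_char_0 \<Rightarrow> real" +
  fixes F :: "'a set" and p :: 'a and R :: "'a set"
  assumes subfield: "subfield F \<Omega>"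
    and complete: "Metric_space.mcomplete F (av_dist av)"
    and p_in: "p \<in> F" and p_pos: "0 < av p" and p_less_1: "av p < 1"
    and value_group: "x \<in> F \<Longrightarrow> x \<noteq> 0 \<Longrightarrow> \<exists>n::int. av x = av p powi n"
    and reps_in: "r \<in> R \<Longrightarrow> r \<in> F" and reps_int: "r \<in> R \<Longrightarrow> av r \<le> 1"
    and reps_finite: "finite R"
    and reps_ex: "x \<in> F \<Longrightarrow> av x \<le> 1 \<Longrightarrow> \<exists>r\<in>R. av (x - r) < 1"
    and reps_unique: "r \<in> R \<Longrightarrow> r' \<in> R \<Longrightarrow> av (r - r') < 1 \<Longrightarrow> r = r'"
begin

lemmas F_closed = subfield_closed[OF subfield]

lemmas p_powi_less_iff = powi_less_iff[OF p_pos p_less_1]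
lemmas p_powi_le_iff = powi_le_iff[OF p_pos p_less_1]
lemmas p_powi_eq_iff = powi_eq_iff[OF p_pos p_less_1]

lemma p_neq_0: "p \<noteq> 0" using p_pos by auto

lemma less_1_imp_le_p: "x \<in> F \<Longrightarrow> av x < 1 \<Longrightarrow> av x \<le> av p"
proof (cases "x = 0")
  case False
  assume x: "x \<in> F" "av x < 1"
  from value_group[OF x(1) False] obtain n where n: "av x = av p powi n" ..
  with x(2) have "0 < n" using p_powi_less_iff[of n 0] by simp
  then show ?thesis using n p_powi_le_iff[of n 1] by simp
qed auto

lemma reps_nonempty: "R \<noteq> {}"
  using reps_ex[of 0] F_closed(1) by auto

section \<open>Representatives modulo powers of the maximal ideal\<close>

definition reps_mod :: "nat \<Rightarrow> 'a set \<Rightarrow> bool" where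
  "reps_mod n S \<longleftrightarrow> S \<subseteq> {x\<in>F. av x \<le> 1} \<and> finite S \<and> card S = card R ^ n \<and>
     (\<forall>x\<in>F. av x \<le> 1 \<longrightarrow> (\<exists>r\<in>S. av (x - r) \<le> av p ^ n)) \<and>
     (\<forall>r\<in>S. \<forall>r'\<in>S. av (r - r') \<le> av p ^ n \<longrightarrow> r = r')"

text \<open>Expansion in digits: each representative modulo p^n is refined by adding p^n times a
  residue representative.\<close>

lemma ex_reps_mod: "\<exists>S. reps_mod n S"
proof (induction n)
  case 0
  have "reps_mod 0 {0}" using F_closed(1) by (auto simp: reps_mod_def)
  then show ?case ..
next
  case (Suc n)
  then obtain S where RS: "reps_mod n S" ..
  have S: "S \<subseteq> {x\<in>F. av x \<le> 1}" "finite S" "card S = card R ^ n"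
    "\<And>x. x \<in> F \<Longrightarrow> av x \<le> 1 \<Longrightarrow> \<exists>r\<in>S. av (x - r) \<le> av p ^ n"
    "\<And>r r'. r \<in> S \<Longrightarrow> r' \<in> S \<Longrightarrow> av (r - r') \<le> av p ^ n \<Longrightarrow> r = r'"
    using RS unfolding reps_mod_def by simp_all
  define f where "f = (\<lambda>(a, b). a + p ^ n * b)"
  have pn: "av (p ^ n * b) \<le> av p ^ n" if "av b \<le> 1" for b
    using av_mult_le_1[of "p ^ n" "av p ^ n" b] that by (simp add: av_power)
  have pn1: "av p ^ n \<le> 1" using p_less_1 p_pos by (simp add: power_le_one)
  have pSuc: "av p ^ Suc n < av p ^ n" using p_less_1 p_pos by simp
  have key: "a = c \<and> b = d" if "a \<in> S" "c \<in> S" "b \<in> R" "d \<in> R"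
    "av (f (a, b) - f (c, d)) \<le> av p ^ Suc n" for a b c d
  proof -
    have *: "av (p ^ n * (d - b)) \<le> av p ^ n"
      by (rule pn, rule av_diff_le) (use that reps_int in auto)
    have "av ((f (a, b) - f (c, d)) + p ^ n * (d - b)) \<le> av p ^ n"
      by (rule av_add_le) (use that(5) pSuc * in linarith)+
    then have "av (a - c) \<le> av p ^ n" by (simp add: f_def algebra_simps)
    then have ac: "a = c" using S(5) that by blast
    then have "av (p ^ n * (b - d)) \<le> av p ^ Suc n" using that(5) by (simp add: f_def algebra_simps)
    then have "av p ^ n * av (b - d) \<le> av p ^ n * av p" by (simp add: av_mult av_power mult.commute)
    then have "av (b - d) \<le> av p" using p_pos by simp
    then have "av (b - d) < 1" using p_less_1 by linarith
    then show ?thesis using ac reps_unique that by blast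
  qed
  have inj: "inj_on f (S \<times> R)"
  proof (rule inj_onI)
    fix x y assume xy: "x \<in> S \<times> R" "y \<in> S \<times> R" "f x = f y"
    then have "av (f x - f y) \<le> av p ^ Suc n" using p_pos by simp
    with xy(1,2) key show "x = y" by (cases x; cases y) blast
  qed
  have "\<exists>r\<in>f ` (S \<times> R). av (x - r) \<le> av p ^ Suc n" if x: "x \<in> F" "av x \<le> 1" for x
  proof -
    from S(4)[OF x] obtain a where a: "a \<in> S" "av (x - a) \<le> av p ^ n" by auto
    then have aF: "a \<in> F" using S(1) by auto
    define y where "y = (x - a) / p ^ n"
    have "y \<in> F" using x aF p_in F_closed by (simp add: y_def)
    moreover have "av y \<le> 1" using a(2) p_pos by (simp add: y_def av_divide av_power)
    ultimately obtain b where b: "b \<in> R" "av (y - b) < 1" using reps_ex by blast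
    then have "av (y - b) \<le> av p" using \<open>y \<in> F\<close> reps_in F_closed(6) less_1_imp_le_p by blast
    then have "av p ^ n * av (y - b) \<le> av p ^ n * av p" using p_pos by simp
    moreover have "x - f (a, b) = p ^ n * (y - b)" using p_neq_0 by (simp add: f_def y_def field_simps)
    ultimately have "av (x - f (a, b)) \<le> av p ^ Suc n" by (simp add: av_mult av_power mult.commute)
    with a b show ?thesis by blast
  qed
  moreover have "f ` (S \<times> R) \<subseteq> {x\<in>F. av x \<le> 1}"
  proof -
    have "f (a, b) \<in> F \<and> av (f (a, b)) \<le> 1" if "a \<in> S" "b \<in> R" for a b
    proof
      show "f (a, b) \<in> F"
        unfolding f_def using that S(1) reps_in p_in by (auto intro: F_closed)
      show "av (f (a, b)) \<le> 1"
        unfolding f_def prod.case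
        by (rule av_add_le) (use that S(1) pn[of b] pn1 reps_int in force)+
    qed
    then show ?thesis by auto
  qed
  moreover have "card (f ` (S \<times> R)) = card R ^ Suc n"
    using card_image[OF inj] S(3) by (simp add: card_cartesian_product mult.commute)
  moreover have "\<forall>r\<in>f ` (S \<times> R). \<forall>r'\<in>f ` (S \<times> R). av (r - r') \<le> av p ^ Suc n \<longrightarrow> r = r'"
  proof (intro ballI impI)
    fix r r' assume "r \<in> f ` (S \<times> R)" "r' \<in> f ` (S \<times> R)" and le: "av (r - r') \<le> av p ^ Suc n"
    then obtain a b c d where "a \<in> S" "b \<in> R" "c \<in> S" "d \<in> R" "r = f (a, b)" "r' = f (c, d)"
      by blast
    with key[of a c b d] le show "r = r'" by simp
  qed
  ultimately have "reps_mod (Suc n) (f ` (S \<times> R))"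
    unfolding reps_mod_def using S(2) reps_finite by blast
  then show ?case ..
qed

text \<open>The residue field is finite of characteristic two, hence perfect.\<close>

lemma square_residue:
  assumes two: "av 2 < 1" and x: "x \<in> F" "av x \<le> 1"
  obtains c where "c \<in> F" "av c \<le> 1" "av (x - c ^ 2) < 1"
proof -
  have "\<exists>f. \<forall>r\<in>R. f r \<in> R \<and> av (r ^ 2 - f r) < 1"
  proof (rule bchoice, rule ballI)
    fix r assume "r \<in> R"
    then show "\<exists>y. y \<in> R \<and> av (r ^ 2 - y) < 1"
      using reps_ex[of "r ^ 2"] reps_in[of r] reps_int[of r] F_closed(9)[of r 2] power_le_one[of "av r" 2]
      by (simp add: av_power) blast
  qed
  then obtain f where f: "\<And>r. r \<in> R \<Longrightarrow> f r \<in> R" "\<And>r. r \<in> R \<Longrightarrow> av (r ^ 2 - f r) < 1" by metis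
  \<comment> \<open>Squaring is injective on residues, since a^2 - b^2 and (a - b)^2 differ by the
    multiple 2 b (b - a) of 2. On a finite set it is then surjective.\<close>
  have "inj_on f R"
  proof (rule inj_onI)
    fix a b assume ab: "a \<in> R" "b \<in> R" "f a = f b"
    then have 1: "av (a ^ 2 - b ^ 2) < 1"
      using av_diff_less[OF f(2)[OF ab(1)] f(2)[OF ab(2)]] by simp
    have "av (2 * (b * (b - a))) < 1"
      using reps_int[OF ab(1)] reps_int[OF ab(2)]
      by (intro av_mult_less_1[OF two] av_mult_le_1 av_diff_le)
    from av_add_less[OF 1 this] have "av ((a - b) ^ 2) < 1"
      by (simp add: power2_eq_square algebra_simps)
    then have "av (a - b) < 1"
      unfolding av_power using one_le_power[of "av (a - b)" 2] by linarith
    then show "a = b" using reps_unique ab by blast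
  qed
  then have "f ` R = R" using f reps_finite by (metis endo_inj_surj image_subsetI)
  moreover obtain r where r: "r \<in> R" "av (x - r) < 1" using reps_ex x by blast
  ultimately obtain c where c: "c \<in> R" "f c = r" by (metis imageE)
  have "av (x - c ^ 2) < 1"
    using c(2) av_add_less[of "x - r" 1 "r - c ^ 2"] r f(2)[OF c(1)] av_diff_commute[of r "c ^ 2"] by simp
  with c that reps_in reps_int show ?thesis by blast
qed

end

section \<open>Quadratic extensions of discretely valued fields\<close>

lemma powi_double: "(x::real) powi (2 * m) = (x powi m)\<^sup>2"
  by (metis mult.commute power_int_mult power_int_numeral)

locale discrete_quad = discrete_valued av F p R + quad_conjugation F E s
  for av :: "'a::field_char_0 \<Rightarrow> real" and F p R E s +
  assumes two: "av 2 < 1"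
begin

text \<open>An element \<open>z\<close> with \<open>\<bar>z\<bar> < 1\<close> and \<open>z * s z = 1\<close> is a fixed point of the contraction
  \<open>w \<mapsto> (1 + w\<^sup>2) / (z + s z)\<close>, which is defined over the complete field \<open>F\<close>.\<close>

lemma norm_one_not_small:
  assumes z: "z \<in> E" "av z < 1" and n1: "z * s z = 1"
  shows False
proof -
  have z0: "z \<noteq> 0" using n1 by auto
  have "av z * av (s z) = 1" using n1 by (metis av_1 av_mult)
  then have "av (s z) = inverse (av z)" by (metis inverse_unique)
  then have sz: "av (s z) > 1" using z(2) z0 by (simp add: one_less_inverse)
  define T where "T = z + s z"
  have T: "T \<in> F" unfolding T_def by (rule trace_in[OF z(1)])
  \<comment> \<open>The conjugate has value 1 / |z| > 1 and dominates the trace, so 1 / T is small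
    enough to serve as contraction factor.\<close>
  have avT: "av T > 1" unfolding T_def using av_add_eq_right[of z "s z"] z(2) sz by simp
  then have T0: "T \<noteq> 0" by auto
  define c where "c = inverse T"
  have cF: "c \<in> F" using T F_closed(7) by (simp add: c_def)
  have c1: "av c < 1" using avT by (simp add: c_def av_inverse inverse_less_1_iff)
  have "z * T = z ^ 2 + 1" using n1 by (simp add: T_def power2_eq_square algebra_simps)
  then have fixp: "z = c * (1 + z ^ 2)" using T0 by (simp add: c_def field_simps)
  define u where "u = rec_nat 0 (\<lambda>_ w. c * (1 + w ^ 2))"
  have u0: "u 0 = 0" and uS: "u (Suc n) = c * (1 + u n ^ 2)" for n by (auto simp: u_def)
  have uF: "u n \<in> F" for n by (induction n) (auto simp: u0 uS intro!: F_closed cF)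
  have u1: "av (u n) \<le> 1" for n
  proof (induction n)
    case (Suc n)
    have "av (1 + u n ^ 2) \<le> 1" using Suc by (intro av_add_le) (auto simp: av_power power_le_one)
    then show ?case unfolding uS using c1 by (intro av_mult_le_1) auto
  qed (simp add: u0)
  have uz: "av (u n - z) \<le> av c ^ n" for n
  proof (induction n)
    case (Suc n)
    have "u (Suc n) - z = c * (1 + u n ^ 2) - c * (1 + z ^ 2)" using fixp uS by metis
    also have "\<dots> = (c * (u n - z)) * (u n + z)" by (simp add: power2_eq_square algebra_simps)
    finally have "av (u (Suc n) - z) = av ((c * (u n - z)) * (u n + z))" by simp
    also have "\<dots> \<le> av (c * (u n - z))" using u1[of n] z(2) by (intro av_mult_le_1[OF order_refl] av_add_le) auto
    also have "\<dots> \<le> av c ^ Suc n" using Suc by (simp add: av_mult mult_left_mono)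
    finally show ?case .
  qed (use z(2) in \<open>simp add: u0\<close>)
  have "(\<lambda>n. av (u n - z)) \<longlonglongrightarrow> 0"
    by (rule tendsto_sandwich[OF _ _ tendsto_const LIMSEQ_realpow_zero[of "av c"]]) (use uz c1 in auto)
  then have "z \<in> F" by (rule limit_in_complete[OF complete uF])
  then have "s z = z" by (rule conj_base)
  then have "av z * av z = 1" using n1 by (metis av_1 av_mult)
  moreover have "av z * av z < 1 * 1" by (rule mult_strict_mono) (use z(2) in auto)
  ultimately show False by simp
qed

text \<open>If |y| < |s y|, then y / s y is an element of norm one and value below 1, which
  \<open>norm_one_not_small\<close> excludes. Applying this to x and to s x gives equality.\<close>

lemma conj_isometry:
  assumes x: "x \<in> E" shows "av (s x) = av x"
proof (cases "x = 0")
  case True then show ?thesis using conj_eq_0_iff x by simp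
next
  case False
  have aux: "\<not> av y < av (s y)" if "y \<in> E" "y \<noteq> 0" for y
  proof
    assume "av y < av (s y)"
    then have 1: "av (y / s y) < 1" by (simp add: av_divide divide_less_eq_1)
    have sy: "s y \<noteq> 0" using that conj_eq_0_iff by simp
    have "(y / s y) * s (y / s y) = 1"
      using that sy conj_in conj_conj by (simp add: conj_divide)
    with norm_one_not_small[OF _ 1] that show False using ext_closed(8) conj_in by blast
  qed
  from aux[OF x False] aux[of "s x"] x False show ?thesis
    using conj_in[OF x] conj_eq_0_iff[OF x] conj_conj[OF x] by simp
qed

lemma av_norm: "x \<in> E \<Longrightarrow> av (x * s x) = av x ^ 2"
  by (simp add: av_mult conj_isometry power2_eq_square)

text \<open>The square of |x| is the value of the norm of x, an element of \<open>F\<close>; so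
  values in \<open>E\<close> are at worst square roots of values in \<open>F\<close>.\<close>

lemma square_value: 
  assumes "x \<in> E" "x \<noteq> 0" shows "\<exists>n::int. av x ^ 2 = av p powi n"
  using value_group[OF norm_in[OF assms(1)]] assms conj_eq_0_iff[OF assms(1)] av_norm[OF assms(1)]
  by auto

text \<open>Squared distances to elements of \<open>F\<close> are powers of |p|. Without a closest
  element their exponents are unbounded, and \<theta> is a limit of elements of \<open>F\<close>,
  hence in \<open>F\<close> by completeness.\<close>

lemma best_approximation:
  assumes \<theta>: "\<theta> \<in> E" "\<theta> \<notin> F"
  shows "\<exists>a\<in>F. \<forall>b\<in>F. av (\<theta> - a) \<le> av (\<theta> - b)"
proof (rule ccontr)
  assume contra: "\<not> ?thesis"
  have "\<exists>n. \<forall>a\<in>F. av (\<theta> - a) ^ 2 = av p powi (n a)"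
  proof (rule bchoice, rule ballI)
    fix a assume "a \<in> F"
    with \<theta> have "\<theta> - a \<in> E" "\<theta> - a \<noteq> 0" using ext_closed(6) base_in by auto
    then show "\<exists>n. av (\<theta> - a) ^ 2 = av p powi n" by (rule square_value)
  qed
  then obtain n :: "'a \<Rightarrow> int" where n: "\<And>a. a \<in> F \<Longrightarrow> av (\<theta> - a) ^ 2 = av p powi (n a)" by blast
  have le: "av (\<theta> - a) \<le> av (\<theta> - b) \<longleftrightarrow> n b \<le> n a" if "a \<in> F" "b \<in> F" for a b
    using n[OF that(1)] n[OF that(2)] p_powi_le_iff[of "n a" "n b"]
      abs_le_square_iff[of "av (\<theta> - a)" "av (\<theta> - b)"] by simp
  have "\<exists>a\<in>F. int k \<le> n a" for k
  proof (rule ccontr)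
    assume ub: "\<not> (\<exists>a\<in>F. int k \<le> n a)"
    \<comment> \<open>All exponents are below \<open>k\<close>, so truncation by \<open>nat\<close>
      loses nothing, and a minimum of k - n a belongs to a closest element.\<close>
    obtain a where a: "a \<in> F" "\<And>b. b \<in> F \<Longrightarrow> nat (int k - n a) \<le> nat (int k - n b)"
      using ex_has_least_nat[of "\<lambda>a. a \<in> F" 0 "\<lambda>a. nat (int k - n a)"] F_closed(1) by blast
    have "av (\<theta> - a) \<le> av (\<theta> - b)" if "b \<in> F" for b
    proof -
      have "n a < int k" "n b < int k" using ub that a(1) by (auto simp: not_le)
      with a(2)[OF that] have "n b \<le> n a" by simp
      then show ?thesis using le[OF a(1) that] by simp
    qed
    with a(1) contra show False by blast
  qed
  then obtain u where u: "\<And>k. u k \<in> F" "\<And>k. int k \<le> n (u k)" by metis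
  have "(\<lambda>k. av (\<theta> - u k) ^ 2) \<longlonglongrightarrow> 0"
  proof (rule tendsto_sandwich[OF _ _ tendsto_const LIMSEQ_realpow_zero[of "av p"]])
    have "av (\<theta> - u k) ^ 2 \<le> av p ^ k" for k
      using u(2)[of k] p_powi_le_iff[of "n (u k)" "int k"] unfolding n[OF u(1)] by simp
    then show "\<forall>\<^sub>F k in sequentially. av (\<theta> - u k) ^ 2 \<le> av p ^ k" by simp
  qed (use p_pos p_less_1 in auto)
  then have "(\<lambda>k. sqrt (av (\<theta> - u k) ^ 2)) \<longlonglongrightarrow> sqrt 0" by (rule tendsto_real_sqrt)
  then have "(\<lambda>k. av (u k - \<theta>)) \<longlonglongrightarrow> 0" by (simp add: av_diff_commute)
  from limit_in_complete[OF complete u(1) this] \<theta> show False by simp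
qed

text \<open>The error of a best approximation to a generator has squared value |p|^n. After scaling
  by a power of \<open>p\<close> the exponent is 0 or 1. For 1 the error is a uniformizer of a
  ramified extension. For 0 it is a unit, and minimality of the distance says that its residue is
  not in the residue field of \<open>F\<close>.\<close>

lemma dichotomy:
  "(\<exists>l\<in>E. av l ^ 2 = av p) \<or> (\<exists>\<xi>\<in>E. av \<xi> = 1 \<and> (\<forall>a\<in>F. 1 \<le> av (\<xi> - a)))"
proof -
  obtain \<theta> where \<theta>: "\<theta> \<in> E" "\<theta> \<notin> F" using base_subset base_neq by auto
  from best_approximation[OF \<theta>] obtain a where a: "a \<in> F" "\<And>b. b \<in> F \<Longrightarrow> av (\<theta> - a) \<le> av (\<theta> - b)"
    by auto
  define t where "t = \<theta> - a"
  have tE: "t \<in> E" using \<theta> a ext_closed(6) by (auto simp: t_def)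
  have tb: "av t \<le> av (t - b)" if "b \<in> F" for b
    using a(2)[of "a + b"] a(1) that F_closed(3) by (simp add: t_def algebra_simps)
  have t0: "t \<noteq> 0" using \<theta> a by (auto simp: t_def)
  from square_value[OF tE t0] obtain n where n: "av t ^ 2 = av p powi n" ..
  define m where "m = n div 2"
  define w where "w = t / p powi m"
  have pm: "p powi m \<in> F" by (rule F_closed(10)[OF p_in])
  have wE: "w \<in> E" using tE pm ext_closed(8) by (auto simp: w_def)
  have avw: "av w ^ 2 = av p powi (n - 2 * m)"
  proof -
    have "av w ^ 2 = av t ^ 2 / (av p powi m) ^ 2" by (simp add: w_def av_divide av_powi power_divide)
    also have "\<dots> = av p powi n / av p powi (2 * m)" unfolding n powi_double ..
    also have "\<dots> = av p powi (n - 2 * m)" using p_pos by (simp add: power_int_diff)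
    finally show ?thesis .
  qed
  show ?thesis
  proof (cases "even n")
    case True
    then have "n - 2 * m = 0" by (auto simp: m_def)
    then have "av w ^ 2 = 1" using avw by simp
    then have w1: "av w = 1" using av_nonneg[of w] by (simp add: power2_eq_1_iff)
    have "1 \<le> av (w - b)" if "b \<in> F" for b
    proof -
      have "av t \<le> av (t - b * p powi m)" using that pm F_closed(4) by (intro tb) auto
      moreover have "t = w * p powi m" using p_neq_0 by (simp add: w_def)
      ultimately have "av (w * p powi m) \<le> av ((w - b) * p powi m)" by (simp add: algebra_simps)
      then show ?thesis using w1 p_pos by (simp add: av_mult av_powi)
    qed
    with wE w1 show ?thesis by blast
  next
    case False
    then have "n - 2 * m = 1" by (auto simp: m_def elim!: oddE)
    with wE avw show ?thesis by auto
  qed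
qed

text \<open>Only a tie |a| = |b| could cause cancellation; there b can be taken out, and the
  remaining factor \<xi> + a / b has value at least 1.\<close>

lemma unramified_coord_norm:
  assumes \<xi>: "av \<xi> = 1" "\<And>a. a \<in> F \<Longrightarrow> 1 \<le> av (\<xi> - a)" and ab: "a \<in> F" "b \<in> F"
  shows "av (a + b * \<xi>) = max (av a) (av b * av \<xi>)"
proof (cases "av a = av b \<and> b \<noteq> 0")
  case True
  have eq: "a + b * \<xi> = b * (\<xi> - (- a / b))" using True by (simp add: field_simps)
  have "1 \<le> av (\<xi> - (- a / b))" using ab F_closed(5,8) by (intro \<xi>(2)) blast
  from mult_left_mono[OF this av_nonneg[of b]]
  have "av b \<le> av (a + b * \<xi>)" unfolding eq by (simp add: av_mult)
  moreover have "av (a + b * \<xi>) \<le> max (av a) (av b * av \<xi>)" using av_add[of a "b * \<xi>"] by (simp add: av_mult)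
  ultimately show ?thesis using True \<xi>(1) by simp
next
  case False
  then show ?thesis using av_add_eq[of a "b * \<xi>"] \<xi>(1) by (auto simp: av_mult)
qed

text \<open>For nonzero a and b a tie is impossible: |a|^2 is an even and |b l|^2 an odd power of
  |p|.\<close>

lemma ramified_coord_norm:
  assumes l: "av l ^ 2 = av p" and ab: "a \<in> F" "b \<in> F"
  shows "av (a + b * l) = max (av a) (av b * av l)"
proof (cases "a = 0 \<or> b = 0")
  case True then show ?thesis by (auto simp: av_mult)
next
  case False
  have "av a \<noteq> av (b * l)"
  proof
    assume eq: "av a = av (b * l)"
    from value_group ab False obtain m n where mn: "av a = av p powi m" "av b = av p powi n" by metis
    have "av p powi (2 * m) = av a ^ 2" using mn by (simp add: powi_double)
    also have "\<dots> = av b ^ 2 * av p" using eq l by (simp add: av_mult power_mult_distrib)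
    also have "av b ^ 2 = av p powi (2 * n)" using mn by (simp add: powi_double)
    also have "\<dots> * av p = av p powi (2 * n + 1)" using p_pos by (simp add: power_int_add)
    finally have "2 * m = 2 * n + 1" using p_powi_eq_iff[of "2 * m" "2 * n + 1"] by simp
    then show False by presburger
  qed
  then show ?thesis using av_add_eq[of a "b * l"] by (simp add: av_mult)
qed

text \<open>Otherwise \<open>\<xi>\<close> would be purely inseparable over the residue field, which is perfect.\<close>

lemma unramified_conj_diff:
  assumes \<xi>: "\<xi> \<in> E" "av \<xi> = 1" "\<And>a. a \<in> F \<Longrightarrow> 1 \<le> av (\<xi> - a)"
  shows "av (\<xi> - s \<xi>) = 1"
proof (rule ccontr)
  assume "av (\<xi> - s \<xi>) \<noteq> 1"
  moreover have "av (\<xi> - s \<xi>) \<le> 1" using \<xi> conj_isometry by (intro av_diff_le) auto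
  ultimately have lt: "av (\<xi> - s \<xi>) < 1" by simp
  have "av (\<xi> * s \<xi>) \<le> 1" using av_norm \<xi> by simp
  from square_residue[OF two norm_in[OF \<xi>(1)] this] obtain c where
    c: "c \<in> F" "av c \<le> 1" "av (\<xi> * s \<xi> - c ^ 2) < 1" .
  have 1: "av ((\<xi> - s \<xi>) * \<xi>) < 1" using av_mult_less_1[OF lt, of \<xi>] \<xi>(2) by simp
  have 2: "av (2 * (c * (c - \<xi>))) < 1"
    using c \<xi>(2) by (intro av_mult_less_1[OF two] av_mult_le_1 av_diff_le) auto
  \<comment> \<open>If conjugation were trivial on the residue of \<xi>, the norm would be congruent
    to \<xi>^2. A square root c of its residue is then congruent to \<xi>, although c lies in
    \<open>F\<close>.\<close>
  have "(\<xi> - c) ^ 2 = ((\<xi> - s \<xi>) * \<xi> + (\<xi> * s \<xi> - c ^ 2)) + 2 * (c * (c - \<xi>))"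
    by (simp add: power2_eq_square algebra_simps)
  then have "av ((\<xi> - c) ^ 2) < 1" using av_add_less[OF av_add_less[OF 1 c(3)] 2] by simp
  then have "av (\<xi> - c) < 1"
    unfolding av_power using one_le_power[of "av (\<xi> - c)" 2] by linarith
  with \<xi>(3)[OF c(1)] show False by simp
qed

text \<open>By the norm formula, values, limits and residues can be read off coordinates.
  \<open>R\<close> carries over unchanged because the residue field does not grow. The result lets a
  ramified extension serve as base field of the next quadratic layer.\<close>

lemma ramified_ext_discrete:
  assumes l: "l \<in> E" "av l ^ 2 = av p"
  shows "discrete_valued av E l R"
proof -
  have l0: "l \<noteq> 0" using l p_neq_0 by auto
  have l1: "av l < 1"
    using l(2) p_less_1 one_le_power[of "av l" 2] by linarith
  have avl: "av l > 0" using l0 by simp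
  have lF: "l \<notin> F"
  proof
    assume "l \<in> F"
    from value_group[OF this l0] obtain n where n: "av l = av p powi n" ..
    then have "av p powi (2 * n) = av p powi 1" using l(2) by (simp add: powi_double)
    then have "2 * n = 1" using p_powi_eq_iff[of "2 * n" 1] by simp
    then show False by presburger
  qed
  note cn = ramified_coord_norm[OF l(2)]
  have pl: "av p powi n = av l powi (2 * n)" for n
    unfolding l(2)[symmetric] by (metis power_int_mult power_int_numeral)
  have val: "\<exists>n::int. av x = av l powi n" if x: "x \<in> E" "x \<noteq> 0" for x
  proof -
    from basis_coords[OF x(1) l(1) lF] obtain a b where ab: "a \<in> F" "b \<in> F" "x = a + b * l" by metis
    have A: "\<exists>n::int. av a = av l powi n" if "a \<noteq> 0" using value_group[OF ab(1) that] pl by metis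
    have B: "\<exists>n::int. av b * av l = av l powi n" if "b \<noteq> 0"
    proof -
      from value_group[OF ab(2) that] obtain n where "av b = av l powi (2 * n)" using pl by metis
      then have "av b * av l = av l powi (2 * n + 1)" using avl by (simp add: power_int_add)
      then show ?thesis ..
    qed
    have eq: "av x = max (av a) (av b * av l)" using cn ab by simp
    show ?thesis
    proof (cases "av a \<le> av b * av l")
      case True
      then have "b \<noteq> 0" using ab x av_pos[of a] by (auto simp del: av_pos)
      with B True eq show ?thesis by simp
    next
      case False
      then have "0 < av a" using avl av_nonneg[of b] mult_nonneg_nonneg[of "av b" "av l"] by linarith
      then have "a \<noteq> 0" by simp
      with A False eq show ?thesis by simp
    qed
  qed
  show ?thesis
  proof (intro discrete_valued.intro discrete_valued_axioms.intro, rule valued_axioms)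
    show "subfield E \<Omega>" by (rule subfield_ext)
  next
    show "Metric_space.mcomplete E (av_dist av)"
      unfolding mcomplete_av_iff
    proof (intro allI impI, elim conjE)
      fix u :: "nat \<Rightarrow> 'a"
      assume uE: "\<forall>n. u n \<in> E" and cau: "\<forall>e>0. \<exists>N. \<forall>m\<ge>N. \<forall>n\<ge>N. av (u m - u n) < e"
      have "\<forall>n. \<exists>a b. a \<in> F \<and> b \<in> F \<and> u n = a + b * l"
        using uE basis_coords[OF _ l(1) lF] by metis
      then obtain a b where ab: "\<And>n. a n \<in> F" "\<And>n. b n \<in> F" "\<And>n. u n = a n + b n * l" by metis
      have diff: "av (u m - u n) = max (av (a m - a n)) (av (b m - b n) * av l)" for m n
        using cn[of "a m - a n" "b m - b n"] ab F_closed(6) by (simp add: algebra_simps)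
      have "\<exists>x\<in>F. (\<lambda>n. av (a n - x)) \<longlonglongrightarrow> 0"
      proof (rule complete[unfolded mcomplete_av_iff, THEN spec, of a, THEN mp], intro conjI allI impI)
        fix e :: real assume "e > 0"
        with cau obtain N where "\<forall>m\<ge>N. \<forall>n\<ge>N. av (u m - u n) < e" by blast
        then show "\<exists>N. \<forall>m\<ge>N. \<forall>n\<ge>N. av (a m - a n) < e" unfolding diff by auto
      qed (rule ab)
      then obtain x where x: "x \<in> F" "(\<lambda>n. av (a n - x)) \<longlonglongrightarrow> 0" by blast
      have "\<exists>y\<in>F. (\<lambda>n. av (b n - y)) \<longlonglongrightarrow> 0"
      proof (rule complete[unfolded mcomplete_av_iff, THEN spec, of b, THEN mp], intro conjI allI impI)
        fix e :: real assume "e > 0"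
        then have "e * av l > 0" using avl by simp
        with cau obtain N where "\<forall>m\<ge>N. \<forall>n\<ge>N. av (u m - u n) < e * av l" by blast
        then show "\<exists>N. \<forall>m\<ge>N. \<forall>n\<ge>N. av (b m - b n) < e" unfolding diff using avl by auto
      qed (rule ab)
      then obtain y where y: "y \<in> F" "(\<lambda>n. av (b n - y)) \<longlonglongrightarrow> 0" by blast
      have "(\<lambda>n. max (av (a n - x)) (av (b n - y) * av l)) \<longlonglongrightarrow> max 0 (0 * av l)"
        by (intro tendsto_max x y tendsto_mult_right)
      moreover have "av (u n - (x + y * l)) = max (av (a n - x)) (av (b n - y) * av l)" for n
        using cn[of "a n - x" "b n - y"] ab x y F_closed(6) by (simp add: algebra_simps)
      ultimately have "(\<lambda>n. av (u n - (x + y * l))) \<longlonglongrightarrow> 0" by simp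
      moreover have "x + y * l \<in> E" using x(1) y(1) l(1) ext_closed(3,4) base_in by simp
      ultimately show "\<exists>z\<in>E. (\<lambda>n. av (u n - z)) \<longlonglongrightarrow> 0" by blast
    qed
  next
    fix x assume x: "x \<in> E" "av x \<le> 1"
    from basis_coords[OF x(1) l(1) lF] obtain a b where ab: "a \<in> F" "b \<in> F" "x = a + b * l" by metis
    have mx: "max (av a) (av b * av l) \<le> 1" using cn ab x by simp
    then have "av a \<le> 1" by simp
    then obtain r where r: "r \<in> R" "av (a - r) < 1" using reps_ex ab by blast
    \<comment> \<open>The bound |b l| <= 1 alone leaves room above 1. But values in \<open>F\<close>
      are powers of |p| = |l|^2, so |b| > 1 would give |b| >= 1 / |l|^2.\<close>
    have "av b \<le> 1"
    proof (rule ccontr)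
      assume "\<not> av b \<le> 1"
      then have "av (inverse b) < 1" by (simp add: av_inverse inverse_less_1_iff)
      then have "av (inverse b) \<le> av p" using ab F_closed(7) less_1_imp_le_p by blast
      then have "av b * inverse (av b) \<le> av b * av p" by (intro mult_left_mono) (auto simp: av_inverse)
      moreover have "av b \<noteq> 0" using \<open>\<not> av b \<le> 1\<close> by linarith
      ultimately have "1 \<le> av b * av p" by simp
      also have "\<dots> = (av b * av l) * av l" using l(2) by (simp add: power2_eq_square)
      also have "\<dots> \<le> 1 * av l" using mx avl by (intro mult_right_mono) auto
      finally show False using l1 by simp
    qed
    then have "av (l * b) < 1" by (rule av_mult_less_1[OF l1])
    then have "av ((a - r) + l * b) < 1" by (rule av_add_less[OF r(2)])
    then show "\<exists>r\<in>R. av (x - r) < 1" using r(1) ab by (intro bexI[of _ r]) (simp_all add: algebra_simps)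
  qed (use l l0 l1 val reps_in reps_int reps_finite reps_unique in auto)
qed

end

text \<open>The element \<open>t\<close> generates the integers of \<open>E\<close> over those of \<open>F\<close>; its absolute value
  tells whether the extension is ramified.\<close>

locale integral_basis = discrete_quad av F p R E s
  for av :: "'a::field_char_0 \<Rightarrow> real" and F p R E s +
  fixes t :: 'a
  assumes t_in: "t \<in> E" and t_notin: "t \<notin> F" and t_le: "av t \<le> 1" and t_gt: "av p < av t"
    and coord_norm: "a \<in> F \<Longrightarrow> b \<in> F \<Longrightarrow> av (a + b * t) = max (av a) (av b * av t)"
begin

lemma t_pos: "0 < av t" using t_gt p_pos by linarith

text \<open>The norm formula gives |b| <= |p|^j / |t|, which is below |p|^(j - 1) because |t| > |p|;
  discreteness of the values of \<open>F\<close> improves this to |p|^j. The condition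
  \<open>t_gt\<close> thus treats the unit \<open>t\<close> and the uniformizer \<open>t\<close>
  alike.\<close>

lemma coord_bound:
  assumes "a \<in> F" "b \<in> F" "av (a + b * t) \<le> av p ^ j"
  shows "av a \<le> av p ^ j" "av b \<le> av p ^ j"
proof -
  have mx: "av a \<le> av p ^ j" "av b * av t \<le> av p ^ j" using coord_norm assms by simp_all
  then show "av a \<le> av p ^ j" by simp
  show "av b \<le> av p ^ j"
  proof (rule ccontr)
    assume c: "\<not> av b \<le> av p ^ j"
    define d where "d = p ^ j / b"
    have b0: "0 < av b" using c p_pos by (meson le_less_trans linorder_not_less zero_le_power less_imp_le)
    have "av d < 1" using c b0 by (simp add: d_def av_divide av_power)
    then have "av d \<le> av p" using less_1_imp_le_p assms(2) p_in F_closed by (simp add: d_def)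
    then have "av p ^ j \<le> av p * av b" using b0 by (simp add: d_def av_divide av_power field_simps)
    also have "\<dots> < av t * av b" using t_gt b0 by simp
    finally show False using mx(2) by (simp add: mult.commute)
  qed
qed

text \<open>This is the equality of the integers of \<open>E\<close> with O_F[t].\<close>

lemma coords_integral: "a \<in> F \<Longrightarrow> b \<in> F \<Longrightarrow> av (a + b * t) \<le> 1 \<longleftrightarrow> av a \<le> 1 \<and> av b \<le> 1"
  using coord_bound[of a b 0] av_add_le[of a 1 "b * t"] av_mult_le_1[of b 1 t] t_le by auto

lemma distance: "a \<in> F \<Longrightarrow> b \<in> F \<Longrightarrow> c \<in> F \<Longrightarrow> av b * av t \<le> av (a + b * t - c)"
  using coord_norm[of "a - c" b] F_closed(6) by (simp add: algebra_simps)

text \<open>The unit group of the order O_F + p^j O_E, whose conductor exponent is \<open>j\<close>.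
  Value 1 suffices for a unit, since the inverse stays in the order
  (\<open>order_units_inverse\<close>).\<close>

definition order_units :: "nat \<Rightarrow> 'a set" where
  "order_units j = {a + b * t | a b. a \<in> F \<and> b \<in> F \<and> av b \<le> av p ^ j \<and> av (a + b * t) = 1}"

lemma order_unitsI:
  "x = a + b * t \<Longrightarrow> a \<in> F \<Longrightarrow> b \<in> F \<Longrightarrow> av b \<le> av p ^ j \<Longrightarrow> av x = 1 \<Longrightarrow> x \<in> order_units j"
  by (auto simp: order_units_def)

lemma order_unitsD: "a \<in> F \<Longrightarrow> b \<in> F \<Longrightarrow> a + b * t \<in> order_units j \<Longrightarrow> av b \<le> av p ^ j"
  unfolding order_units_def using basis_unique[OF _ _ _ _ t_notin] by fast

lemma order_units_in: "x \<in> order_units j \<Longrightarrow> x \<in> E" "x \<in> order_units j \<Longrightarrow> av x = 1"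
  using t_in ext_closed(3,4) base_in by (auto simp: order_units_def)

lemma p_power: "av p ^ j \<le> 1" "0 < j \<Longrightarrow> av p ^ j < 1"
  using p_pos p_less_1 by (auto simp: power_le_one power_less_one_iff)

text \<open>Multiply numerator and denominator by the conjugate of a + b t: the norm is a unit, and
  the coordinate at \<open>t\<close> becomes the determinant of the two coordinate pairs. Hence
  cosets of \<open>order_units j\<close> are told apart as points of a projective line.\<close>

lemma quotient_coords:
  assumes "a \<in> F" "b \<in> F" "c \<in> F" "d \<in> F" "av (a + b * t) = 1" "av (c + d * t) = 1"
  shows "(c + d * t) / (a + b * t) \<in> order_units j \<longleftrightarrow> av (a * d - b * c) \<le> av p ^ j"
proof -
  define T N where "T = t + s t" and "N = t * s t"
  have TN: "T \<in> F" "N \<in> F" using trace_in norm_in t_in by (auto simp: T_def N_def)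
  define u where "u = a + b * t"
  have uE: "u \<in> E" using assms t_in ext_closed(3,4) base_in by (auto simp: u_def)
  define M where "M = u * s u"
  have MF: "M \<in> F" unfolding M_def by (rule norm_in[OF uE])
  have M1: "av M = 1" unfolding M_def using av_norm[OF uE] assms by (simp add: u_def)
  then have M0: "M \<noteq> 0" by auto
  have su: "s u = a + b * s t"
    using assms t_in ext_closed(4) base_in conj_base by (simp add: u_def conj_add conj_mult)
  have u0: "u \<noteq> 0" "s u \<noteq> 0" using M0 by (auto simp: M_def)
  have eq: "(c + d * t) * s u = (c * a + c * b * T + b * d * N) + (a * d - b * c) * t"
    unfolding su T_def N_def by (simp add: algebra_simps)
  have "(c + d * t) / u = ((c + d * t) * s u) / M" using u0 by (simp add: M_def)
  also have "\<dots> = (c * a + c * b * T + b * d * N) / M + (a * d - b * c) / M * t"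
    unfolding eq by (simp add: add_divide_distrib)
  finally have q: "(c + d * t) / u = (c * a + c * b * T + b * d * N) / M + (a * d - b * c) / M * t" .
  have in1: "(c * a + c * b * T + b * d * N) / M \<in> F" and in2: "(a * d - b * c) / M \<in> F"
    using assms TN MF F_closed by auto
  have av2: "av ((a * d - b * c) / M) = av (a * d - b * c)" by (simp add: av_divide M1)
  have avq: "av ((c + d * t) / u) = 1" using assms by (simp add: av_divide u_def)
  show ?thesis
    unfolding u_def[symmetric]
    using order_unitsI[OF q in1 in2 _ avq] order_unitsD[OF in1 in2] av2 q by metis
qed

lemma order_units_mult:
  assumes "x \<in> order_units j" "y \<in> order_units j" shows "x * y \<in> order_units j"
proof -
  from assms obtain a b c d where
    x: "a \<in> F" "b \<in> F" "av b \<le> av p ^ j" "x = a + b * t" "av x = 1"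
    and y: "c \<in> F" "d \<in> F" "av d \<le> av p ^ j" "y = c + d * t" "av y = 1"
    by (auto simp: order_units_def)
  define T N where "T = t + s t" and "N = t * s t"
  have TN: "T \<in> F" "N \<in> F" using trace_in norm_in t_in by (auto simp: T_def N_def)
  have "t * t = T * t - N" by (simp add: T_def N_def algebra_simps)
  then have "b * d * (t * t) = b * d * (T * t - N)" by simp
  then have eq: "x * y = (a * c - b * d * N) + (b * c + d * a + b * (d * T)) * t"
    unfolding x y by (simp add: algebra_simps)
  have T1: "av T \<le> 1" unfolding T_def using t_le conj_isometry[OF t_in] by (intro av_add_le) auto
  have le: "av a \<le> 1" "av b \<le> 1" "av c \<le> 1" "av d \<le> 1"
    using coords_integral[of a b] coords_integral[of c d] x y by auto
  show ?thesis
  proof (rule order_unitsI[OF eq])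
    show "av (b * c + d * a + b * (d * T)) \<le> av p ^ j"
      using x(3) y(3) le T1 by (intro av_add_le av_mult_le_1) auto
  qed (use x y TN F_closed in \<open>auto simp: av_mult\<close>)
qed

lemma order_units_inverse:
  assumes "x \<in> order_units j" shows "inverse x \<in> order_units j"
proof -
  from assms obtain a b where x: "a \<in> F" "b \<in> F" "av b \<le> av p ^ j" "x = a + b * t" "av x = 1"
    by (auto simp: order_units_def)
  have "(1 + 0 * t) / (a + b * t) \<in> order_units j"
    by (subst quotient_coords) (use x F_closed in auto)
  then show ?thesis using x by (simp add: divide_inverse)
qed

text \<open>The order units contain a ball around 1, which makes their cosets open and therefore
  measurable. Positivity of \<open>j\<close> keeps this ball inside the units.\<close>

lemma order_units_nbhd:
  assumes "z \<in> E" "av (z - 1) \<le> av p ^ j" "0 < j" shows "z \<in> order_units j"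
proof -
  have "z - 1 \<in> E" using assms ext_closed by auto
  from basis_coords[OF this t_in t_notin] obtain a b where ab: "a \<in> F" "b \<in> F" "z - 1 = a + b * t" by metis
  have z1: "av z = 1" using av_add_eq_right[of "z - 1" 1] assms(2) p_power(2)[OF assms(3)] by simp
  show ?thesis
    by (rule order_unitsI[of _ "a + 1" b])
      (use ab z1 coord_bound[of a b j] assms F_closed in \<open>auto simp: algebra_simps\<close>)
qed

text \<open>The coset of \<open>a + b t\<close> is determined by the point \<open>[a : b]\<close> of the projective line over
  \<open>\<O> / p\<^sup>j\<close>; all points occur if \<open>t\<close> is a unit, otherwise only those with \<open>a\<close> invertible.\<close>

lemma order_units_transversal:
  assumes j: "0 < j"
  shows "\<exists>W. finite W \<and> card W = card R ^ j + (if av t = 1 then card R ^ (j - 1) else 0) \<and>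
     (\<forall>x\<in>W. x \<in> E \<and> av x = 1) \<and>
     (\<forall>u\<in>E. av u = 1 \<longrightarrow> (\<exists>x\<in>W. u / x \<in> order_units j)) \<and>
     (\<forall>x\<in>W. \<forall>y\<in>W. y / x \<in> order_units j \<longrightarrow> x = y)"
proof -
  obtain S where S: "reps_mod j S" using ex_reps_mod by blast
  obtain S' where S': "reps_mod (j - 1) S'" using ex_reps_mod by blast
  have SF: "\<And>r. r \<in> S \<Longrightarrow> r \<in> F" "\<And>r. r \<in> S \<Longrightarrow> av r \<le> 1" using S by (auto simp: reps_mod_def)
  have SF': "\<And>r. r \<in> S' \<Longrightarrow> r \<in> F" "\<And>r. r \<in> S' \<Longrightarrow> av r \<le> 1" using S' by (auto simp: reps_mod_def)
  have pj: "av p ^ j = av p ^ (j - 1) * av p" using j by (cases j) auto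
  \<comment> \<open>\<open>X1\<close> consists of the points [1 : r] and \<open>X2\<close> of the
    points [p r : 1]. In the second case r matters only modulo p^(j - 1), hence the coarser system
    \<open>S'\<close>.\<close>
  define X1 where "X1 = (\<lambda>r. 1 + r * t) ` S"
  define X2 where "X2 = (if av t = 1 then (\<lambda>r. p * r + 1 * t) ` S' else {})"
  have unit1: "av (1 + r * t) = 1" if "r \<in> F" "av r \<le> 1" for r
    using coord_norm[of 1 r] that F_closed t_le by (simp add: mult_le_one)
  have unit2: "av (p * r + 1 * t) = 1" if "r \<in> F" "av r \<le> 1" "av t = 1" for r
  proof -
    have "av (p * r) \<le> 1" using p_less_1 that by (intro av_mult_le_1) auto
    then show ?thesis using coord_norm[of "p * r" 1] that F_closed p_in by simp
  qed
  have rel11: "r = r'" if "r \<in> S" "r' \<in> S" "(1 + r' * t) / (1 + r * t) \<in> order_units j" for r r'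
  proof -
    have "av (1 * r' - r * 1) \<le> av p ^ j"
      using that(3) by (subst (asm) quotient_coords) (use that SF unit1 F_closed in auto)
    then show ?thesis using that S av_diff_commute[of r r'] by (simp add: reps_mod_def)
  qed
  have rel22: "r = r'" if "r \<in> S'" "r' \<in> S'" "av t = 1"
    "(p * r' + 1 * t) / (p * r + 1 * t) \<in> order_units j" for r r'
  proof -
    have "av (p * r * 1 - 1 * (p * r')) \<le> av p ^ j"
      using that(4) by (subst (asm) quotient_coords) (use that SF' unit2 F_closed p_in in auto)
    then have "av (p * (r - r')) \<le> av p ^ j" by (simp add: algebra_simps)
    then have "av (r - r') \<le> av p ^ (j - 1)" using p_pos by (simp add: pj av_mult)
    then show ?thesis using that S' by (simp add: reps_mod_def)
  qed
  have nrel: "av (1 * 1 - r * (p * r')) = 1" if "r \<in> S" "r' \<in> S'" for r r'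
  proof -
    have "av ((p * r') * r) < 1" using SF SF' that by (intro av_mult_less_1 p_less_1) auto
    then show ?thesis using av_add_eq_right[of "- (r * (p * r'))" 1] by (simp add: mult.commute)
  qed
  have rel12: False if "r \<in> S" "r' \<in> S'" "av t = 1" "(p * r' + 1 * t) / (1 + r * t) \<in> order_units j" for r r'
  proof -
    have "av (1 * 1 - r * (p * r')) \<le> av p ^ j"
      using that(4) by (subst (asm) quotient_coords) (use that SF SF' unit1 unit2 F_closed p_in in auto)
    then show False using nrel[OF that(1,2)] p_power(2)[OF j] by linarith
  qed
  have sym: "x / y \<in> order_units j" if "y / x \<in> order_units j" for x y
    using order_units_inverse[OF that] by simp
  have inj1: "inj_on (\<lambda>r. 1 + r * t) S"
    using t_pos by (auto intro!: inj_onI)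
  have inj2: "inj_on (\<lambda>r. p * r + 1 * t) S'"
    using p_neq_0 by (auto intro!: inj_onI)
  have one: "1 \<in> order_units j"
    by (rule order_units_nbhd) (use j p_pos ext_closed in auto)
  have dis: "X1 \<inter> X2 = {}"
  proof (rule ccontr)
    assume "X1 \<inter> X2 \<noteq> {}"
    then obtain r r' where r: "r \<in> S" "r' \<in> S'" "av t = 1" "1 + r * t = p * r' + 1 * t"
      by (auto simp: X1_def X2_def split: if_splits)
    then have "(p * r' + 1 * t) / (1 + r * t) \<in> order_units j"
      using one unit1[of r] SF by (metis av_0 divide_self zero_neq_one)
    with rel12 r show False by blast
  qed
  have fin: "finite X1" "finite X2" using S S' by (auto simp: X1_def X2_def reps_mod_def)
  have "card X1 = card R ^ j" using card_image[OF inj1] S by (simp add: X1_def reps_mod_def)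
  moreover have "card X2 = (if av t = 1 then card R ^ (j - 1) else 0)"
    using card_image[OF inj2] S' by (simp add: X2_def reps_mod_def)
  ultimately have card: "card (X1 \<union> X2) = card R ^ j + (if av t = 1 then card R ^ (j - 1) else 0)"
    using card_Un_disjoint[OF fin dis] by simp
  have units: "x \<in> E \<and> av x = 1" if "x \<in> X1 \<union> X2" for x
    using that
  proof
    assume "x \<in> X1"
    then show ?thesis using unit1 SF t_in ext_closed base_in by (auto simp: X1_def)
  next
    assume "x \<in> X2"
    then obtain r where "r \<in> S'" "av t = 1" "x = p * r + 1 * t" by (auto simp: X2_def split: if_splits)
    then show ?thesis using unit2 SF' t_in p_in ext_closed base_in by auto
  qed
  have cover: "\<exists>x\<in>X1 \<union> X2. u / x \<in> order_units j" if u: "u \<in> E" "av u = 1" for u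
  proof -
    from basis_coords[OF u(1) t_in t_notin] obtain a b where ab: "a \<in> F" "b \<in> F" "u = a + b * t" by metis
    have le: "av a \<le> 1" "av b \<le> 1" using coords_integral[of a b] u ab by auto
    show ?thesis
    proof (cases "av a = 1")
      case True
      then have a0: "a \<noteq> 0" by auto
      have "b / a \<in> F" "av (b / a) \<le> 1" using ab le True F_closed by (auto simp: av_divide)
      then obtain r where r: "r \<in> S" "av (b / a - r) \<le> av p ^ j"
        using S by (auto simp: reps_mod_def)
      have "1 * b - r * a = a * (b / a - r)" using a0 by (simp add: field_simps)
      then have "av (1 * b - r * a) = av (a * (b / a - r))" by simp
      also have "\<dots> \<le> av p ^ j" using r True by (simp add: av_mult)
      finally have "(a + b * t) / (1 + r * t) \<in> order_units j"
        by (subst quotient_coords) (use u ab r SF unit1 F_closed in auto)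
      then show ?thesis using ab r(1) by (auto simp: X1_def)
    next
      case False
      then have a1: "av a < 1" using le by simp
      \<comment> \<open>A non-unit \<open>a\<close> forces |b t| = 1, so \<open>t\<close> must be a
        unit and the point is of the second kind.\<close>
      have "max (av a) (av b * av t) = 1" using coord_norm ab u by simp
      then have bt: "av b * av t = 1" using a1 by (simp add: max_def split: if_splits)
      then have b1: "av b = 1" and t1: "av t = 1"
        using le t_le mult_le_one[of "av b" "av t"] mult_left_le[of "av t" "av b"] mult_right_le_one_le[of "av t" "av b"]
          mult_left_le_one_le[of "av t" "av b"] t_pos by auto
      have b0: "b \<noteq> 0" using b1 by auto
      define e where "e = a / (b * p)"
      have "av a \<le> av p" using less_1_imp_le_p ab a1 by blast
      then have "e \<in> F" "av e \<le> 1"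
        using ab p_in F_closed p_pos by (auto simp: e_def av_divide av_mult b1)
      then obtain r where r: "r \<in> S'" "av (e - r) \<le> av p ^ (j - 1)"
        using S' by (auto simp: reps_mod_def)
      have "p * r * b - 1 * a = p * b * (r - e)" using b0 p_neq_0
        by (simp add: e_def field_simps)
      then have "av (p * r * b - 1 * a) = av (p * b * (r - e))" by simp
      also have "\<dots> \<le> av p ^ j" using r b1 p_pos by (simp add: av_mult pj av_diff_commute mult.commute)
      finally have "(a + b * t) / (p * r + 1 * t) \<in> order_units j"
        by (subst quotient_coords) (use u ab r SF' unit2[OF _ _ t1] F_closed p_in in auto)
      then show ?thesis using ab r(1) t1 by (auto simp: X2_def)
    qed
  qed
  have uniq: "x = y" if "x \<in> X1 \<union> X2" "y \<in> X1 \<union> X2" and q: "y / x \<in> order_units j" for x y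
  proof -
    from that(1,2) consider "x \<in> X1" "y \<in> X1" | "x \<in> X2" "y \<in> X2" | "x \<in> X1" "y \<in> X2" | "x \<in> X2" "y \<in> X1"
      by blast
    then show ?thesis
    proof cases
      case 1
      then obtain r r' where "r \<in> S" "r' \<in> S" "x = 1 + r * t" "y = 1 + r' * t" by (auto simp: X1_def)
      with rel11 q show ?thesis by blast
    next
      case 2
      then obtain r r' where "r \<in> S'" "r' \<in> S'" "av t = 1" "x = p * r + 1 * t" "y = p * r' + 1 * t"
        by (auto simp: X2_def split: if_splits)
      with rel22 q show ?thesis by blast
    next
      case 3
      then obtain r r' where "r \<in> S" "r' \<in> S'" "av t = 1" "x = 1 + r * t" "y = p * r' + 1 * t"
        by (auto simp: X1_def X2_def split: if_splits)
      with rel12 q show ?thesis by blast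
    next
      case 4
      then obtain r r' where "r \<in> S" "r' \<in> S'" "av t = 1" "y = 1 + r * t" "x = p * r' + 1 * t"
        by (auto simp: X1_def X2_def split: if_splits)
      with rel12 sym[OF q] show ?thesis by blast
    qed
  qed
  show ?thesis
    by (intro exI[of _ "X1 \<union> X2"] conjI ballI impI; (rule card)?) (use fin units cover uniq in auto)
qed

end

section \<open>Volumes of orders\<close>

context integral_basis
begin

lemma Units_int_ring: "Units (int_ring av E) = {x\<in>E. av x = 1}"
proof (intro equalityI subsetI)
  fix x assume "x \<in> Units (int_ring av E)"
  then obtain y where y: "x \<in> E" "av x \<le> 1" "av y \<le> 1" "y * x = 1"
    by (auto simp: Units_def int_ring_def)
  have "1 = av y * av x" using y(4) by (metis av_1 av_mult)
  also have "\<dots> \<le> 1 * av x" using y(3) by (intro mult_right_mono) auto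
  finally show "x \<in> {x\<in>E. av x = 1}" using y by simp
next
  fix x assume x: "x \<in> {x\<in>E. av x = 1}"
  then have x0: "x \<noteq> 0" by auto
  have i: "inverse x \<in> E" "av (inverse x) = 1" using x ext_closed(7) by (simp_all add: av_inverse)
  show "x \<in> Units (int_ring av E)"
    unfolding Units_def int_ring_def using x x0 i by simp (metis left_inverse right_inverse order_refl)
qed

lemma openin_coset:
  assumes j: "0 < j" and x: "x \<in> E" "x \<noteq> 0"
  shows "openin (Metric_space.mtopology (E - {0}) (av_dist av)) ((\<lambda>h. x * h) ` order_units j)"
proof -
  interpret M: Metric_space "E - {0}" "av_dist av" by (rule Metric_space_av)
  show ?thesis
    unfolding M.openin_mtopology
  proof (intro conjI allI impI subsetI)
    fix w assume "w \<in> (\<lambda>h. x * h) ` order_units j"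
    then obtain h where h: "h \<in> order_units j" "w = x * h" by auto
    note hE = order_units_in[OF h(1)]
    have h0: "h \<noteq> 0" using hE by auto
    have w0: "w \<noteq> 0" using h h0 x by simp
    have wE: "w \<in> E" using h hE x ext_closed(4) by simp
    then show "w \<in> E - {0}" using w0 by simp
    show "\<exists>r>0. M.mball w r \<subseteq> (\<lambda>h. x * h) ` order_units j"
    proof (intro exI[of _ "av p ^ j * av w"] conjI subsetI)
      show "0 < av p ^ j * av w" using p_pos w0 by simp
      fix z assume "z \<in> M.mball w (av p ^ j * av w)"
      then have z: "z \<in> E" "z \<noteq> 0" "av (z - w) < av p ^ j * av w"
        by (auto simp: M.mball_def av_dist_def av_diff_commute)
      have "z / w - 1 = (z - w) / w" using w0 by (simp add: field_simps)
      then have "av (z / w - 1) \<le> av p ^ j"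
        using z(3) w0 by (simp add: av_divide field_simps less_imp_le)
      then have "z / w \<in> order_units j"
        using order_units_nbhd[OF _ _ j] z(1) wE ext_closed(8) by blast
      then have "h * (z / w) \<in> order_units j" by (rule order_units_mult[OF h(1)])
      moreover have "z = x * (h * (z / w))" using h h0 x w0 by (simp add: field_simps)
      ultimately show "z \<in> (\<lambda>h. x * h) ` order_units j" by blast
    qed
  qed
qed

text \<open>The units, of volume one, are the disjoint union of the cosets given by the transversal,
  and invariance gives all of them the same volume.\<close>

lemma measure_order_units:
  assumes haar: "normalized_haar av E \<mu>" and j: "0 < j"
  shows "measure \<mu> (order_units j) = 1 / (card R ^ j + (if av t = 1 then card R ^ (j - 1) else 0))"
proof -
  let ?H = "order_units j"
  define C where "C x = (\<lambda>h. x * h) ` ?H" for x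
  let ?T = "Metric_space.mtopology (E - {0}) (av_dist av)"
  let ?G = "mult_of (\<Omega>\<lparr>carrier := E\<rparr>)"
  have carr: "carrier ?G = E - {0}" and mul: "x \<otimes>\<^bsub>?G\<^esub> y = x * y" for x y by simp_all
  note hm = haar[unfolded normalized_haar_def Units_int_ring, THEN conjunct1]
    and unit = haar[unfolded normalized_haar_def Units_int_ring, THEN conjunct2]
  note haar_conds = hm[unfolded haar_measure_def carr mul]
  have sets: "sets \<mu> = sigma_sets (E - {0}) {U. openin ?T U}"
    using haar_conds by (elim conjE)
  have inv: "\<And>g A. g \<in> E - {0} \<Longrightarrow> A \<in> sets \<mu> \<Longrightarrow> emeasure \<mu> ((\<lambda>h. g * h) ` A) = emeasure \<mu> A"
    using haar_conds[THEN conjunct2, THEN conjunct2, THEN conjunct2, THEN conjunct1] by simp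
  have C_sets: "C x \<in> sets \<mu>" if "x \<in> E" "x \<noteq> 0" for x
    unfolding sets C_def by (rule sigma_sets.Basic) (use openin_coset[OF j that] in simp)
  have C1: "C 1 = ?H" by (auto simp: C_def)
  have H_sets: "?H \<in> sets \<mu>" using C_sets[of 1] ext_closed(2) C1 by simp
  obtain W where W: "finite W" "card W = card R ^ j + (if av t = 1 then card R ^ (j - 1) else 0)"
     "\<forall>x\<in>W. x \<in> E \<and> av x = 1"
     "\<forall>u\<in>E. av u = 1 \<longrightarrow> (\<exists>x\<in>W. u / x \<in> ?H)"
     "\<forall>x\<in>W. \<forall>y\<in>W. y / x \<in> ?H \<longrightarrow> x = y"
    using order_units_transversal[OF j] by (elim exE conjE)
  have W0: "x \<noteq> 0" if "x \<in> W" for x using W(3) that by auto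
  have U: "{x\<in>E. av x = 1} = (\<Union>x\<in>W. C x)"
  proof (intro equalityI subsetI)
    fix u assume u: "u \<in> {x\<in>E. av x = 1}"
    then obtain x where x: "x \<in> W" "u / x \<in> ?H" using W(4) by auto
    then have "u = x * (u / x)" using W0 by simp
    with x show "u \<in> (\<Union>x\<in>W. C x)" unfolding C_def by blast
  next
    fix u assume "u \<in> (\<Union>x\<in>W. C x)"
    then obtain x h where "x \<in> W" "h \<in> ?H" "u = x * h" by (auto simp: C_def)
    then show "u \<in> {x\<in>E. av x = 1}" using W(3) order_units_in ext_closed(4) by (simp add: av_mult)
  qed
  have dis: "disjoint_family_on C W"
    unfolding disjoint_family_on_def
  proof (intro ballI impI)
    fix x y assume xy: "x \<in> W" "y \<in> W" "x \<noteq> y"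
    show "C x \<inter> C y = {}"
    proof (rule ccontr)
      assume "C x \<inter> C y \<noteq> {}"
      then obtain h h' where h: "h \<in> ?H" "h' \<in> ?H" "x * h = y * h'" by (auto simp: C_def)
      have "h' \<noteq> 0" using order_units_in(2)[OF h(2)] by auto
      then have "y / x = h * inverse h'" using h(3) W0 xy by (simp add: field_simps)
      then have "y / x \<in> ?H" using order_units_mult[OF h(1) order_units_inverse[OF h(2)]] by simp
      with W(5) xy show False by blast
    qed
  qed
  have "1 = emeasure \<mu> (\<Union>x\<in>W. C x)" using unit U by simp
  also have "\<dots> = (\<Sum>x\<in>W. emeasure \<mu> (C x))"
    by (rule sum_emeasure[symmetric]) (use C_sets W(1,3) W0 dis in auto)
  also have "\<dots> = (\<Sum>x\<in>W. emeasure \<mu> ?H)"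
    unfolding C_def by (rule sum.cong) (use inv H_sets W(3) W0 in auto)
  finally have eq: "1 = of_nat (card W) * emeasure \<mu> ?H" by simp
  \<comment> \<open>\<open>measure\<close> turns an infinite value into 0, so finiteness has to be
    known before leaving \<open>emeasure\<close>.\<close>
  have "emeasure \<mu> ?H \<le> emeasure \<mu> {x\<in>E. av x = 1}"
  proof (rule emeasure_mono)
    show "{x\<in>E. av x = 1} \<in> sets \<mu>" unfolding U using C_sets W(1,3) W0 by (intro sets.finite_UN) auto
  qed (use order_units_in in auto)
  then have "emeasure \<mu> ?H \<noteq> \<infinity>" using unit by (auto simp: top_unique)
  then have "emeasure \<mu> ?H = ennreal (measure \<mu> ?H)" by (simp add: emeasure_eq_ennreal_measure)
  then have "ennreal 1 = ennreal (real (card W) * measure \<mu> ?H)"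
    using eq by (simp add: ennreal_mult ennreal_of_nat_eq_real_of_nat)
  then have "1 = real (card W) * measure \<mu> ?H" by (subst (asm) ennreal_inj) auto
  then show ?thesis using W(2) by (metis nonzero_mult_div_cancel_left mult_zero_left zero_neq_one)
qed

end

section \<open>Ideals of rings of integers\<close>

lemma int_ring_simps [simp]:
  "carrier (int_ring av F) = {x\<in>F. av x \<le> 1}" "\<one>\<^bsub>int_ring av F\<^esub> = 1" "\<zero>\<^bsub>int_ring av F\<^esub> = 0"
  "x \<oplus>\<^bsub>int_ring av F\<^esub> y = x + y" "x \<otimes>\<^bsub>int_ring av F\<^esub> y = x * y"
  by (simp_all add: int_ring_def)

context valued
begin

lemma ring_int_ring: "subfield F \<Omega> \<Longrightarrow> ring (int_ring av F)"
proof -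
  assume F: "subfield F \<Omega>"
  note cl = subfield_closed[OF F]
  interpret \<Omega>: field "\<Omega> :: 'a ring" by (rule field_ambient)
  have "subring {x\<in>F. av x \<le> 1} \<Omega>"
    by (rule \<Omega>.subringI) (auto intro: cl av_add_le av_mult_le_1)
  then show ?thesis unfolding int_ring_def by (rule \<Omega>.subring_is_ring)
qed

lemma ideal_ball:
  assumes F: "subfield F \<Omega>" and c: "0 \<le> c" "c \<le> 1"
  shows "ideal {x\<in>F. av x \<le> c} (int_ring av F)"
proof -
  note cl = subfield_closed[OF F]
  interpret R: ring "int_ring av F" by (rule ring_int_ring[OF F])
  show ?thesis
  proof (rule idealI)
    show "ring (int_ring av F)" by (rule R.ring_axioms)
    show "subgroup {x\<in>F. av x \<le> c} (add_monoid (int_ring av F))"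
    proof (rule R.add.subgroupI)
      fix x assume x: "x \<in> {x\<in>F. av x \<le> c}"
      have "\<ominus>\<^bsub>int_ring av F\<^esub> x = - x"
        by (rule R.minus_equality) (use x c cl in auto)
      then show "\<ominus>\<^bsub>int_ring av F\<^esub> x \<in> {x\<in>F. av x \<le> c}" using x cl by simp
    qed (use c cl(1) in \<open>auto intro: cl(3) av_add_le\<close>)
  qed (auto intro: cl(4) av_mult_le_1 simp: mult.commute)
qed

text \<open>In a valuation ring a generator \<open>d\<close> of largest value generates alone,
  because x = (x / d) d whenever |x| <= |d|. This computes the ideals in \<open>unramified\<close>
  and \<open>discriminant\<close>.\<close>

lemma genideal_eq_ball:
  assumes F: "subfield F \<Omega>" and S: "S \<subseteq> {x\<in>F. av x \<le> av d}" "d \<in> S" and d: "av d \<le> 1"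
  shows "Idl\<^bsub>int_ring av F\<^esub> S = {x\<in>F. av x \<le> av d}"
proof
  show "Idl\<^bsub>int_ring av F\<^esub> S \<subseteq> {x\<in>F. av x \<le> av d}"
    unfolding genideal_def using ideal_ball[OF F _ d] S by auto
  show "{x\<in>F. av x \<le> av d} \<subseteq> Idl\<^bsub>int_ring av F\<^esub> S"
    unfolding genideal_def
  proof (intro subsetI InterI, elim CollectE conjE)
    fix x I assume x: "x \<in> F" "av x \<le> av d" and I: "ideal I (int_ring av F)" "S \<subseteq> I"
    interpret ideal I "int_ring av F" by (rule I)
    show "x \<in> I"
    proof (cases "d = 0")
      case True
      then have "x = 0" using x(2) av_pos[of x] by (auto simp del: av_pos)
      then show ?thesis using True S I by auto
    next
      case False
      have "x / d \<in> F" using x S subfield_closed[OF F] by auto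
      moreover have "av (x / d) \<le> 1" using x False by (simp add: av_divide)
      ultimately have "(x / d) * d \<in> I" using I_l_closed[of d "x / d"] S I by auto
      then show ?thesis using False by simp
    qed
  qed
qed

end

context discrete_valued
begin

lemma max_ideal_eq: "max_ideal av F = {x\<in>F. av x \<le> av p}"
  using less_1_imp_le_p p_less_1 by (auto simp: max_ideal_def)

lemma max_ideal_pow_eq: "max_ideal_pow av F n = {x\<in>F. av x \<le> av p ^ n}"
proof (induction n)
  case 0
  show ?case by (simp add: max_ideal_pow_def nat_pow_def ideals_set_def)
next
  case (Suc n)
  have "max_ideal_pow av F (Suc n) = ideal_prod (int_ring av F) (max_ideal_pow av F n) (max_ideal av F)"
    by (simp add: max_ideal_pow_def nat_pow_def ideals_set_def)
  also have "\<dots> = ideal_prod (int_ring av F) {x\<in>F. av x \<le> av p ^ n} {x\<in>F. av x \<le> av p}"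
    unfolding Suc max_ideal_eq ..
  also have "\<dots> = {x\<in>F. av x \<le> av p ^ Suc n}"
  proof (intro equalityI subsetI)
    fix x assume "x \<in> ideal_prod (int_ring av F) {x\<in>F. av x \<le> av p ^ n} {x\<in>F. av x \<le> av p}"
    then show "x \<in> {x\<in>F. av x \<le> av p ^ Suc n}"
    proof induction
      case (prod i j)
      then have "av i * av j \<le> av p ^ n * av p" by (intro mult_mono) auto
      with prod show ?case by (auto simp: av_mult mult.commute intro: F_closed(4))
    next
      case (sum x y)
      then show ?case by (auto intro: F_closed(3) av_add_le)
    qed
  next
    fix x assume x: "x \<in> {x\<in>F. av x \<le> av p ^ Suc n}"
    then have "x / p \<in> {x\<in>F. av x \<le> av p ^ n}"
      using F_closed(8)[OF _ p_in] p_pos by (simp add: av_divide field_simps)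
    moreover have "p \<in> {x\<in>F. av x \<le> av p}" using p_in by simp
    ultimately have "(x / p) \<otimes>\<^bsub>int_ring av F\<^esub> p \<in> ideal_prod (int_ring av F) {x\<in>F. av x \<le> av p ^ n} {x\<in>F. av x \<le> av p}"
      by (rule ideal_prod.prod)
    then show "x \<in> ideal_prod (int_ring av F) {x\<in>F. av x \<le> av p ^ n} {x\<in>F. av x \<le> av p}"
      using p_neq_0 by simp
  qed
  finally show ?case .
qed

end

text \<open>\<open>R\<close> takes one element from every residue class, so its cardinality is the
  residue cardinality of the theorem.\<close>

lemma local_field_discrete_valued:
  assumes av: "nonarch_abs_value av" and lf: "local_field av K"
  obtains p R where "discrete_valued av K p R" "card R = residue_card av K"
proof -
  interpret valued av using av by unfold_locales
  have K: "subfield K \<Omega>" and comp: "Metric_space.mcomplete K (av_dist av)"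
    and fin: "finite (carrier (int_ring av K Quot max_ideal av K))"
    using lf by (auto simp: local_field_def)
  note cl = subfield_closed[OF K]
  from lf obtain p where p: "p \<in> K" "0 < av p" "av p < 1" "\<forall>x\<in>K - {0}. \<exists>n::int. av x = av p powi n"
    by (auto simp: local_field_def)
  define C where "C a = {x\<in>K. av (x - a) < 1}" for a
  let ?O = "{a\<in>K. av a \<le> 1}"
  have coset: "max_ideal av K +>\<^bsub>int_ring av K\<^esub> a = C a" if "a \<in> ?O" for a
  proof -
    have "max_ideal av K +>\<^bsub>int_ring av K\<^esub> a = (\<lambda>i. i + a) ` max_ideal av K"
      by (auto simp: a_r_coset_def r_coset_def)
    also have "\<dots> = C a"
    proof (intro equalityI subsetI)
      fix x assume "x \<in> C a"
      then have "x - a \<in> max_ideal av K" using that cl by (auto simp: C_def max_ideal_def)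
      then show "x \<in> (\<lambda>i. i + a) ` max_ideal av K" by (rule rev_image_eqI) simp
    qed (use that cl in \<open>auto simp: C_def max_ideal_def\<close>)
    finally show ?thesis .
  qed
  have carr: "carrier (int_ring av K Quot max_ideal av K) = C ` ?O"
    using coset by (auto simp: FactRing_def A_RCOSETS_def RCOSETS_def a_r_coset_def)
  have self: "a \<in> C a" if "a \<in> ?O" for a using that by (simp add: C_def)
  have CO: "C a \<subseteq> ?O" if "a \<in> ?O" for a
  proof
    fix x assume "x \<in> C a"
    then show "x \<in> ?O" using that av_add_le[of "x - a" 1 a] by (auto simp: C_def)
  qed
  have Ceq: "C x = C a" if "av (x - a) < 1" for a x
  proof -
    have "av (y - a) < 1 \<longleftrightarrow> av (y - x) < 1" for y
      using av_add_less[of "y - x" 1 "x - a"] av_diff_less[of "y - a" 1 "x - a"] that by auto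
    then show ?thesis by (auto simp: C_def)
  qed
  define R where "R = (\<lambda>D. SOME x. x \<in> D) ` C ` ?O"
  have some: "(SOME x. x \<in> C a) \<in> C a" if "a \<in> ?O" for a
    by (rule someI[of _ a]) (rule self[OF that])
  have someC: "C (SOME x. x \<in> C a) = C a" if "a \<in> ?O" for a
    by (rule Ceq) (use some[OF that] in \<open>simp add: C_def\<close>)
  have inj: "inj_on (\<lambda>D. SOME x. x \<in> D) (C ` ?O)"
    by (rule inj_on_inverseI[of _ C]) (use someC in blast)
  have RO: "r \<in> ?O" if "r \<in> R" for r
    using that some CO unfolding R_def by blast
  have "discrete_valued av K p R"
  proof (intro discrete_valued.intro discrete_valued_axioms.intro, rule valued_axioms)
    fix x assume x: "x \<in> K" "av x \<le> 1"
    then have "(SOME y. y \<in> C x) \<in> R" "(SOME y. y \<in> C x) \<in> C x"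
      using some[of x] by (auto simp: R_def)
    then show "\<exists>r\<in>R. av (x - r) < 1" by (auto simp: C_def av_diff_commute)
  next
    fix r r' assume r: "r \<in> R" "r' \<in> R" "av (r - r') < 1"
    then obtain D D' where D: "D \<in> C ` ?O" "r = (SOME x. x \<in> D)" "D' \<in> C ` ?O" "r' = (SOME x. x \<in> D')"
      unfolding R_def by blast
    then have "C r = D" "C r' = D'" using someC by blast+
    moreover have "C r = C r'" by (rule Ceq[OF r(3)])
    ultimately show "r = r'" using D by simp
  next
    show "finite R" using fin by (simp add: R_def carr)
  qed (use K comp p RO in auto)
  moreover have "card R = residue_card av K"
    unfolding R_def residue_card_def carr by (rule card_image[OF inj])
  ultimately show ?thesis by (rule that)
qed

section \<open>Ramified and unramified quadratic extensions\<close>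

context discrete_quad
begin

text \<open>The maximal ideal of \<open>F\<close> generates the ball of radius |p| in the integers
  of \<open>E\<close>, so ramification means a value strictly between |p| and 1.\<close>

lemma unramified_iff: "unramified av F E \<longleftrightarrow> (\<forall>x\<in>E. av x < 1 \<longrightarrow> av x \<le> av p)"
proof -
  have "Idl\<^bsub>int_ring av E\<^esub> (max_ideal av F) = {x\<in>E. av x \<le> av p}"
    by (rule genideal_eq_ball[OF subfield_ext]) (use p_in p_less_1 in \<open>auto simp: max_ideal_eq\<close>)
  then have "unramified av F E \<longleftrightarrow> {x\<in>E. av x \<le> av p} = {x\<in>E. av x < 1}"
    by (simp add: unramified_def max_ideal_def)
  also have "\<dots> \<longleftrightarrow> (\<forall>x\<in>E. av x < 1 \<longrightarrow> av x \<le> av p)"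
    using p_less_1 by (auto simp: set_eq_iff)
  finally show ?thesis .
qed

lemma ramified_gt:
  assumes "av l ^ 2 = av p" shows "av p < av l" "av l < 1"
proof -
  show l1: "av l < 1" using assms p_less_1 one_le_power[of "av l" 2] by linarith
  have "0 < av l" using assms p_pos by (metis av_nonneg less_eq_real_def power_zero_numeral)
  then have "av l * av l < 1 * av l" using l1 by (intro mult_strict_right_mono)
  then show "av p < av l" using assms by (simp add: power2_eq_square)
qed

lemma unramified_value:
  assumes \<xi>: "\<xi> \<in> E" "av \<xi> = 1" "\<And>a. a \<in> F \<Longrightarrow> 1 \<le> av (\<xi> - a)" and x: "x \<in> E" "x \<noteq> 0"
  shows "\<exists>n::int. av x = av p powi n"
proof -
  have "\<xi> \<notin> F" using \<xi>(3)[of \<xi>] by auto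
  from basis_coords[OF x(1) \<xi>(1) this] obtain a b where ab: "a \<in> F" "b \<in> F" "x = a + b * \<xi>" by metis
  have "av x = max (av a) (av b)" using unramified_coord_norm[OF \<xi>(2,3) ab(1,2)] \<xi>(2) ab(3) by simp
  moreover have "\<exists>n::int. av a = av p powi n" if "av b \<le> av a"
  proof (rule value_group[OF ab(1)])
    show "a \<noteq> 0" using that x ab av_pos[of b] by (auto simp del: av_pos)
  qed
  moreover have "\<exists>n::int. av b = av p powi n" if "av a \<le> av b"
  proof (rule value_group[OF ab(2)])
    show "b \<noteq> 0" using that x ab av_pos[of a] by (auto simp del: av_pos)
  qed
  ultimately show ?thesis by (cases "av b \<le> av a") (auto simp: max_def)
qed

text \<open>An element with |l|^2 = |p| has a value strictly between |p| and 1, so only the second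
  alternative of \<open>dichotomy\<close> remains.\<close>

lemma unramified_generator:
  assumes "unramified av F E"
  obtains \<xi> where "\<xi> \<in> E" "av \<xi> = 1" "\<And>a. a \<in> F \<Longrightarrow> 1 \<le> av (\<xi> - a)"
  using dichotomy assms[unfolded unramified_iff] ramified_gt by fastforce

text \<open>In the second alternative of \<open>dichotomy\<close> the values of \<open>E\<close> are
  those of \<open>F\<close>, and none lies between |p| and 1.\<close>

lemma ramified_uniformizer:
  assumes "\<not> unramified av F E"
  obtains l where "l \<in> E" "av l ^ 2 = av p"
proof -
  from assms obtain x where x: "x \<in> E" "av x < 1" "av p < av x" by (auto simp: unramified_iff)
  have False if \<xi>: "\<xi> \<in> E" "av \<xi> = 1" "\<forall>a\<in>F. 1 \<le> av (\<xi> - a)" for \<xi>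
  proof -
    have "x \<noteq> 0" using x(3) av_nonneg[of p] by (auto simp del: av_nonneg)
    with unramified_value[OF \<xi>(1,2) _ x(1)] \<xi>(3) obtain n :: int where n: "av x = av p powi n" by blast
    have "0 < n" using x(2) n p_powi_less_iff[of n 0] by simp
    moreover have "n < 1" using x(3) n p_powi_less_iff[of 1 n] by simp
    ultimately show False by simp
  qed
  then show ?thesis using dichotomy that by blast
qed

lemma unramified_integral_basis:
  assumes "\<xi> \<in> E" "av \<xi> = 1" "\<And>a. a \<in> F \<Longrightarrow> 1 \<le> av (\<xi> - a)"
  shows "integral_basis av F p R E s \<xi>"
  by (intro integral_basis.intro integral_basis_axioms.intro, rule discrete_quad_axioms)
    (use assms p_less_1 unramified_coord_norm[OF assms(2,3)] assms(3)[of \<xi>] in auto)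

lemma ramified_integral_basis:
  assumes "l \<in> E" "av l ^ 2 = av p"
  shows "integral_basis av F p R E s l"
proof (intro integral_basis.intro integral_basis_axioms.intro, rule discrete_quad_axioms)
  show "l \<notin> F" using ramified_gt[OF assms(2)] less_1_imp_le_p[of l] by auto
qed (use assms ramified_gt[OF assms(2)] ramified_coord_norm[OF assms(2)] in auto)

end

lemma (in integral_basis) discriminant_eq:
  assumes s: "\<And>x. x \<in> E \<Longrightarrow> quad_conj F E x = s x"
  shows "discriminant av F E = {x\<in>F. av x \<le> av (t - s t) ^ 2}"
proof -
  define d where "d = (t * s 1 - 1 * s t) ^ 2"
  have d: "d = (t - s t) ^ 2" using conj_base base_closed(2) by (simp add: d_def)
  have dF: "d \<in> F"
  proof -
    have "d = (t + s t) ^ 2 - 4 * (t * s t)" by (simp add: d power2_eq_square algebra_simps)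
    then show ?thesis using trace_in[OF t_in] norm_in[OF t_in] F_closed by simp
  qed
  have "discriminant av F E = {x\<in>F. av x \<le> av d}"
    unfolding discriminant_def
  proof (rule genideal_eq_ball[OF subfield])
    show "av d \<le> 1" using av_diff_le[of t 1 "s t"] t_le conj_isometry[OF t_in] by (simp add: d av_power power_le_one)
    show "d \<in> {(\<omega>\<^sub>1 * quad_conj F E \<omega>\<^sub>2 - \<omega>\<^sub>2 * quad_conj F E \<omega>\<^sub>1)\<^sup>2 |\<omega>\<^sub>1 \<omega>\<^sub>2.
      \<omega>\<^sub>1 \<in> carrier (int_ring av E) \<and> \<omega>\<^sub>2 \<in> carrier (int_ring av E)}"
      unfolding d_def using t_in t_le ext_closed(2) s
      by (intro CollectI exI[of _ t] exI[of _ 1]) simp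
    show "{(\<omega>\<^sub>1 * quad_conj F E \<omega>\<^sub>2 - \<omega>\<^sub>2 * quad_conj F E \<omega>\<^sub>1)\<^sup>2 |\<omega>\<^sub>1 \<omega>\<^sub>2.
      \<omega>\<^sub>1 \<in> carrier (int_ring av E) \<and> \<omega>\<^sub>2 \<in> carrier (int_ring av E)} \<subseteq> {x\<in>F. av x \<le> av d}"
    proof (intro subsetI, elim CollectE exE conjE)
      fix x w1 w2 assume x: "x = (w1 * quad_conj F E w2 - w2 * quad_conj F E w1)\<^sup>2"
        and "w1 \<in> carrier (int_ring av E)" "w2 \<in> carrier (int_ring av E)"
      then have w: "w1 \<in> E" "av w1 \<le> 1" "w2 \<in> E" "av w2 \<le> 1" by auto
      from basis_coords[OF w(1) t_in t_notin] obtain a b where ab: "a \<in> F" "b \<in> F" "w1 = a + b * t" by metis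
      from basis_coords[OF w(3) t_in t_notin] obtain a' b' where ab': "a' \<in> F" "b' \<in> F" "w2 = a' + b' * t" by metis
      have le: "av a \<le> 1" "av b \<le> 1" "av a' \<le> 1" "av b' \<le> 1"
        using coords_integral[of a b] coords_integral[of a' b'] ab ab' w by auto
      have sw: "s w1 = a + b * s t" "s w2 = a' + b' * s t"
        using ab ab' t_in ext_closed(4) base_in conj_base by (simp_all add: conj_add conj_mult)
      have "w1 * s w2 - w2 * s w1 = (b * a' - a * b') * (t - s t)"
        unfolding sw by (simp add: ab(3) ab'(3) algebra_simps)
      then have x': "x = d * (b * a' - a * b') ^ 2"
        unfolding x d using s w by (simp add: power_mult_distrib)
      have "av ((b * a' - a * b') ^ 2) \<le> 1"
        unfolding av_power by (rule power_le_one) (use le in \<open>auto intro: av_diff_le av_mult_le_1\<close>)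
      then have "av x \<le> av d" unfolding x' by (intro av_mult_le_1) auto
      moreover have "x \<in> F" unfolding x' using dF ab ab' F_closed by simp
      ultimately show "x \<in> {x\<in>F. av x \<le> av d}" by simp
    qed
  qed
  then show ?thesis by (simp add: d av_power)
qed

section \<open>The identity component of the stabilizer\<close>

no_notation fps_nth (infixl \<open>$\<close> 75)

section \<open>Two-by-two matrices and the pencil of the standard representative\<close>

lemma mat2_nth [simp]:
  "mat2 a b c d $ 1 $ 1 = a" "mat2 a b c d $ 1 $ 2 = b" "mat2 a b c d $ 2 $ 1 = c" "mat2 a b c d $ 2 $ 2 = d"
  by (simp_all add: mat2_def)

lemma mat2_eq_iff:
  "A = (B :: 'a mat2) \<longleftrightarrow> A $ 1 $ 1 = B $ 1 $ 1 \<and> A $ 1 $ 2 = B $ 1 $ 2 \<and> A $ 2 $ 1 = B $ 2 $ 1 \<and> A $ 2 $ 2 = B $ 2 $ 2"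
  by (auto simp: vec_eq_iff forall_2)

lemma mat2_mult_nth: "((A :: 'a::semiring_1 mat2) ** B) $ i $ j = A $ i $ 1 * B $ 1 $ j + A $ i $ 2 * B $ 2 $ j"
  by (simp add: matrix_matrix_mult_def sum_2)

lemma vec_mat2_nth: "((u :: 'a::comm_semiring_1 ^ 2) v* A) $ j = A $ 1 $ j * u $ 1 + A $ 2 $ j * u $ 2"
  by (simp add: vector_matrix_mult_def sum_2 mult.commute)

lemma transpose_nth: "transpose A $ i $ j = A $ j $ i"
  by (simp add: transpose_def)

lemma mat_1_nth: "(mat 1 :: 'a::semiring_1 mat2) $ 1 $ 1 = 1" "(mat 1 :: 'a mat2) $ 1 $ 2 = 0"
  "(mat 1 :: 'a mat2) $ 2 $ 1 = 0" "(mat 1 :: 'a mat2) $ 2 $ 2 = 1"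
  by (simp_all add: mat_def)

lemma pencil_std_rep:
  "pencil (std_rep a1 a2) u = mat2 (u $ 2) (u $ 1 + a1 * u $ 2) (u $ 1 + a1 * u $ 2)
     (a1 * u $ 1 + (a1\<^sup>2 - a2) * u $ 2)"
  by (simp add: pencil_def std_rep_def mat2_eq_iff mult.commute)

lemma disc_form_std_rep:
  "disc_form (std_rep a1 a2) u = (u $ 1)\<^sup>2 + a1 * u $ 1 * u $ 2 + a2 * (u $ 2)\<^sup>2"
  by (simp add: disc_form_def pencil_std_rep det_2 power2_eq_square algebra_simps)

text \<open>The matrix A_p(c, d). For a root \<alpha> of z^2 + a1 z + a2 the column (1, - \<alpha>)
  is an eigenvector with eigenvalue c + d \<alpha>.\<close>

definition torus_mat :: "'a::field \<Rightarrow> 'a \<Rightarrow> 'a \<Rightarrow> 'a \<Rightarrow> 'a mat2" where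
  "torus_mat a1 a2 c d = mat2 c (- d) (a2 * d) (c - a1 * d)"

text \<open>The norm form: the product of c + d \<alpha> over the two roots \<alpha> of z^2 + a1 z +
  a2.\<close>

definition torus_det :: "'a::field \<Rightarrow> 'a \<Rightarrow> 'a \<Rightarrow> 'a \<Rightarrow> 'a" where
  "torus_det a1 a2 c d = c\<^sup>2 - a1 * c * d + a2 * d\<^sup>2"

lemma torus_mat_nth [simp]:
  "torus_mat a1 a2 c d $ 1 $ 1 = c" "torus_mat a1 a2 c d $ 1 $ 2 = - d"
  "torus_mat a1 a2 c d $ 2 $ 1 = a2 * d" "torus_mat a1 a2 c d $ 2 $ 2 = c - a1 * d"
  by (simp_all add: torus_mat_def)

text \<open>A torus matrix on either side of the pencil can be moved onto its argument. Hence A on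
  the left and the transpose of B on the right are compensated by the inverse of A B acting on
  \<open>u\<close>.\<close>

lemma torus_mat_pencil:
  "torus_mat a1 a2 c d ** pencil (std_rep a1 a2) u = pencil (std_rep a1 a2) (u v* torus_mat a1 a2 c d)"
  "pencil (std_rep a1 a2) u ** transpose (torus_mat a1 a2 c d) = pencil (std_rep a1 a2) (u v* torus_mat a1 a2 c d)"
  by (simp_all add: mat2_eq_iff mat2_mult_nth pencil_std_rep vec_mat2_nth transpose_nth power2_eq_square algebra_simps)

lemma torus_mat_mult:
  "torus_mat a1 a2 c d ** torus_mat a1 a2 c' d' = torus_mat a1 a2 (c * c' - a2 * d * d') (c * d' + c' * d - a1 * d * d')"
  by (simp add: mat2_eq_iff mat2_mult_nth algebra_simps)

lemma torus_mat_1: "torus_mat a1 a2 1 0 = mat 1"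
  by (simp add: mat2_eq_iff mat_1_nth)

text \<open>Its parameters are those of the conjugate of c + d \<alpha> divided by the norm.\<close>

definition torus_inv :: "'a::field \<Rightarrow> 'a \<Rightarrow> 'a \<Rightarrow> 'a \<Rightarrow> 'a mat2" where
  "torus_inv a1 a2 c d = torus_mat a1 a2 ((c - a1 * d) / torus_det a1 a2 c d) (- d / torus_det a1 a2 c d)"

lemma torus_mat_inv:
  assumes "torus_det a1 a2 c d \<noteq> 0"
  shows "torus_mat a1 a2 c d ** torus_inv a1 a2 c d = mat 1" "torus_inv a1 a2 c d ** torus_mat a1 a2 c d = mat 1"
proof -
  let ?D = "torus_det a1 a2 c d"
  have "c * ((c - a1 * d) / ?D) - a2 * d * (- d / ?D) = ?D / ?D"
    unfolding add_divide_distrib[symmetric] diff_divide_distrib[symmetric] times_divide_eq_right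
    by (simp add: torus_det_def power2_eq_square algebra_simps)
  then have 1: "c * ((c - a1 * d) / ?D) - a2 * d * (- d / ?D) = 1" using assms by simp
  have 2: "c * (- d / ?D) + ((c - a1 * d) / ?D) * d - a1 * d * (- d / ?D) = 0"
    using assms by (simp add: field_simps)
  show "torus_mat a1 a2 c d ** torus_inv a1 a2 c d = mat 1"
    unfolding torus_inv_def torus_mat_mult 1 2 by (rule torus_mat_1)
  have one': "((c - a1 * d) / ?D) * c - a2 * (- d / ?D) * d = 1" using 1 by (simp add: mult_ac)
  have two': "((c - a1 * d) / ?D) * d + c * (- d / ?D) - a1 * (- d / ?D) * d = 0" using 2 by (simp add: mult_ac add.commute)
  show "torus_inv a1 a2 c d ** torus_mat a1 a2 c d = mat 1"
    unfolding torus_inv_def torus_mat_mult one' two' by (rule torus_mat_1)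
qed

lemma torus_mat_commute:
  "torus_mat a1 a2 c d ** torus_mat a1 a2 c' d' = torus_mat a1 a2 c' d' ** torus_mat a1 a2 c d"
  unfolding torus_mat_mult by (simp add: algebra_simps)

text \<open>The pairs (c, d) and (c', d') are independent because a geometric point has two
  unrelated first factors; for points over \<open>K\<close> the second pair is the conjugate of the
  first.\<close>

definition torus_point :: "'a::field \<Rightarrow> 'a \<Rightarrow> 'a \<Rightarrow> 'a \<Rightarrow> 'a \<Rightarrow> 'a \<Rightarrow> 'a geom" where
  "torus_point a1 a2 c d c' d' = (torus_mat a1 a2 c d, torus_mat a1 a2 c' d', torus_inv a1 a2 c d ** torus_inv a1 a2 c' d')"

lemma GL2_UNIV_I: "A ** B = mat 1 \<Longrightarrow> B ** A = mat 1 \<Longrightarrow> A \<in> GL2 UNIV"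
  unfolding GL2_def by blast

lemma torus_mat_mult_inv:
  assumes "torus_det a1 a2 c d \<noteq> 0" "torus_det a1 a2 c' d' \<noteq> 0"
  shows "torus_inv a1 a2 c d ** torus_inv a1 a2 c' d' ** (torus_mat a1 a2 c d ** torus_mat a1 a2 c' d') = mat 1"
    "torus_mat a1 a2 c d ** torus_mat a1 a2 c' d' ** (torus_inv a1 a2 c d ** torus_inv a1 a2 c' d') = mat 1"
proof -
  let ?A = "torus_mat a1 a2 c d" and ?B = "torus_mat a1 a2 c' d'"
  let ?A' = "torus_inv a1 a2 c d" and ?B' = "torus_inv a1 a2 c' d'"
  note inv = torus_mat_inv[OF assms(1)] torus_mat_inv[OF assms(2)]
  have comm: "?A' ** ?B' = ?B' ** ?A'" unfolding torus_inv_def by (rule torus_mat_commute)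
  show "?A' ** ?B' ** (?A ** ?B) = mat 1"
    unfolding comm by (metis inv(2,4) matrix_mul_assoc matrix_mul_lid)
  show "?A ** ?B ** (?A' ** ?B') = mat 1"
    unfolding comm by (metis inv(1,3) matrix_mul_assoc matrix_mul_lid)
qed

lemma torus_point_in_stabilizer:
  assumes "torus_det a1 a2 c d \<noteq> 0" "torus_det a1 a2 c' d' \<noteq> 0"
  shows "torus_point a1 a2 c d c' d' \<in> geom_stabilizer (std_rep a1 a2)"
proof -
  let ?A = "torus_mat a1 a2 c d" and ?B = "torus_mat a1 a2 c' d'"
  let ?A' = "torus_inv a1 a2 c d" and ?B' = "torus_inv a1 a2 c' d'"
  note inv = torus_mat_inv[OF assms(1)] torus_mat_inv[OF assms(2)]
  have 1: "?A' ** ?B' ** (?A ** ?B) = mat 1" and 2: "?A ** ?B ** (?A' ** ?B') = mat 1"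
    by (rule torus_mat_mult_inv[OF assms])+
  have "?A ** pencil (std_rep a1 a2) (u v* (?A' ** ?B')) ** transpose ?B = pencil (std_rep a1 a2) u" for u
    unfolding torus_mat_pencil vector_matrix_mul_assoc 
    using 1 by (simp add: matrix_mul_assoc)
  then show ?thesis
    unfolding geom_stabilizer_def torus_point_def
    using GL2_UNIV_I[OF inv(1,2)] GL2_UNIV_I[OF inv(3,4)] GL2_UNIV_I[OF 1 2] by simp
qed

text \<open>A torus point is joined to the identity by the line through the two, whose coordinates are
  rational functions of the parameter.\<close>

lemma torus_point_in_component:
  fixes a1 a2 :: "'a::field_char_0"
  assumes "torus_det a1 a2 c d \<noteq> 0" "torus_det a1 a2 c' d' \<noteq> 0"
  shows "torus_point a1 a2 c d c' d' \<in> geom_stabilizer_0 (std_rep a1 a2)"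
proof -
  let ?S = "geom_stabilizer (std_rep a1 a2)"
  define C D C' D' where "C = [:1, c - 1:]" and "D = [:0, d:]" and "C' = [:1, c' - 1:]" and "D' = [:0, d':]"
  define N where "N = C * C - [:a1:] * (C * D) + [:a2:] * (D * D)"
  define N' where "N' = C' * C' - [:a1:] * (C' * D') + [:a2:] * (D' * D')"
  define T where "T = {t. poly (N * N') t \<noteq> 0}"
  have det: "torus_det a1 a2 (poly C t) (poly D t) = poly N t"
    and det': "torus_det a1 a2 (poly C' t) (poly D' t) = poly N' t" for t
    by (simp_all add: torus_det_def N_def N'_def power2_eq_square algebra_simps)
  define \<gamma> where "\<gamma> t = torus_point a1 a2 (poly C t) (poly D t) (poly C' t) (poly D' t)" for t
  have \<gamma>0: "\<gamma> 0 = (mat 1, mat 1, mat 1)"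
    by (simp add: \<gamma>_def C_def D_def C'_def D'_def torus_point_def torus_inv_def torus_det_def torus_mat_1)
  have \<gamma>1: "\<gamma> 1 = torus_point a1 a2 c d c' d'"
    by (simp add: \<gamma>_def C_def D_def C'_def D'_def)
  have "poly C 1 = c" "poly D 1 = d" "poly C' 1 = c'" "poly D' 1 = d'"
    by (simp_all add: C_def D_def C'_def D'_def)
  with det[of 1] det'[of 1] assms have T1: "1 \<in> T" by (simp add: T_def)
  have T0: "0 \<in> T" by (simp add: T_def N_def N'_def C_def D_def C'_def D'_def)
  have cofin: "finite (T - {t\<in>T. poly P t \<noteq> 0})" if "P \<noteq> 0" for P
    by (rule finite_subset[OF _ poly_roots_finite[OF that]]) auto
  have NN: "N * N' \<noteq> 0" using T0 by (auto simp: T_def)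
  have infT: "infinite T"
  proof
    assume "finite T"
    then have "finite (T \<union> {t. poly (N * N') t = 0})" using poly_roots_finite[OF NN] by simp
    moreover have "T \<union> {t. poly (N * N') t = 0} = UNIV" by (auto simp: T_def)
    ultimately show False using infinite_UNIV_char_0 by metis
  qed
  \<comment> \<open>Along the line a polynomial function becomes a polynomial divided by a power of
    N N', so it vanishes on all of \<open>T\<close> or at finitely many points only.\<close>
  define ratl where "ratl \<phi> \<longleftrightarrow> (\<exists>P k. \<forall>t\<in>T. \<phi> t * poly (N * N') t ^ k = poly P t)" for \<phi>
  have ratl_poly: "ratl (poly P)" for P
    unfolding ratl_def by (intro exI[of _ P] exI[of _ 0]) simp
  have ratl_const: "ratl (\<lambda>_. a)" for a
    unfolding ratl_def by (intro exI[of _ "[:a:]"] exI[of _ 0]) simp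
  have ratl_add: "ratl (\<lambda>t. \<phi> t + \<psi> t)" and ratl_mult: "ratl (\<lambda>t. \<phi> t * \<psi> t)"
    if "ratl \<phi>" "ratl \<psi>" for \<phi> \<psi>
  proof -
    from that obtain P k Q m where PQ: "\<And>t. t \<in> T \<Longrightarrow> \<phi> t * poly (N * N') t ^ k = poly P t"
      "\<And>t. t \<in> T \<Longrightarrow> \<psi> t * poly (N * N') t ^ m = poly Q t" unfolding ratl_def by blast
    show "ratl (\<lambda>t. \<phi> t + \<psi> t)"
      unfolding ratl_def
    proof (intro exI[of _ "P * (N * N') ^ m + Q * (N * N') ^ k"] exI[of _ "k + m"] ballI)
      fix t assume t: "t \<in> T"
      show "(\<phi> t + \<psi> t) * poly (N * N') t ^ (k + m) = poly (P * (N * N') ^ m + Q * (N * N') ^ k) t"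
        unfolding poly_add poly_mult[of P] poly_mult[of Q] poly_power PQ[OF t, symmetric]
        by (simp add: power_add algebra_simps)
    qed
    show "ratl (\<lambda>t. \<phi> t * \<psi> t)"
      unfolding ratl_def
    proof (intro exI[of _ "P * Q"] exI[of _ "k + m"] ballI)
      fix t assume t: "t \<in> T"
      show "(\<phi> t * \<psi> t) * poly (N * N') t ^ (k + m) = poly (P * Q) t"
        unfolding poly_mult[of P] PQ[OF t, symmetric] by (simp add: power_add algebra_simps)
    qed
  qed
  have ratl_inv: "ratl (\<lambda>t. inverse (poly N t))"
    unfolding ratl_def by (intro exI[of _ N'] exI[of _ 1]) (auto simp: T_def)
  have ratl_inv': "ratl (\<lambda>t. inverse (poly N' t))"
    unfolding ratl_def by (intro exI[of _ N] exI[of _ 1]) (auto simp: T_def)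
  have ratl_minus: "ratl (\<lambda>t. - \<phi> t)" if "ratl \<phi>" for \<phi>
    using ratl_mult[OF ratl_const[of "-1"] that] by simp
  have ratl_diff: "ratl (\<lambda>t. \<phi> t - \<psi> t)" if "ratl \<phi>" "ratl \<psi>" for \<phi> \<psi>
    using ratl_add[OF that(1) ratl_minus[OF that(2)]] by simp
  note ratl_intros = ratl_poly ratl_const ratl_add ratl_mult ratl_inv ratl_inv' ratl_minus ratl_diff
  have two: "i = 1 \<or> i = 2" for i :: 2 using exhaust_2 by blast
  have ratl_torus: "ratl (\<lambda>t. torus_mat a1 a2 (\<phi> t) (\<psi> t) $ i $ j)" if "ratl \<phi>" "ratl \<psi>" for \<phi> \<psi> i j
    using two[of i] two[of j] by (elim disjE) (simp_all add: that ratl_intros)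
  have ratl_pf: "ratl (\<lambda>t. f (\<gamma> t))" if "f \<in> polynomial_funs" for f
    using that
  proof induction
    case (coord1 i j)
    then show ?case by (simp add: \<gamma>_def torus_point_def ratl_torus ratl_intros)
  next
    case (coord2 i j)
    then show ?case by (simp add: \<gamma>_def torus_point_def ratl_torus ratl_intros)
  next
    case (coord3 i j)
    show ?case
      by (simp add: \<gamma>_def torus_point_def torus_inv_def mat2_mult_nth det det' divide_inverse
          ratl_torus ratl_intros)
  qed (simp_all add: ratl_intros)
  \<comment> \<open>The cofinite topology on \<open>T\<close>, that is, the Zariski topology of a
    line without finitely many points. It is connected because \<open>T\<close> is infinite.\<close>
  define cof where "cof = topology (\<lambda>U. U = {} \<or> U \<subseteq> T \<and> finite (T - U))"
  have "istopology (\<lambda>U. U = {} \<or> U \<subseteq> T \<and> finite (T - U))"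
    unfolding istopology_def
  proof (intro conjI allI impI)
    fix U V assume "U = {} \<or> U \<subseteq> T \<and> finite (T - U)" "V = {} \<or> V \<subseteq> T \<and> finite (T - V)"
    then show "U \<inter> V = {} \<or> U \<inter> V \<subseteq> T \<and> finite (T - U \<inter> V)"
      by (auto simp: Diff_Int)
  next
    fix \<U> assume U: "\<forall>U\<in>\<U>. U = {} \<or> U \<subseteq> T \<and> finite (T - U)"
    show "\<Union>\<U> = {} \<or> \<Union>\<U> \<subseteq> T \<and> finite (T - \<Union>\<U>)"
    proof (cases "\<Union>\<U> = {}")
      case False
      then obtain V where V: "V \<in> \<U>" "V \<noteq> {}" by auto
      then have "finite (T - V)" using U by blast
      then have "finite (T - \<Union>\<U>)" by (rule finite_subset[rotated]) (use V in auto)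
      moreover have "\<Union>\<U> \<subseteq> T" using U by blast
      ultimately show ?thesis by blast
    qed simp
  qed
  then have open_cof: "openin cof U \<longleftrightarrow> U = {} \<or> U \<subseteq> T \<and> finite (T - U)" for U
    unfolding cof_def by simp
  have top_cof: "topspace cof = T"
  proof
    show "topspace cof \<subseteq> T" using openin_topspace[of cof] unfolding open_cof by blast
    show "T \<subseteq> topspace cof" by (rule openin_subset) (simp add: open_cof)
  qed
  have conn: "connected_space cof"
    unfolding connected_space_def top_cof
  proof (intro notI, elim exE conjE)
    fix U V assume UV: "openin cof U" "openin cof V" "T \<subseteq> U \<union> V" "U \<inter> V = {}" "U \<noteq> {}" "V \<noteq> {}"
    then have "finite (T - U)" "finite (T - V)" unfolding open_cof by metis+
    moreover have "T = (T - U) \<union> (T - V)" using UV(4) by blast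
    ultimately show False using infT by (metis finite_Un)
  qed
  have cont: "continuous_map cof zariski \<gamma>"
    unfolding zariski_def
  proof (rule continuous_on_generated_topo)
    fix U :: "'a geom set" assume "U \<in> {{t. f t \<noteq> 0} | f. f \<in> polynomial_funs}"
    then obtain f where f: "f \<in> polynomial_funs" "U = {t. f t \<noteq> 0}" by auto
    from ratl_pf[OF f(1)] obtain P k where P: "\<And>t. t \<in> T \<Longrightarrow> f (\<gamma> t) * poly (N * N') t ^ k = poly P t"
      unfolding ratl_def by blast
    have "f (\<gamma> t) \<noteq> 0 \<longleftrightarrow> poly P t \<noteq> 0" if "t \<in> T" for t
    proof -
      have "poly (N * N') t ^ k \<noteq> 0" using that unfolding T_def by simp
      then show ?thesis using P[OF that] by (metis mult_eq_0_iff)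
    qed
    then have "\<gamma> -` U \<inter> topspace cof = {t\<in>T. poly P t \<noteq> 0}" by (auto simp: top_cof f)
    then show "openin cof (\<gamma> -` U \<inter> topspace cof)"
      using cofin[of P] unfolding open_cof by (cases "P = 0") simp_all
  next
    have "UNIV \<in> {{t :: 'a geom. f t \<noteq> 0} | f. f \<in> polynomial_funs}"
      by (intro CollectI exI[of _ "\<lambda>_. 1"] conjI polynomial_funs.const) simp
    then show "\<gamma> ` topspace cof \<subseteq> \<Union> {{t. f t \<noteq> 0} | f. f \<in> polynomial_funs}"
      by (meson Sup_upper order_trans subset_UNIV)
  qed
  have "connectedin cof T" using conn unfolding top_cof[symmetric] by (simp add: connectedin_topspace)
  then have "connectedin zariski (\<gamma> ` T)" by (rule connectedin_continuous_map_image[OF cont])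
  moreover have "\<gamma> ` T \<subseteq> ?S"
    using det det' by (auto simp: \<gamma>_def T_def intro!: torus_point_in_stabilizer)
  ultimately have "connectedin (subtopology zariski ?S) (\<gamma> ` T)"
    by (simp add: connectedin_subtopology)
  then have "connected_component_of (subtopology zariski ?S) (\<gamma> 0) (\<gamma> 1)"
    unfolding connected_component_of_def using T0 T1 by blast
  then show ?thesis by (simp add: geom_stabilizer_0_def \<gamma>0 \<gamma>1)
qed

text \<open>The stabilizer permutes the two roots of the form, and the elements fixing them form an open
  and closed subset.\<close>

lemma stabilizer_component_eigenvector:
  fixes a1 a2 \<alpha> :: "'a::field_char_0"
  assumes root: "\<alpha>\<^sup>2 + a1 * \<alpha> + a2 = 0" and neq: "\<alpha> \<noteq> - a1 - \<alpha>"
    and mem: "(g, g', h) \<in> geom_stabilizer_0 (std_rep a1 a2)"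
  shows "g $ 2 $ 1 + g $ 2 $ 2 * (\<alpha> + a1) = (g $ 1 $ 1 + g $ 1 $ 2 * (\<alpha> + a1)) * (\<alpha> + a1)"
proof -
  let ?x = "std_rep a1 a2"
  let ?S = "geom_stabilizer ?x"
  define v :: "'a^2" where "v = vector [\<alpha>, 1]"
  have v: "v $ 1 = \<alpha>" "v $ 2 = 1" by (simp_all add: v_def)
  define l where "l u = u $ 1 - \<alpha> * u $ 2" for u :: "'a^2"
  define l' where "l' u = u $ 1 - (- a1 - \<alpha>) * u $ 2" for u :: "'a^2"
  have a2: "a2 = - (\<alpha>\<^sup>2) - a1 * \<alpha>" using root by (simp add: eq_diff_eq eq_neg_iff_add_eq_0 ac_simps)
  have form: "disc_form ?x u = l u * l' u" for u
    by (simp add: disc_form_std_rep l_def l'_def a2 power2_eq_square algebra_simps)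
  have both: "u = 0" if "l u = 0" "l' u = 0" for u
  proof -
    have "(\<alpha> - (- a1 - \<alpha>)) * u $ 2 = 0" using that by (simp add: l_def l'_def algebra_simps)
    moreover have "\<alpha> - (- a1 - \<alpha>) \<noteq> 0" using neq by (metis eq_iff_diff_eq_0)
    ultimately have "u $ 2 = 0" by (metis mult_eq_0_iff)
    then show ?thesis using that by (simp add: l_def vec_eq_iff forall_2)
  qed
  have nz: "v v* h \<noteq> 0" if "h \<in> GL2 UNIV" for h
  proof
    assume 0: "v v* h = 0"
    from that obtain B where B: "h ** B = mat 1" by (auto simp: GL2_def)
    have "v = v v* (h ** B)" unfolding B by simp
    also have "\<dots> = 0" unfolding vector_matrix_mul_assoc[symmetric] 0 by (simp add: vec_eq_iff forall_2 vec_mat2_nth)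
    finally show False using v by simp
  qed
  have prod0: "l (v v* h) * l' (v v* h) = 0" if "(g, g', h) \<in> ?S" for g g' h
  proof -
    from that have g: "g \<in> GL2 UNIV" "g' \<in> GL2 UNIV" and eq: "g ** pencil ?x (v v* h) ** transpose g' = pencil ?x v"
      by (auto simp: geom_stabilizer_def)
    have "det g \<noteq> 0" "det g' \<noteq> 0" if "g \<in> GL2 UNIV" "g' \<in> GL2 UNIV" for g g' :: "'a mat2"
      using that by (auto simp: GL2_def) (metis det_I det_mul mult_zero_left zero_neq_one)+
    with g have "det g \<noteq> 0" "det g' \<noteq> 0" by blast+
    moreover have "det g * det (pencil ?x (v v* h)) * det g' = det (pencil ?x v)"
      unfolding eq[symmetric] by (simp add: det_mul)
    moreover have "det (pencil ?x v) = 0"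
      using form[of v] by (simp add: disc_form_def l_def v)
    ultimately show ?thesis using form[of "v v* h"] by (simp add: disc_form_def)
  qed
  \<comment> \<open>The vector v v* h is a root of the form l l' again. Elements of \<open>U\<close>
    fix the root \<open>v\<close>, those of \<open>V\<close> send it to the other root.\<close>
  define U where "U = {t \<in> ?S. case t of (g, g', h) \<Rightarrow> l' (v v* h) \<noteq> 0}"
  define V where "V = {t \<in> ?S. case t of (g, g', h) \<Rightarrow> l (v v* h) \<noteq> 0}"
  have open_lin: "openin (subtopology zariski ?S) {t \<in> ?S. case t of (g, g', h) \<Rightarrow> (v v* h) $ 1 - b * (v v* h) $ 2 \<noteq> 0}" for b
  proof -
    define f :: "'a geom \<Rightarrow> 'a" where "f = (\<lambda>t. ((case t of (g, g', h) \<Rightarrow> h $ 1 $ 1) * \<alpha> + (case t of (g, g', h) \<Rightarrow> h $ 2 $ 1))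
        + (- b) * ((case t of (g, g', h) \<Rightarrow> h $ 1 $ 2) * \<alpha> + (case t of (g, g', h) \<Rightarrow> h $ 2 $ 2)))"
    have "f \<in> polynomial_funs" unfolding f_def
      by (intro polynomial_funs.intros)
    then have "openin zariski {t. f t \<noteq> 0}"
      unfolding zariski_def by (intro topology_generated_by_Basis) blast
    moreover have "{t \<in> ?S. case t of (g, g', h) \<Rightarrow> (v v* h) $ 1 - b * (v v* h) $ 2 \<noteq> 0} = {t. f t \<noteq> 0} \<inter> ?S"
      by (auto simp: f_def vec_mat2_nth v algebra_simps)
    ultimately show ?thesis by (auto simp: openin_subtopology)
  qed
  have openU: "openin (subtopology zariski ?S) U" and openV: "openin (subtopology zariski ?S) V"
    using open_lin unfolding U_def V_def l_def l'_def by blast+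
  have UV: "?S \<subseteq> U \<union> V" "U \<inter> V = {}"
  proof -
    show "?S \<subseteq> U \<union> V"
    proof
      fix t assume t: "t \<in> ?S"
      obtain g g' h where [simp]: "t = (g, g', h)" by (cases t) auto
      from t have "h \<in> GL2 UNIV" by (simp add: geom_stabilizer_def)
      with nz both have "l (v v* h) \<noteq> 0 \<or> l' (v v* h) \<noteq> 0" by blast
      with t show "t \<in> U \<union> V" by (auto simp: U_def V_def)
    qed
    show "U \<inter> V = {}" using prod0 by (fastforce simp: U_def V_def)
  qed
  from mem have "connected_component_of (subtopology zariski ?S) (mat 1, mat 1, mat 1) (g, g', h)"
    by (simp add: geom_stabilizer_0_def)
  then obtain C where C: "connectedin (subtopology zariski ?S) C" "(mat 1, mat 1, mat 1) \<in> C" "(g, g', h) \<in> C"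
    unfolding connected_component_of_def by blast
  have CS: "C \<subseteq> ?S" using C(1) connectedin_subset_topspace by fastforce
  have "(mat 1, mat 1, mat 1) \<in> U"
  proof -
    have "l' v \<noteq> 0" unfolding l'_def v using neq by (metis eq_iff_diff_eq_0 mult.right_neutral)
    then show ?thesis using CS C(2) by (auto simp: U_def)
  qed
  then have "C \<inter> U \<noteq> {}" using C(2) by blast
  moreover have "\<not> (C \<subseteq> U \<union> V \<and> U \<inter> V \<inter> C = {} \<and> U \<inter> C \<noteq> {} \<and> V \<inter> C \<noteq> {})"
    using C(1) openU openV unfolding connectedin by blast
  ultimately have "V \<inter> C = {}" using UV CS by blast
  then have lh: "l (v v* h) = 0" using C(3) CS by (auto simp: V_def)
  define k where "k = (v v* h) $ 2"
  have vh: "(v v* h) $ 1 = k * \<alpha>" "(v v* h) $ 2 = k" using lh by (simp_all add: l_def k_def mult.commute)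
  have "(g, g', h) \<in> ?S" using CS C(3) by blast
  then have eq: "g ** pencil ?x (v v* h) ** transpose g' = pencil ?x v" by (simp add: geom_stabilizer_def)
  \<comment> \<open>At the root the pencil has rank one: it is a multiple of the column (1, b) times
    its transpose. Comparing the first columns of the stabilizer equation shows that
    \<open>g\<close> has (1, b) as an eigenvector.\<close>
  define b where "b = \<alpha> + a1"
  have pv: "pencil ?x u = mat2 m (m * b) (m * b) (m * b * b)" if "u $ 1 = m * \<alpha>" "u $ 2 = m" for u m
    by (simp add: pencil_std_rep mat2_eq_iff that b_def a2 power2_eq_square algebra_simps)
  define m where "m = k * (g' $ 1 $ 1 + b * g' $ 1 $ 2)"
  have pv1: "pencil ?x v = mat2 1 b b (b * b)" using pv[of v 1] v by simp
  have e1: "(g $ 1 $ 1 + g $ 1 $ 2 * b) * m = 1"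
    using eq[unfolded pv[OF vh] pv1, THEN arg_cong, of "\<lambda>A. A $ 1 $ 1"]
    by (simp add: mat2_mult_nth transpose_nth m_def algebra_simps)
  have e2: "(g $ 2 $ 1 + g $ 2 $ 2 * b) * m = b"
    using eq[unfolded pv[OF vh] pv1, THEN arg_cong, of "\<lambda>A. A $ 2 $ 1"]
    by (simp add: mat2_mult_nth transpose_nth m_def algebra_simps)
  have "(g $ 2 $ 1 + g $ 2 $ 2 * b) * m = ((g $ 1 $ 1 + g $ 1 $ 2 * b) * b) * m"
    using e1 e2 by (metis mult.assoc mult.commute mult_1)
  moreover have "m \<noteq> 0" using e1 by auto
  ultimately show ?thesis by (simp add: b_def)
qed

text \<open>Modulo the quadratic equation, the eigenvector condition is linear in the root. Its
  coefficients \<open>P\<close> and \<open>Q\<close> measure how far \<open>g\<close> is from a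
  torus matrix, and they vanish because the condition holds at two distinct roots.\<close>

lemma stabilizer_component_torus:
  fixes a1 a2 \<alpha> :: "'a::field_char_0"
  assumes root: "\<alpha>\<^sup>2 + a1 * \<alpha> + a2 = 0" and neq: "\<alpha> \<noteq> - a1 - \<alpha>"
    and mem: "(g, g', h) \<in> geom_stabilizer_0 (std_rep a1 a2)"
  shows "g = torus_mat a1 a2 (g $ 1 $ 1) (- (g $ 1 $ 2))"
proof -
  define P Q where "P = g $ 2 $ 1 + a2 * g $ 1 $ 2" and "Q = g $ 2 $ 2 - g $ 1 $ 1 - a1 * g $ 1 $ 2"
  have lin: "P + Q * (\<beta> + a1) = 0" if \<beta>: "\<beta>\<^sup>2 + a1 * \<beta> + a2 = 0" "\<beta> \<noteq> - a1 - \<beta>" for \<beta>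
  proof -
    have a2: "a2 = - (\<beta>\<^sup>2) - a1 * \<beta>" using \<beta>(1) by (simp add: eq_diff_eq eq_neg_iff_add_eq_0 ac_simps)
    show ?thesis
      using stabilizer_component_eigenvector[OF \<beta> mem]
      by (simp add: P_def Q_def a2 power2_eq_square algebra_simps)
  qed
  have "(- a1 - \<alpha>)\<^sup>2 + a1 * (- a1 - \<alpha>) + a2 = 0" using root by (simp add: power2_eq_square algebra_simps)
  from lin[OF root neq] lin[OF this] neq have 1: "P + Q * (\<alpha> + a1) = 0" and 2: "P + Q * (- \<alpha>) = 0" by auto
  have "Q * (\<alpha> - (- a1 - \<alpha>)) = 0" using 1 2 by (simp add: algebra_simps)
  moreover have "\<alpha> - (- a1 - \<alpha>) \<noteq> 0" using neq by (metis eq_iff_diff_eq_0)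
  ultimately have "Q = 0" by (metis mult_eq_0_iff)
  with 2 have "P = 0" by simp
  have "g $ 2 $ 2 = Q + g $ 1 $ 1 + a1 * g $ 1 $ 2" "g $ 2 $ 1 = P - a2 * g $ 1 $ 2"
    by (simp_all add: P_def Q_def)
  then show ?thesis unfolding mat2_eq_iff \<open>Q = 0\<close> \<open>P = 0\<close> by simp
qed

section \<open>Composites of two ramified quadratic extensions\<close>

text \<open>The norm of \<alpha> is \<open>a2\<close>, so \<open>a2_value\<close> makes \<alpha> a
  uniformizer of \<open>M\<close>, as \<open>l\<close> is one of \<open>L\<close>. The root is a
  parameter so that the locale can be instantiated again at a root of another Eisenstein polynomial
  in \<open>level_eq\<close>.\<close>

locale ramified_pair = discrete_valued av K p R +
  KL: quad_conjugation K L "quad_conj K L" + KM: quad_conjugation K M "quad_conj K M"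
  for av :: "'a::field_char_0 \<Rightarrow> real" and K p R L M +
  fixes l \<alpha> a1 a2 :: 'a
  assumes two: "av 2 < 1"
    and l_in: "l \<in> L" and l_value: "av l ^ 2 = av p"
    and \<alpha>_in: "\<alpha> \<in> M" and \<alpha>_notin: "\<alpha> \<notin> L"
    and a1_in: "a1 \<in> K" and a2_in: "a2 \<in> K" and a2_value: "av a2 = av p"
    and root: "\<alpha> * \<alpha> = - a1 * \<alpha> - a2"
begin

sublocale KL: discrete_quad av K p R L "quad_conj K L"
  by (intro discrete_quad.intro discrete_quad_axioms.intro discrete_valued_axioms
      KL.quad_conjugation_axioms two)

sublocale KM: discrete_quad av K p R M "quad_conj K M"
  by (intro discrete_quad.intro discrete_quad_axioms.intro discrete_valued_axioms
      KM.quad_conjugation_axioms two)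

definition E where "E = {a + b * \<alpha> | a b. a \<in> L \<and> b \<in> L}"

lemma \<alpha>_notin_K: "\<alpha> \<notin> K"
  using \<alpha>_notin KL.base_in by blast

lemma l_notin_K: "l \<notin> K"
  using KL.ramified_gt[OF l_value] less_1_imp_le_p[of l] by auto

lemma l_notin_M: "l \<notin> M"
proof
  assume lM: "l \<in> M"
  have "M = {a + b * l | a b. a \<in> K \<and> b \<in> K}" by (rule KM.ext_eq[OF lM l_notin_K])
  then have "M = L" using KL.ext_eq[OF l_in l_notin_K] by simp
  then show False using \<alpha>_in \<alpha>_notin by simp
qed

lemma conj_\<alpha>: "quad_conj K M \<alpha> = - a1 - \<alpha>"
  by (rule KM.conj_root[OF \<alpha>_in \<alpha>_notin_K _ a2_in root]) (rule F_closed(5)[OF a1_in])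

lemma \<alpha>_value: "av \<alpha> ^ 2 = av p"
proof -
  have "\<alpha> * quad_conj K M \<alpha> = a2" using root by (simp add: conj_\<alpha> algebra_simps)
  then show ?thesis using KM.av_norm[OF \<alpha>_in] a2_value by simp
qed

lemma \<alpha>_value_l: "av \<alpha> = av l"
  using \<alpha>_value l_value by (metis av_nonneg power2_eq_imp_eq)

lemma L_discrete: "discrete_valued av L l R"
  by (rule KL.ramified_ext_discrete[OF l_in l_value])

lemma M_discrete: "discrete_valued av M \<alpha> R"
  by (rule KM.ramified_ext_discrete[OF \<alpha>_in \<alpha>_value])

sublocale LE: discrete_quad av L l R E "quad_conj L E"
proof (intro discrete_quad.intro discrete_quad_axioms.intro L_discrete two)
  show "quad_conjugation L E (quad_conj L E)"
    unfolding E_def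
    by (rule quad_conjugation_adjoin[OF KL.subfield_ext \<alpha>_notin _ _ root])
      (use a1_in a2_in F_closed(5) KL.base_in in auto)
qed

lemma \<alpha>_in_E: "\<alpha> \<in> E"
  unfolding E_def using KL.ext_closed(1,2) by (intro CollectI exI[of _ 0] exI[of _ 1]) simp

text \<open>Expanding in the four products of 1, l with 1, \<alpha> shows \<open>E\<close> as a
  quadratic extension of \<open>M\<close> too, which supplies the second conjugation.\<close>

lemma E_eq: "E = {a + b * l | a b. a \<in> M \<and> b \<in> M}"
proof (intro equalityI subsetI)
  fix x assume "x \<in> E"
  then obtain a b where ab: "a \<in> L" "b \<in> L" "x = a + b * \<alpha>" by (auto simp: E_def)
  from KL.basis_coords[OF ab(1) l_in l_notin_K] obtain a0 a1 where a: "a0 \<in> K" "a1 \<in> K" "a = a0 + a1 * l" by metis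
  from KL.basis_coords[OF ab(2) l_in l_notin_K] obtain b0 b1 where b: "b0 \<in> K" "b1 \<in> K" "b = b0 + b1 * l" by metis
  have "x = (a0 + b0 * \<alpha>) + (a1 + b1 * \<alpha>) * l" using ab a b by (simp add: algebra_simps)
  moreover have "a0 + b0 * \<alpha> \<in> M" "a1 + b1 * \<alpha> \<in> M"
    using a b \<alpha>_in KM.base_in KM.ext_closed(3,4) by simp_all
  ultimately show "x \<in> {a + b * l | a b. a \<in> M \<and> b \<in> M}" by blast
next
  fix x assume "x \<in> {a + b * l | a b. a \<in> M \<and> b \<in> M}"
  then obtain a b where ab: "a \<in> M" "b \<in> M" "x = a + b * l" by auto
  from KM.basis_coords[OF ab(1) \<alpha>_in \<alpha>_notin_K] obtain a0 a1 where a: "a0 \<in> K" "a1 \<in> K" "a = a0 + a1 * \<alpha>" by metis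
  from KM.basis_coords[OF ab(2) \<alpha>_in \<alpha>_notin_K] obtain b0 b1 where b: "b0 \<in> K" "b1 \<in> K" "b = b0 + b1 * \<alpha>" by metis
  have "x = (a0 + b0 * l) + (a1 + b1 * l) * \<alpha>" using ab a b by (simp add: algebra_simps)
  moreover have "a0 + b0 * l \<in> L" "a1 + b1 * l \<in> L"
    using a b l_in KL.base_in KL.ext_closed(3,4) by simp_all
  ultimately show "x \<in> E" unfolding E_def by blast
qed

lemma l_root: "l * l = (l + quad_conj K L l) * l - l * quad_conj K L l"
  by (simp add: algebra_simps)

sublocale ME: discrete_quad av M \<alpha> R E "quad_conj M E"
proof (intro discrete_quad.intro discrete_quad_axioms.intro M_discrete two)
  show "quad_conjugation M E (quad_conj M E)"
    unfolding E_eq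
    by (rule quad_conjugation_adjoin[OF KM.subfield_ext l_notin_M _ _ l_root])
      (use KL.trace_in[OF l_in] KL.norm_in[OF l_in] KM.base_in in auto)
qed

lemma LE_conj_\<alpha>: "quad_conj L E \<alpha> = - a1 - \<alpha>"
  by (rule LE.conj_root[OF \<alpha>_in_E \<alpha>_notin _ _ root])
    (use a1_in a2_in F_closed(5) KL.base_in in auto)

lemma ME_conj_l: "quad_conj M E l = quad_conj K L l"
proof -
  have "quad_conj M E l = (l + quad_conj K L l) - l"
    by (rule ME.conj_root[OF _ l_notin_M _ _ l_root])
      (use KL.trace_in[OF l_in] KL.norm_in[OF l_in] KM.base_in LE.base_in l_in in auto)
  then show ?thesis by simp
qed

lemma ME_conj_L: "a \<in> L \<Longrightarrow> quad_conj M E a = quad_conj K L a"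
proof -
  assume "a \<in> L"
  from KL.basis_coords[OF this l_in l_notin_K] obtain c d where cd: "c \<in> K" "d \<in> K" "a = c + d * l" by metis
  have "quad_conj M E a = c + d * quad_conj M E l"
    using cd l_in KM.base_in ME.base_in LE.base_in LE.ext_closed(4) by (simp add: ME.conj_add ME.conj_mult ME.conj_base)
  moreover have "quad_conj K L a = c + d * quad_conj K L l"
    using cd l_in KL.base_in KL.ext_closed(4) by (simp add: KL.conj_add KL.conj_mult KL.conj_base)
  ultimately show ?thesis by (simp add: ME_conj_l)
qed

lemma LE_conj_K: "c \<in> K \<Longrightarrow> quad_conj L E c = c"
  by (rule LE.conj_base) (rule KL.base_in)

text \<open>The involution of E / K that restricts to the nontrivial conjugation on both
  \<open>L\<close> and \<open>M\<close> (\<open>\<rho>_L\<close>,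
  \<open>\<rho>_\<alpha>\<close>).\<close>

definition \<rho> where "\<rho> x = quad_conj M E (quad_conj L E x)"

lemma \<rho>_in: "x \<in> E \<Longrightarrow> \<rho> x \<in> E"
  and \<rho>_add: "x \<in> E \<Longrightarrow> y \<in> E \<Longrightarrow> \<rho> (x + y) = \<rho> x + \<rho> y"
  and \<rho>_mult: "x \<in> E \<Longrightarrow> y \<in> E \<Longrightarrow> \<rho> (x * y) = \<rho> x * \<rho> y"
  and \<rho>_av: "x \<in> E \<Longrightarrow> av (\<rho> x) = av x"
  by (simp_all add: \<rho>_def LE.conj_in ME.conj_in LE.conj_add ME.conj_add LE.conj_mult ME.conj_mult
      LE.conj_isometry ME.conj_isometry)

lemma \<rho>_K: "c \<in> K \<Longrightarrow> \<rho> c = c"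
  using KM.base_in by (simp add: \<rho>_def LE_conj_K ME.conj_base)

lemma \<rho>_L: "a \<in> L \<Longrightarrow> \<rho> a = quad_conj K L a"
  by (simp add: \<rho>_def LE.conj_base ME_conj_L)

lemma \<rho>_\<alpha>: "\<rho> \<alpha> = - a1 - \<alpha>"
  unfolding \<rho>_def LE_conj_\<alpha>
  by (rule ME.conj_base) (use a1_in \<alpha>_in KM.base_in KM.ext_closed(5,6) in auto)

lemma \<rho>_\<rho>: 
  assumes "x \<in> E" shows "\<rho> (\<rho> x) = x"
proof -
  from assms obtain a b where ab: "a \<in> L" "b \<in> L" "x = a + b * \<alpha>" by (auto simp: E_def)
  have L: "\<rho> a \<in> E" "\<rho> (\<rho> a) = a" if "a \<in> L" for a
    using that \<rho>_L KL.conj_in[OF that] KL.conj_conj[OF that] LE.base_in by auto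
  have "\<rho> (- a1 - \<alpha>) = \<rho> (- a1 + (- 1) * \<alpha>)" by simp
  also have "\<dots> = \<rho> (- a1) + \<rho> (- 1) * \<rho> \<alpha>"
  proof -
    have E: "- a1 \<in> E" "- 1 \<in> E" using a1_in KL.base_in LE.base_in F_closed(2,5) by auto
    show ?thesis by (simp only: \<rho>_add[OF E(1) LE.ext_closed(4)[OF E(2) \<alpha>_in_E]] \<rho>_mult[OF E(2) \<alpha>_in_E])
  qed
  also have "\<dots> = \<alpha>" using a1_in F_closed(2,5) by (simp add: \<rho>_K \<rho>_\<alpha>)
  finally have \<alpha>: "\<rho> (\<rho> \<alpha>) = \<alpha>" by (simp add: \<rho>_\<alpha>)
  have "\<rho> x = \<rho> a + \<rho> b * \<rho> \<alpha>"
    using ab \<alpha>_in_E LE.base_in LE.ext_closed(4) by (simp add: \<rho>_add \<rho>_mult)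
  then have "\<rho> (\<rho> x) = \<rho> (\<rho> a) + \<rho> (\<rho> b) * \<rho> (\<rho> \<alpha>)"
    using L ab(1,2) \<rho>_in[OF \<alpha>_in_E] LE.ext_closed(4) by (simp add: \<rho>_add \<rho>_mult)
  then show ?thesis using L ab \<alpha> by simp
qed

text \<open>If \<open>E / L\<close> is unramified, both conjugations act on the residue field of \<open>E\<close> by its nontrivial
  automorphism, so \<open>\<rho>\<close> acts trivially. Hence the third quadratic subfield, fixed by \<open>\<rho>\<close>,
  contains a generator of the residue field.\<close>

lemma unramified_subfield_generator:
  assumes \<xi>: "\<xi> \<in> E" "av \<xi> = 1" "\<And>a. a \<in> L \<Longrightarrow> 1 \<le> av (\<xi> - a)"
  obtains \<zeta> where "\<zeta> \<in> E" "av \<zeta> = 1" "\<rho> \<zeta> = \<zeta>" "\<And>a. a \<in> M \<Longrightarrow> 1 \<le> av (\<zeta> - a)"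
proof -
  let ?\<tau> = "quad_conj L E" and ?\<sigma> = "quad_conj M E"
  \<comment> \<open>Every residue of \<open>M\<close> is represented in \<open>K\<close>, hence in
    \<open>L\<close>, so \<xi> is not congruent to an element of \<open>M\<close> either.\<close>
  have \<xi>M: "1 \<le> av (\<xi> - a)" if a: "a \<in> M" for a
  proof (rule ccontr)
    assume "\<not> 1 \<le> av (\<xi> - a)"
    then have lt: "av (\<xi> - a) < 1" by simp
    then have "av a \<le> 1" using av_diff_le[of \<xi> 1 "\<xi> - a"] \<xi>(2) by simp
    then obtain r where r: "r \<in> R" "av (a - r) < 1" using ME.reps_ex[OF a] by blast
    have "av (\<xi> - r) < 1" using av_add_less[OF lt r(2)] by simp
    then show False using \<xi>(3)[of r] KL.base_in reps_in r by fastforce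
  qed
  have \<sigma>\<xi>: "av (\<xi> - ?\<sigma> \<xi>) = 1" by (rule ME.unramified_conj_diff[OF \<xi>(1,2) \<xi>M])
  have in_E: "?\<tau> \<xi> \<in> E" "?\<sigma> \<xi> \<in> E" using \<xi> LE.conj_in ME.conj_in by auto
  have av1: "av (?\<tau> \<xi>) = 1" "av (?\<sigma> \<xi>) = 1" using \<xi> LE.conj_isometry ME.conj_isometry by auto
  define T N where "T = \<xi> + ?\<tau> \<xi>" and "N = \<xi> * ?\<tau> \<xi>"
  have TL: "T \<in> L" "av T \<le> 1" and NL: "N \<in> L" "av N \<le> 1"
    using LE.trace_in LE.norm_in \<xi> av1 by (auto simp: T_def N_def av_mult intro: av_add_le)
  obtain r where r: "r \<in> R" "av (T - r) < 1" using LE.reps_ex[OF TL] by blast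
  obtain r' where r': "r' \<in> R" "av (N - r') < 1" using LE.reps_ex[OF NL] by blast
  \<comment> \<open>A model of the polynomial of \<xi> over \<open>L\<close> with coefficients in
    \<open>K\<close>, which both conjugations fix. Modulo the maximal ideal its roots are \<xi> and
    its conjugate over \<open>L\<close>. The conjugate over \<open>M\<close> is a root not congruent
    to \<xi>, so the two conjugates are congruent.\<close>
  define f where "f = (\<lambda>z. z * z - r * z + r')"
  have rM: "r \<in> M" "r' \<in> M" using reps_in r r' KM.base_in by auto
  have small: "av ((T - r) * z - (N - r')) < 1" if "av z = 1" for z
    using that av_mult_less_1[OF r(2), of z] by (intro av_diff_less r') auto
  have "f \<xi> = (T - r) * \<xi> - (N - r')" by (simp add: f_def T_def N_def algebra_simps)
  then have "av (f \<xi>) < 1" using small[OF \<xi>(2)] by simp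
  moreover have "?\<sigma> (f \<xi>) = f (?\<sigma> \<xi>)"
    using \<xi>(1) rM ME.base_in LE.ext_closed(3,4,6)
    by (simp add: f_def ME.conj_add ME.conj_diff ME.conj_mult ME.conj_base)
  moreover have "f \<xi> \<in> E" using \<xi>(1) rM ME.base_in LE.ext_closed(3,4,6) by (simp add: f_def)
  ultimately have "av (f (?\<sigma> \<xi>)) < 1" using ME.conj_isometry by metis
  moreover have "(?\<sigma> \<xi> - \<xi>) * (?\<sigma> \<xi> - ?\<tau> \<xi>) = f (?\<sigma> \<xi>) - ((T - r) * ?\<sigma> \<xi> - (N - r'))"
    by (simp add: f_def T_def N_def algebra_simps)
  ultimately have "av ((?\<sigma> \<xi> - \<xi>) * (?\<sigma> \<xi> - ?\<tau> \<xi>)) < 1"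
    using small[OF av1(2)] av_diff_less by simp
  then have lt: "av (?\<sigma> \<xi> - ?\<tau> \<xi>) < 1"
    using \<sigma>\<xi> av_diff_commute[of \<xi> "?\<sigma> \<xi>"] by (simp add: av_mult)
  have "?\<sigma> (?\<sigma> \<xi> - ?\<tau> \<xi>) = \<xi> - \<rho> \<xi>"
    using \<xi>(1) in_E by (simp add: ME.conj_diff ME.conj_conj \<rho>_def)
  then have \<rho>\<xi>: "av (\<xi> - \<rho> \<xi>) < 1"
    using lt ME.conj_isometry[of "?\<sigma> \<xi> - ?\<tau> \<xi>"] in_E LE.ext_closed(6) by simp
  \<comment> \<open>The product is fixed by \<rho> and congruent to \<xi>^2. It still generates the
    residue extension: if it were congruent to an element of \<open>M\<close>, a square root of the
    residue of that element would be congruent to \<xi>.\<close>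
  define \<zeta> where "\<zeta> = \<xi> * \<rho> \<xi>"
  have \<zeta>E: "\<zeta> \<in> E" using \<xi>(1) \<rho>_in LE.ext_closed(4) by (simp add: \<zeta>_def)
  moreover have \<zeta>1: "av \<zeta> = 1" using \<xi>(1,2) by (simp add: \<zeta>_def av_mult \<rho>_av)
  moreover have "\<rho> \<zeta> = \<zeta>" using \<xi>(1) \<rho>_in by (simp add: \<zeta>_def \<rho>_mult \<rho>_\<rho>)
  moreover have "1 \<le> av (\<zeta> - a)" if a: "a \<in> M" for a
  proof (rule ccontr)
    assume "\<not> 1 \<le> av (\<zeta> - a)"
    then have lt: "av (\<zeta> - a) < 1" by simp
    then have "av a \<le> 1" using av_diff_le[of \<zeta> 1 "\<zeta> - a"] \<zeta>1 by simp
    from ME.square_residue[OF two a this] obtain c where c: "c \<in> M" "av c \<le> 1" "av (a - c ^ 2) < 1" .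
    have 1: "av ((\<xi> - \<rho> \<xi>) * \<xi>) < 1" using av_mult_less_1[OF \<rho>\<xi>, of \<xi>] \<xi>(2) by simp
    have 2: "av (2 * (c * (c - \<xi>))) < 1"
      using c \<xi>(2) by (intro av_mult_less_1[OF two] av_mult_le_1 av_diff_le) auto
    have "(\<xi> - c) ^ 2 = (((\<xi> - \<rho> \<xi>) * \<xi> + (\<zeta> - a)) + (a - c ^ 2)) + 2 * (c * (c - \<xi>))"
      by (simp add: \<zeta>_def power2_eq_square algebra_simps)
    then have "av ((\<xi> - c) ^ 2) < 1"
      using av_add_less[OF av_add_less[OF av_add_less[OF 1 lt] c(3)] 2] by simp
    then have "av (\<xi> - c) < 1"
      unfolding av_power using one_le_power[of "av (\<xi> - c)" 2] by linarith
    with \<xi>M[OF c(1)] show False by simp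
  qed
  ultimately show ?thesis by (rule that)
qed

text \<open>Both \<open>l\<close> and \<open>\<alpha>\<close> are uniformizers of \<open>E\<close>, which is totally ramified over the fixed field of
  \<open>\<rho>\<close>, and \<open>\<bar>\<rho> x - x\<bar>\<close> is the same for all uniformizers \<open>x\<close>.\<close>

lemma unramified_conj_diff_eq:
  assumes \<xi>: "\<xi> \<in> E" "av \<xi> = 1" "\<And>a. a \<in> L \<Longrightarrow> 1 \<le> av (\<xi> - a)"
  shows "av (l - quad_conj K L l) = av (\<alpha> - (- a1 - \<alpha>))"
proof -
  obtain \<zeta> where \<zeta>: "\<zeta> \<in> E" "av \<zeta> = 1" "\<rho> \<zeta> = \<zeta>" "\<And>a. a \<in> M \<Longrightarrow> 1 \<le> av (\<zeta> - a)"
    using unramified_subfield_generator[OF \<xi>] by blast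
  interpret M\<zeta>: integral_basis av M \<alpha> R E "quad_conj M E" \<zeta>
    by (rule ME.unramified_integral_basis[OF \<zeta>(1,2,4)])
  interpret K\<alpha>: integral_basis av K p R M "quad_conj K M" \<alpha>
    by (rule KM.ramified_integral_basis[OF \<alpha>_in \<alpha>_value])
  have ME: "x \<in> E" if "x \<in> M" for x using that by (rule ME.base_in)
  define D where "D = av (\<rho> \<alpha> - \<alpha>)"
  have "\<rho> \<alpha> \<noteq> \<alpha>"
    unfolding \<rho>_\<alpha> LE_conj_\<alpha>[symmetric] using LE.conj_fix_iff[OF \<alpha>_in_E] \<alpha>_notin by blast
  then have D: "0 < D" by (simp add: D_def)
  have M_le: "av (\<rho> x - x) \<le> D" if x: "x \<in> M" "av x \<le> 1" for x
  proof -
    from KM.basis_coords[OF x(1) \<alpha>_in \<alpha>_notin_K] obtain c d where cd: "c \<in> K" "d \<in> K" "x = c + d * \<alpha>" by metis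
    have "av d \<le> 1" using K\<alpha>.coords_integral[OF cd(1,2)] cd(3) x(2) by simp
    have "\<rho> x = c + d * \<rho> \<alpha>"
      using cd ME KM.base_in \<alpha>_in_E LE.ext_closed(4) by (simp add: \<rho>_add \<rho>_mult \<rho>_K)
    then have "\<rho> x - x = (\<rho> \<alpha> - \<alpha>) * d" using cd by (simp add: algebra_simps)
    then show ?thesis unfolding D_def using av_mult_le_1[OF order_refl \<open>av d \<le> 1\<close>] by simp
  qed
  \<comment> \<open>Write l = u \<alpha> with a unit u. The coordinates of u with respect to 1 and
    \<zeta> lie in \<open>M\<close>, so u changes under \<rho> by at most \<open>D\<close>. In the
    product rule for \<rho> l - l the change of u is multiplied by \<alpha> and is therefore
    dominated by the change of \<alpha>.\<close>
  define u where "u = l / \<alpha>"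
  have \<alpha>0: "\<alpha> \<noteq> 0" using \<alpha>_notin KL.ext_closed(1) by auto
  have lE: "l \<in> E" using l_in LE.base_in by blast
  have uE: "u \<in> E" using lE \<alpha>_in_E LE.ext_closed(8) by (simp add: u_def)
  have u1: "av u = 1" using \<alpha>0 by (simp add: u_def av_divide \<alpha>_value_l[symmetric])
  from ME.basis_coords[OF uE \<zeta>(1) M\<zeta>.t_notin] obtain x y where xy: "x \<in> M" "y \<in> M" "u = x + y * \<zeta>" by metis
  have le: "av x \<le> 1" "av y \<le> 1" using M\<zeta>.coords_integral[OF xy(1,2)] xy(3) u1 by auto
  have "\<rho> u = \<rho> x + \<rho> y * \<zeta>"
    using xy ME \<zeta>(1,3) LE.ext_closed(4) by (simp add: \<rho>_add \<rho>_mult)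
  then have "\<rho> u - u = (\<rho> x - x) + (\<rho> y - y) * \<zeta>" using xy by (simp add: algebra_simps)
  then have du: "av (\<rho> u - u) \<le> D"
    using M_le[OF xy(1) le(1)] av_mult_le_1[OF M_le[OF xy(2) le(2)], of \<zeta>] \<zeta>(2) av_add_le by simp
  have l: "l = u * \<alpha>" using \<alpha>0 by (simp add: u_def)
  then have "\<rho> l = \<rho> u * \<rho> \<alpha>" using uE \<alpha>_in_E \<rho>_mult by simp
  then have eq: "\<rho> l - l = (\<rho> u - u) * \<alpha> + \<rho> u * (\<rho> \<alpha> - \<alpha>)" using l by (simp add: algebra_simps)
  have "av ((\<rho> u - u) * \<alpha>) \<le> D * av \<alpha>" using du by (simp add: av_mult mult_right_mono)
  also have "\<dots> < D * 1" using D ME.p_less_1 by (intro mult_strict_left_mono) auto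
  also have "\<dots> = av (\<rho> u * (\<rho> \<alpha> - \<alpha>))" using uE u1 by (simp add: D_def av_mult \<rho>_av)
  finally have "av (\<rho> l - l) = av (\<rho> u * (\<rho> \<alpha> - \<alpha>))" unfolding eq by (rule av_add_eq_right)
  also have "\<dots> = D" using uE u1 by (simp add: D_def av_mult \<rho>_av)
  finally show ?thesis
    unfolding D_def \<rho>_\<alpha> \<rho>_L[OF l_in] by (metis av_diff_commute)
qed

text \<open>The order \<open>\<O>\<^sub>L[\<alpha>]\<close> in the integers \<open>\<O>\<^sub>L[t]\<close> of \<open>E\<close>: its conductor exponent is the
  valuation of the coordinate of \<open>\<alpha>\<close> at \<open>t\<close>.\<close>

lemma conductor:
  assumes "integral_basis av L l R E (quad_conj L E) t"
  obtains a b j where "a \<in> L" "b \<in> L" "\<alpha> = a + b * t" "av a \<le> 1" "av b = av l ^ j" "0 < j"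
    "{c + d * \<alpha> | c d. c \<in> L \<and> d \<in> L \<and> av c \<le> 1 \<and> av d \<le> 1 \<and> av (c + d * \<alpha>) = 1} =
      integral_basis.order_units av L l t j"
proof -
  interpret B: integral_basis av L l R E "quad_conj L E" t by (rule assms)
  from LE.basis_coords[OF \<alpha>_in_E B.t_in B.t_notin] obtain a b where
    ab: "a \<in> L" "b \<in> L" "\<alpha> = a + b * t" by metis
  have b0: "b \<noteq> 0" using ab \<alpha>_notin by auto
  have \<alpha>1: "av \<alpha> \<le> 1" using ME.p_less_1 by simp
  have le: "av a \<le> 1" "av b \<le> 1" using B.coords_integral[OF ab(1,2)] ab(3) \<alpha>1 by auto
  \<comment> \<open>From |b t| <= |\<alpha>| = |l| < |t| it follows that \<open>b\<close> is a
    non-unit. The exponent is thus positive, as the openness and the count of cosets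
    require.\<close>
  have "av b * av t \<le> av l" using B.coord_norm[OF ab(1,2)] ab(3) \<alpha>_value_l by simp
  then have "av b * av t < 1 * av t" using B.t_gt by simp
  then have b1: "av b < 1" using B.t_pos by (simp only: mult_less_cancel_right_pos)
  from LE.value_group[OF ab(2) b0] obtain n where n: "av b = av l powi n" ..
  have "0 < n" using b1 n LE.p_powi_less_iff[of n 0] by simp
  define j where "j = nat n"
  have j: "0 < j" "av b = av l ^ j" using \<open>0 < n\<close> n by (auto simp: j_def power_int_def)
  have "{c + d * \<alpha> | c d. c \<in> L \<and> d \<in> L \<and> av c \<le> 1 \<and> av d \<le> 1 \<and> av (c + d * \<alpha>) = 1} = B.order_units j"
  proof (intro equalityI subsetI)
    fix x assume "x \<in> {c + d * \<alpha> | c d. c \<in> L \<and> d \<in> L \<and> av c \<le> 1 \<and> av d \<le> 1 \<and> av (c + d * \<alpha>) = 1}"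
    then obtain c d where cd: "c \<in> L" "d \<in> L" "av d \<le> 1" "av x = 1" "x = c + d * \<alpha>" by auto
    show "x \<in> B.order_units j"
    proof (rule B.order_unitsI)
      show "x = (c + d * a) + (b * d) * t" using cd(5) ab(3) by (simp add: algebra_simps)
      show "av (b * d) \<le> av l ^ j" using j cd by (intro av_mult_le_1) auto
    qed (use cd ab KL.ext_closed(3,4) in auto)
  next
    fix x assume "x \<in> B.order_units j"
    then obtain u v where uv: "u \<in> L" "v \<in> L" "av v \<le> av l ^ j" "x = u + v * t" "av x = 1"
      by (auto simp: B.order_units_def)
    define d where "d = v / b"
    have d: "d \<in> L" "av d \<le> 1" using uv ab KL.ext_closed(8) j b0
      by (auto simp: d_def av_divide divide_le_eq_1)
    have "av u \<le> 1" using B.coords_integral[OF uv(1,2)] uv by simp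
    then have "av (u - a * d) \<le> 1" using le d by (intro av_diff_le av_mult_le_1)
    moreover have "u - a * d \<in> L" using uv ab d KL.ext_closed(4,6) by simp
    moreover have "x = (u - a * d) + d * \<alpha>" using uv b0 by (simp add: ab(3) d_def algebra_simps)
    ultimately show "x \<in> {c + d * \<alpha> | c d. c \<in> L \<and> d \<in> L \<and> av c \<le> 1 \<and> av d \<le> 1 \<and> av (c + d * \<alpha>) = 1}"
      using d uv(5) by blast
  qed
  with ab le(1) j that show ?thesis by blast
qed

lemma l_power: "av l ^ (2 * i) = av p ^ i"
  by (simp add: power_mult l_value)

lemma conductor_unramified:
  assumes \<xi>: "\<xi> \<in> E" "av \<xi> = 1" "\<And>a. a \<in> L \<Longrightarrow> 1 \<le> av (\<xi> - a)"
    and ab: "a \<in> L" "b \<in> L" "\<alpha> = a + b * \<xi>" "av b = av l ^ j"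
    and disc: "discriminant av K L = max_ideal_pow av K \<delta>"
  shows "j = \<delta>"
proof -
  interpret Kl: integral_basis av K p R L "quad_conj K L" l
    by (rule KL.ramified_integral_basis[OF l_in l_value])
  let ?d = "(l - quad_conj K L l) ^ 2"
  have dK: "?d \<in> K"
  proof -
    have "?d = (l + quad_conj K L l) ^ 2 - 4 * (l * quad_conj K L l)"
      by (simp add: power2_eq_square algebra_simps)
    then show ?thesis using KL.trace_in[OF l_in] KL.norm_in[OF l_in] F_closed by simp
  qed
  have eq: "{x\<in>K. av x \<le> av (l - quad_conj K L l) ^ 2} = {x\<in>K. av x \<le> av p ^ \<delta>}"
    using disc Kl.discriminant_eq max_ideal_pow_eq by simp
  \<comment> \<open>Both radii are values of elements of \<open>K\<close>, so equal balls have equal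
    radii.\<close>
  have "?d \<in> {x\<in>K. av x \<le> av p ^ \<delta>}" unfolding eq[symmetric] using dK by (simp add: av_power)
  moreover have "p ^ \<delta> \<in> {x\<in>K. av x \<le> av (l - quad_conj K L l) ^ 2}"
    unfolding eq using F_closed(9)[OF p_in] by (simp add: av_power)
  ultimately have d: "av (l - quad_conj K L l) ^ 2 = av p ^ \<delta>" by (simp add: av_power)
  have "quad_conj L E (a + b * \<xi>) = a + b * quad_conj L E \<xi>"
    using ab(1,2) \<xi>(1) LE.base_in LE.ext_closed(4) by (simp add: LE.conj_add LE.conj_mult LE.conj_base)
  then have "quad_conj L E \<alpha> = a + b * quad_conj L E \<xi>" unfolding ab(3)[symmetric] .
  then have "\<alpha> - (- a1 - \<alpha>) = b * (\<xi> - quad_conj L E \<xi>)"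
    unfolding LE_conj_\<alpha> using ab(3) by (simp add: algebra_simps)
  then have "av (\<alpha> - (- a1 - \<alpha>)) = av l ^ j"
    using LE.unramified_conj_diff[OF \<xi>] ab(4) by (simp add: av_mult)
  \<comment> \<open>The squared difference has value |p|^\<delta> = |l|^(2 \<delta>), so the
    discriminant exponent over \<open>K\<close> is the exponent of the difference itself over
    \<open>L\<close>.\<close>
  then have "(av l ^ j) ^ 2 = av l ^ (2 * \<delta>)"
    using unramified_conj_diff_eq[OF \<xi>] d l_power by simp
  then have "av l powi int (2 * j) = av l powi int (2 * \<delta>)"
    by (simp only: power_int_of_nat power_mult[symmetric] mult.commute[of j 2])
  then show ?thesis using LE.p_powi_eq_iff by simp
qed

text \<open>For \<open>\<eta>\<close> in \<open>L\<close> the polynomial of \<open>\<alpha>\<close> at \<open>\<theta> = - \<eta>\<close> has absolute value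
  \<open>\<bar>\<theta> - \<alpha>\<bar>\<^sup>2\<close>, and modulo the characteristic polynomial of \<open>\<eta>\<close> it is a linear polynomial in \<open>\<eta>\<close> whose
  coefficients measure how far trace and norm of \<open>\<eta>\<close> are from \<open>a1\<close> and \<open>a2\<close>.\<close>

lemma level_poly_eq:
  assumes t: "t \<in> E" "av t ^ 2 = av l" and ab: "a \<in> L" "b \<in> L" "\<alpha> = a + b * t" "av b = av l ^ j" and j: "0 < j"
  shows "level_poly av K L a1 a2 = j"
proof -
  interpret B: integral_basis av L l R E "quad_conj L E" t by (rule LE.ramified_integral_basis[OF t])
  let ?\<sigma> = "quad_conj K L"
  have t1: "av t < 1" by (rule LE.ramified_gt(2)[OF t(2)])
  have dist_sq: "av ((quad_trace K L \<eta> - a1) * \<eta> - (quad_norm K L \<eta> - a2)) = av (\<alpha> + \<eta>) ^ 2"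
    if "\<eta> \<in> L" for \<eta>
  proof -
    have E: "\<alpha> + \<eta> \<in> E" using \<alpha>_in_E LE.base_in[OF that] LE.ext_closed(3) by simp
    have cj: "quad_conj L E (\<alpha> + \<eta>) = - a1 - \<alpha> + \<eta>"
      using \<alpha>_in_E LE.base_in[OF that] that by (simp add: LE.conj_add LE_conj_\<alpha> LE.conj_base)
    have "(\<alpha> + \<eta>) * quad_conj L E (\<alpha> + \<eta>) = - (\<alpha> * \<alpha> + a1 * \<alpha>) - a1 * \<eta> + \<eta> * \<eta>"
      unfolding cj by (simp add: algebra_simps)
    also have "\<dots> = a2 - a1 * \<eta> + \<eta> * \<eta>" unfolding root by simp
    also have "\<dots> = (quad_trace K L \<eta> - a1) * \<eta> - (quad_norm K L \<eta> - a2)"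
      by (simp add: quad_trace_def quad_norm_def algebra_simps)
    finally show ?thesis using LE.av_norm[OF E] by simp
  qed
  have in_K: "quad_trace K L \<eta> - a1 \<in> K" "quad_norm K L \<eta> - a2 \<in> K" if "\<eta> \<in> L" for \<eta>
    using that KL.trace_in KL.norm_in a1_in a2_in F_closed(6) by (auto simp: quad_trace_def quad_norm_def)
  have bt: "(av b * av t) ^ 2 = av l ^ (2 * j + 1)"
    using ab(4) t(2) by (simp add: power_mult_distrib power_mult power_add mult.commute flip: power_mult)
  define P where "P i \<longleftrightarrow> (\<exists>\<eta>\<in>carrier (int_ring av L).
        quad_trace K L \<eta> - a1 \<in> max_ideal_pow av K i \<and>
        quad_norm K L \<eta> - a2 \<in> max_ideal_pow av K i)" for i
  have le: "i \<le> j" if "P i" for i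
  proof -
    from that obtain \<eta> where \<eta>: "\<eta> \<in> L" "av \<eta> \<le> 1" "av (quad_trace K L \<eta> - a1) \<le> av p ^ i"
      "av (quad_norm K L \<eta> - a2) \<le> av p ^ i"
      by (auto simp: P_def max_ideal_pow_eq)
    have "av b * av t \<le> av (\<alpha> + \<eta>)"
      using B.distance[OF ab(1,2), of "- \<eta>"] \<eta>(1) KL.ext_closed(5) ab(3) by simp
    then have "(av b * av t) ^ 2 \<le> av (\<alpha> + \<eta>) ^ 2" by (intro power_mono) auto
    also have "\<dots> \<le> av p ^ i"
      unfolding dist_sq[OF \<eta>(1), symmetric]
      by (rule av_diff_le[OF av_mult_le_1[OF \<eta>(3,2)] \<eta>(4)])
    \<comment> \<open>Over \<open>L\<close> the smallest squared distance has the odd exponent 2 j +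
      1 and |p|^i the even exponent 2 i, so the comparison yields i <= j.\<close>
    finally have "av l powi int (2 * j + 1) \<le> av l powi int (2 * i)"
      unfolding bt l_power[symmetric] power_int_of_nat .
    then show ?thesis using LE.p_powi_le_iff[of "int (2 * j + 1)" "int (2 * i)"] by simp
  qed
  have "P j"
    unfolding P_def max_ideal_pow_eq
  \<comment> \<open>At \<eta> = - a the distance |\<alpha> + \<eta>| takes its least value |b
    t|.\<close>
  proof (intro bexI[of _ "- a"] conjI)
    have aL: "- a \<in> L" using ab KL.ext_closed(5) by simp
    have "av b \<le> av l" using ab(4) j LE.p_less_1 LE.p_pos power_decreasing[of 1 j "av l"] by simp
    then have "av b * av t \<le> av l * av t" by (intro mult_right_mono) auto
    also have "\<dots> < av l * 1" using t1 LE.p_pos by (intro mult_strict_left_mono)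
    finally have "av b * av t < av l * 1" .
    moreover have "av l = max (av a) (av b * av t)"
      using B.coord_norm[OF ab(1,2)] ab(3) \<alpha>_value_l by simp
    ultimately have a_l: "av a = av l" by (simp add: max_def split: if_splits)
    show "- a \<in> carrier (int_ring av L)" using aL a_l LE.p_less_1 by simp
    define r s where "r = quad_trace K L (- a) - a1" and "s = quad_norm K L (- a) - a2"
    have rs: "r \<in> K" "s \<in> K" using in_K[OF aL] by (auto simp: r_def s_def)
    have a_value: "av (- a) ^ 2 = av p" using a_l l_value by simp
    \<comment> \<open>Since |a| = |l|, the element - a is a uniformizer of \<open>L\<close>, and
      \<open>s\<close> and \<open>r * (- a)\<close> cannot cancel. The value of their combination
      therefore bounds each of them.\<close>
    have "max (av (- s)) (av r * av (- a)) = av (- s + r * (- a))"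
      by (rule KL.ramified_coord_norm[OF a_value, symmetric]) (use rs F_closed(5) in auto)
    also have "\<dots> = av (r * (- a) - s)" by (simp only: diff_conv_add_uminus add.commute)
    also have "\<dots> = av (\<alpha> + (- a)) ^ 2" unfolding r_def s_def by (rule dist_sq[OF aL])
    also have "\<dots> = av l ^ (2 * j + 1)" using ab(3) bt by (simp add: av_mult)
    finally have max: "max (av s) (av r * av l) = av l ^ (2 * j) * av l" using a_l by (simp add: mult.commute)
    then have "av r * av l \<le> av l ^ (2 * j) * av l" by simp
    then have "av r \<le> av p ^ j" using LE.p_pos unfolding l_power by (simp only: mult_le_cancel_right_pos)
    then show "quad_trace K L (- a) - a1 \<in> {x\<in>K. av x \<le> av p ^ j}" using rs by (simp add: r_def)
    have "av s \<le> av l ^ (2 * j) * av l" using max by simp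
    also have "\<dots> \<le> av l ^ (2 * j) * 1" using LE.p_less_1 by (intro mult_left_mono) auto
    finally show "quad_norm K L (- a) - a2 \<in> {x\<in>K. av x \<le> av p ^ j}" using rs by (simp add: s_def l_power)
  qed
  have "level_poly av K L a1 a2 = (GREATEST i. P i)" unfolding level_poly_def P_def ..
  also have "\<dots> = j" using \<open>P j\<close> le by (rule Greatest_equality)
  finally show ?thesis .
qed

end

section \<open>The volume\<close>

lemma GL2_I:
  assumes "\<And>i j. A $ i $ j \<in> S" "\<And>i j. B $ i $ j \<in> S" "A ** B = mat 1" "B ** A = mat 1"
  shows "A \<in> GL2 S"
  unfolding GL2_def using assms by (intro CollectI conjI allI exI[of _ B])

context ramified_pair
begin

lemma a1_le: "av a1 \<le> 1"
proof -
  have "- a1 = \<alpha> + quad_conj K M \<alpha>" by (simp add: conj_\<alpha>)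
  moreover have "av (\<alpha> + quad_conj K M \<alpha>) \<le> 1"
    using ME.p_less_1 KM.conj_isometry[OF \<alpha>_in] by (intro av_add_le) auto
  ultimately show ?thesis by (metis av_minus)
qed

lemma a2_le: "av a2 \<le> 1"
  using a2_value p_less_1 by simp

lemma \<alpha>_neq: "\<alpha> \<noteq> - a1 - \<alpha>"
  using KM.conj_fix_iff[OF \<alpha>_in] \<alpha>_notin_K conj_\<alpha> by metis

lemma root_eq_0: "\<alpha>\<^sup>2 + a1 * \<alpha> + a2 = 0"
  by (simp add: power2_eq_square root)

text \<open>The determinant is the norm of c + d \<alpha> from \<open>E\<close> to
  \<open>L\<close>.\<close>

lemma av_torus_det:
  assumes "c \<in> L" "d \<in> L" shows "av (torus_det a1 a2 c d) = av (c + d * \<alpha>) ^ 2"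
proof -
  have E: "c + d * \<alpha> \<in> E" using assms by (auto simp: E_def)
  have cj: "quad_conj L E (c + d * \<alpha>) = c + d * (- a1 - \<alpha>)"
    using assms \<alpha>_in_E LE.base_in LE.ext_closed(4) by (simp add: LE.conj_add LE.conj_mult LE.conj_base LE_conj_\<alpha>)
  have "(c + d * \<alpha>) * (c + d * (- a1 - \<alpha>)) = c\<^sup>2 - a1 * c * d + d\<^sup>2 * (- a1 * \<alpha> - \<alpha> * \<alpha>)"
    by (simp add: power2_eq_square algebra_simps)
  also have "\<dots> = torus_det a1 a2 c d" unfolding root by (simp add: torus_det_def algebra_simps)
  finally show ?thesis using LE.av_norm[OF E] unfolding cj by simp
qed

lemma torus_det_in: "subfield F \<Omega> \<Longrightarrow> a1 \<in> F \<Longrightarrow> a2 \<in> F \<Longrightarrow> c \<in> F \<Longrightarrow> d \<in> F \<Longrightarrow> torus_det a1 a2 c d \<in> F"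
  unfolding torus_det_def by (simp add: subfield_closed)

lemma torus_mat_entries:
  assumes "subfield F \<Omega>" "a1 \<in> F" "a2 \<in> F" "c \<in> F" "d \<in> F" "av c \<le> 1" "av d \<le> 1"
  shows "torus_mat a1 a2 c d $ i $ j \<in> {x\<in>F. av x \<le> 1}"
proof -
  have "av (a2 * d) \<le> 1" "av (c - a1 * d) \<le> 1"
    using a1_le a2_le assms by (auto intro!: av_mult_le_1 av_diff_le)
  moreover have "a2 * d \<in> F" "c - a1 * d \<in> F" "- d \<in> F" using assms by (simp_all add: subfield_closed)
  moreover have "i = 1 \<or> i = 2" "j = 1 \<or> j = 2" using exhaust_2 by blast+
  ultimately show ?thesis using assms by auto
qed

text \<open>This identifies the intersection with the units of O_L[\<alpha>]. An invertible integral
  torus matrix has a unit determinant, which is the norm of c + d \<alpha>. Conversely the inverse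
  of the torus matrix of a unit is integral, and the second component is the inverse of the product
  of the matrix with its conjugate.\<close>

lemma stab_iso_image:
  "stab_iso \<alpha> ` (max_compact av K L \<inter> stabilizer_0 K L (std_rep a1 a2)) =
    {c + d * \<alpha> | c d. c \<in> L \<and> d \<in> L \<and> av c \<le> 1 \<and> av d \<le> 1 \<and> av (c + d * \<alpha>) = 1}"
proof (intro equalityI subsetI)
  fix x assume "x \<in> stab_iso \<alpha> ` (max_compact av K L \<inter> stabilizer_0 K L (std_rep a1 a2))"
  then obtain g1 g2 where g: "g1 \<in> GL2 {x\<in>L. av x \<le> 1}"
      "(g1, map_mat2 (quad_conj K L) g1, g2) \<in> geom_stabilizer_0 (std_rep a1 a2)"
      "x = stab_iso \<alpha> (g1, g2)"
    by (auto simp: max_compact_def stabilizer_0_def)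
  define c d where "c = g1 $ 1 $ 1" and "d = - (g1 $ 1 $ 2)"
  have g1: "g1 = torus_mat a1 a2 c d"
    unfolding c_def d_def by (rule stabilizer_component_torus[OF root_eq_0 \<alpha>_neq g(2)])
  from g(1) obtain B where B: "\<And>i j. g1 $ i $ j \<in> {x\<in>L. av x \<le> 1}"
    "\<And>i j. B $ i $ j \<in> {x\<in>L. av x \<le> 1}" "g1 ** B = mat 1"
    unfolding GL2_def by blast
  have cd: "c \<in> L" "av c \<le> 1" "d \<in> L" "av d \<le> 1"
    using B(1)[of 1 1] B(1)[of 1 2] KL.ext_closed(5) by (auto simp: c_def d_def)
  have det_le: "av (det A) \<le> 1" if "\<And>i j. A $ i $ j \<in> {x\<in>L. av x \<le> 1}" for A :: "'a mat2"
    unfolding det_2 using that by (auto intro!: av_diff_le av_mult_le_1)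
  have det_g1: "det g1 = torus_det a1 a2 c d"
    unfolding g1 by (simp add: det_2 torus_det_def power2_eq_square algebra_simps)
  have "det g1 * det B = 1" using B(3) by (metis det_I det_mul)
  then have prod: "av (det g1) * av (det B) = 1" by (metis av_1 av_mult)
  have "av (det g1) * av (det B) \<le> av (det g1) * 1"
    using det_le[OF B(2)] by (intro mult_left_mono) auto
  then have "1 \<le> av (det g1)" unfolding prod by simp
  then have "av (det g1) = 1" using det_le[OF B(1)] by simp
  then have "av (c + d * \<alpha>) ^ 2 = 1" using av_torus_det[OF cd(1,3)] det_g1 by simp
  then have "av (c + d * \<alpha>) = 1" using av_nonneg[of "c + d * \<alpha>"] by (simp add: power2_eq_1_iff)
  moreover have "x = c + d * \<alpha>" unfolding g(3) by (simp add: stab_iso_def c_def d_def)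
  ultimately show "x \<in> {c + d * \<alpha> | c d. c \<in> L \<and> d \<in> L \<and> av c \<le> 1 \<and> av d \<le> 1 \<and> av (c + d * \<alpha>) = 1}"
    using cd by blast
next
  fix x assume "x \<in> {c + d * \<alpha> | c d. c \<in> L \<and> d \<in> L \<and> av c \<le> 1 \<and> av d \<le> 1 \<and> av (c + d * \<alpha>) = 1}"
  then obtain c d where cd: "c \<in> L" "d \<in> L" "av c \<le> 1" "av d \<le> 1" "av (c + d * \<alpha>) = 1" "x = c + d * \<alpha>" by blast
  let ?\<sigma> = "quad_conj K L"
  define D where "D = torus_det a1 a2 c d"
  define D' where "D' = torus_det a1 a2 (?\<sigma> c) (?\<sigma> d)"
  have aL: "a1 \<in> L" "a2 \<in> L" using a1_in a2_in KL.base_in by auto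
  have \<sigma>cd: "?\<sigma> c \<in> L" "?\<sigma> d \<in> L" "av (?\<sigma> c) \<le> 1" "av (?\<sigma> d) \<le> 1"
    using cd KL.conj_in KL.conj_isometry by auto
  have DL: "D \<in> L" unfolding D_def by (rule torus_det_in[OF KL.subfield_ext aL cd(1,2)])
  have D1: "av D = 1" using av_torus_det[OF cd(1,2)] cd(5) by (simp add: D_def)
  have D'_eq: "D' = ?\<sigma> D"
    using cd(1,2) aL a1_in a2_in KL.ext_closed(3,4,6,9)
    by (simp add: D'_def D_def torus_det_def KL.conj_add KL.conj_diff KL.conj_mult KL.conj_power KL.conj_base)
  then have D'1: "av D' = 1" using KL.conj_isometry[OF DL] D1 by simp
  have D0: "D \<noteq> 0" "D' \<noteq> 0" using D1 D'1 by auto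
  define ci di where "ci = (c - a1 * d) / D" and "di = - d / D"
  have ci: "ci \<in> L" "di \<in> L" "av ci \<le> 1" "av di \<le> 1"
  proof -
    have "av (c - a1 * d) \<le> 1" using cd a1_le by (intro av_diff_le av_mult_le_1)
    then show "av ci \<le> 1" "av di \<le> 1" using D1 cd by (simp_all add: ci_def di_def av_divide)
    show "ci \<in> L" "di \<in> L" using cd DL aL KL.ext_closed(4-6,8) by (simp_all add: ci_def di_def)
  qed
  have inv: "torus_inv a1 a2 c d = torus_mat a1 a2 ci di"
    by (simp add: torus_inv_def ci_def di_def D_def)
  have inv': "torus_inv a1 a2 (?\<sigma> c) (?\<sigma> d) = torus_mat a1 a2 (?\<sigma> ci) (?\<sigma> di)"
  proof -
    have "?\<sigma> ci = (?\<sigma> c - a1 * ?\<sigma> d) / D'" "?\<sigma> di = - ?\<sigma> d / D'"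
      using cd(1,2) DL aL a1_in KL.ext_closed(4-6,8)
      by (simp_all add: ci_def di_def D'_eq KL.conj_divide KL.conj_diff KL.conj_mult KL.conj_base KL.conj_uminus)
    then show ?thesis by (simp add: torus_inv_def D'_def)
  qed
  \<comment> \<open>The parameters of the product of a torus matrix with its conjugate are built
    from norms, a trace and the coefficients \<open>a1\<close> and \<open>a2\<close>; so they lie in
    \<open>K\<close>.\<close>
  have prod_entries: "(torus_mat a1 a2 u v ** torus_mat a1 a2 (?\<sigma> u) (?\<sigma> v)) $ i $ j \<in> {x\<in>K. av x \<le> 1}"
    if uv: "u \<in> L" "v \<in> L" "av u \<le> 1" "av v \<le> 1" for u v i j
    unfolding torus_mat_mult
  proof (rule torus_mat_entries[OF subfield a1_in a2_in])
    have \<sigma>uv: "av (?\<sigma> u) \<le> 1" "av (?\<sigma> v) \<le> 1" "?\<sigma> u \<in> L" "?\<sigma> v \<in> L"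
      using uv KL.conj_isometry KL.conj_in by auto
    have "u * ?\<sigma> v + ?\<sigma> (u * ?\<sigma> v) \<in> K" by (rule KL.trace_in) (use uv \<sigma>uv KL.ext_closed(4) in simp)
    then have tr: "u * ?\<sigma> v + ?\<sigma> u * v \<in> K" using uv \<sigma>uv by (simp add: KL.conj_mult KL.conj_conj)
    have nr: "u * ?\<sigma> u \<in> K" "v * ?\<sigma> v \<in> K" using KL.norm_in uv by auto
    show "u * ?\<sigma> u - a2 * v * ?\<sigma> v \<in> K" using nr a2_in F_closed(4,6) by (simp add: mult.assoc)
    show "u * ?\<sigma> v + ?\<sigma> u * v - a1 * v * ?\<sigma> v \<in> K" using tr nr a1_in F_closed(4,6) by (simp add: mult.assoc)
    show "av (u * ?\<sigma> u - a2 * v * ?\<sigma> v) \<le> 1"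
      by (rule av_diff_le[OF av_mult_le_1[OF uv(3) \<sigma>uv(1)]
            av_mult_le_1[OF av_mult_le_1[OF a2_le uv(4)] \<sigma>uv(2)]])
    show "av (u * ?\<sigma> v + ?\<sigma> u * v - a1 * v * ?\<sigma> v) \<le> 1"
      by (rule av_diff_le[OF av_add_le[OF av_mult_le_1[OF uv(3) \<sigma>uv(2)] av_mult_le_1[OF \<sigma>uv(1) uv(4)]]
            av_mult_le_1[OF av_mult_le_1[OF a1_le uv(4)] \<sigma>uv(2)]])
  qed
  define g1 where "g1 = torus_mat a1 a2 c d"
  define g2 where "g2 = torus_inv a1 a2 c d ** torus_inv a1 a2 (?\<sigma> c) (?\<sigma> d)"
  have g1': "map_mat2 ?\<sigma> g1 = torus_mat a1 a2 (?\<sigma> c) (?\<sigma> d)"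
    using cd(1,2) aL a1_in a2_in KL.ext_closed(4)
    by (simp add: mat2_eq_iff map_mat2_def g1_def KL.conj_uminus KL.conj_mult KL.conj_diff KL.conj_base)
  have g1_GL: "g1 \<in> GL2 {x\<in>L. av x \<le> 1}"
    unfolding g1_def
    by (rule GL2_I[OF _ _ torus_mat_inv[OF D0(1)[unfolded D_def], unfolded inv]])
      (rule torus_mat_entries[OF KL.subfield_ext aL], fact+)+
  have g2_GL: "g2 \<in> GL2 {x\<in>K. av x \<le> 1}"
    unfolding g2_def inv inv'
    by (rule GL2_I[OF prod_entries[OF ci] prod_entries[OF cd(1-4)]
          torus_mat_mult_inv[OF D0[unfolded D_def D'_def], unfolded inv inv']])
  have comp: "(g1, map_mat2 ?\<sigma> g1, g2) \<in> geom_stabilizer_0 (std_rep a1 a2)"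
    using torus_point_in_component[OF D0[unfolded D_def D'_def]]
    unfolding torus_point_def g1_def[symmetric] g1'[symmetric] g2_def .
  have "GL2 {x\<in>F. av x \<le> 1} \<subseteq> GL2 F" for F :: "'a set" unfolding GL2_def by blast
  with g1_GL g2_GL have "g1 \<in> GL2 L" "g2 \<in> GL2 K" by blast+
  with g1_GL g2_GL comp have "(g1, g2) \<in> max_compact av K L \<inter> stabilizer_0 K L (std_rep a1 a2)"
    by (simp add: max_compact_def stabilizer_0_def)
  moreover have "x = stab_iso \<alpha> (g1, g2)" by (simp add: stab_iso_def g1_def cd(6))
  ultimately show "x \<in> stab_iso \<alpha> ` (max_compact av K L \<inter> stabilizer_0 K L (std_rep a1 a2))" by blast
qed

lemma stab_vol_eq:
  assumes "integral_basis av L l R E (quad_conj L E) t" "normalized_haar av E \<mu>"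
  obtains a b j where "a \<in> L" "b \<in> L" "\<alpha> = a + b * t" "av b = av l ^ j" "0 < j"
    "stab_vol \<mu> \<alpha> (max_compact av K L \<inter> stabilizer_0 K L (std_rep a1 a2)) =
      1 / (card R ^ j + (if av t = 1 then card R ^ (j - 1) else 0))"
proof -
  from conductor[OF assms(1)]
  obtain a b j where ab: "a \<in> L" "b \<in> L" "\<alpha> = a + b * t" "av a \<le> 1" "av b = av l ^ j" and j: "0 < j"
    and eq: "{c + d * \<alpha> | c d. c \<in> L \<and> d \<in> L \<and> av c \<le> 1 \<and> av d \<le> 1 \<and> av (c + d * \<alpha>) = 1} =
      integral_basis.order_units av L l t j" .
  have "stab_vol \<mu> \<alpha> (max_compact av K L \<inter> stabilizer_0 K L (std_rep a1 a2)) =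
      1 / (card R ^ j + (if av t = 1 then card R ^ (j - 1) else 0))"
    unfolding stab_vol_def stab_iso_image eq
    by (rule integral_basis.measure_order_units[OF assms j])
  with ab(1-3,5) j show ?thesis by (rule that)
qed

end

section \<open>Independence of the level from the Eisenstein polynomial\<close>

lemma (in discrete_valued) eisensteinD:
  assumes "eisenstein av F b1 b2" shows "b1 \<in> F" "b2 \<in> F" "av b2 = av p"
proof -
  have b: "b1 \<in> F" "b2 \<in> F" "av b2 \<le> av p" "av p ^ 2 < av b2"
    using assms by (auto simp: eisenstein_def max_ideal_pow_eq max_ideal_eq)
  then have "b2 \<noteq> 0" by auto
  from value_group[OF b(2) this] obtain n where n: "av b2 = av p powi n" ..
  have "1 \<le> n" using b(3) n p_powi_le_iff[of n 1] by simp
  moreover have "n < 2" using b(4) n p_powi_less_iff[of 2 n] by simp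
  ultimately have "n = 1" by simp
  then show "b1 \<in> F" "b2 \<in> F" "av b2 = av p" using b n by auto
qed

context ramified_pair
begin

text \<open>A root \<beta> of another Eisenstein polynomial for \<open>M\<close> is u + w \<alpha>.
  Both \<alpha> and \<beta> generate the integers of \<open>M\<close> over those of
  \<open>K\<close>, so w is a unit and the coordinates of \<alpha> and \<beta> at \<open>t\<close>
  have the same value. Hence \<open>level_poly_eq\<close> returns the same \<open>j\<close> for both
  polynomials.\<close>

lemma level_eq:
  assumes t: "t \<in> E" "av t ^ 2 = av l" and ab: "a \<in> L" "b \<in> L" "\<alpha> = a + b * t" "av b = av l ^ j" and j: "0 < j"
    and eis: "eisenstein av K a1 a2" and gen: "generate_field \<Omega> (K \<union> {z. poly [:a2, a1, 1:] z = 0}) = M"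
  shows "level av K M L = j"
proof -
  have key: "level_poly av K L b1 b2 = j" if e: "eisenstein av K b1 b2"
    and g: "generate_field \<Omega> (K \<union> {z. poly [:b2, b1, 1:] z = 0}) = M" for b1 b2
  proof -
    note b12 = eisensteinD[OF e]
    have "\<not> {z. poly [:b2, b1, 1:] z = 0} \<subseteq> K"
    proof
      assume "{z. poly [:b2, b1, 1:] z = 0} \<subseteq> K"
      then have "M \<subseteq> K" unfolding g[symmetric] by (intro generate_field_subset subfield) auto
      then show False using KM.base_subset KM.base_neq by blast
    qed
    then obtain \<beta> where \<beta>: "poly [:b2, b1, 1:] \<beta> = 0" "\<beta> \<notin> K" by blast
    have \<beta>M: "\<beta> \<in> M" unfolding g[symmetric] using \<beta>(1) by (intro generate_field.incl) simp
    have \<beta>L: "\<beta> \<notin> L"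
    proof
      assume "\<beta> \<in> L"
      then have "L = M" using KL.ext_eq[OF _ \<beta>(2)] KM.ext_eq[OF \<beta>M \<beta>(2)] by simp
      then show False using \<alpha>_in \<alpha>_notin by simp
    qed
    have "b2 + b1 * \<beta> + \<beta> * \<beta> = 0" using \<beta>(1) by (simp add: algebra_simps)
    then have \<beta>_root: "\<beta> * \<beta> = - b1 * \<beta> - b2" by (simp add: eq_diff_eq eq_neg_iff_add_eq_0 ac_simps)
    interpret B: ramified_pair av K p R L M l \<beta> b1 b2
      by (rule ramified_pair.intro[OF discrete_valued_axioms KL.quad_conjugation_axioms
            KM.quad_conjugation_axioms ramified_pair_axioms.intro[OF two l_in l_value \<beta>M \<beta>L b12 \<beta>_root]])
    have BE: "B.E = E" unfolding B.E_def using LE.ext_eq[OF ME.base_in[OF \<beta>M] \<beta>L] by simp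
    from KM.basis_coords[OF \<beta>M \<alpha>_in \<alpha>_notin_K] obtain u w where
      uw: "u \<in> K" "w \<in> K" "\<beta> = u + w * \<alpha>" by metis
    have w0: "w \<noteq> 0" using uw \<beta>(2) by auto
    interpret K\<alpha>: integral_basis av K p R M "quad_conj K M" \<alpha>
      by (rule KM.ramified_integral_basis[OF \<alpha>_in \<alpha>_value])
    interpret K\<beta>: integral_basis av K p R M "quad_conj K M" \<beta>
      by (rule KM.ramified_integral_basis[OF \<beta>M B.\<alpha>_value])
    have "av w \<le> 1" using K\<alpha>.coords_integral[OF uw(1,2)] K\<beta>.t_le uw(3) by simp
    moreover have "av (1 / w) \<le> 1"
    proof -
      have eq: "- (u / w) + (1 / w) * \<beta> = \<alpha>" unfolding uw(3) using w0 by (simp add: field_simps)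
      have "- (u / w) \<in> K" "1 / w \<in> K" using uw(1,2) F_closed(2,5,8) by auto
      from K\<beta>.coords_integral[OF this] show ?thesis unfolding eq using K\<alpha>.t_le by blast
    qed
    ultimately have w1: "av w = 1" using w0 av_nonneg[of w]
      by (auto simp: av_divide divide_le_eq_1 simp del: av_nonneg)
    show ?thesis
    proof (rule B.level_poly_eq[of t "u + w * a" "w * b"])
      show "t \<in> B.E" using t BE by simp
      show "\<beta> = (u + w * a) + (w * b) * t" using uw ab by (simp add: algebra_simps)
      show "u + w * a \<in> L" "w * b \<in> L" using uw ab KL.base_in KL.ext_closed(3,4) by auto
      show "av (w * b) = av l ^ j" using ab w1 by (simp add: av_mult)
    qed (use t j in auto)
  qed
  show ?thesis
    unfolding level_def
  proof (rule the_equality)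
    fix n assume "\<forall>b1 b2. eisenstein av K b1 b2 \<and> generate_field \<Omega> (K \<union> {z. poly [:b2, b1, 1:] z = 0}) = M
        \<longrightarrow> n = level_poly av K L b1 b2"
    then have "n = level_poly av K L a1 a2" using eis gen by blast
    then show "n = j" by (simp only: key[OF eis gen])
  qed (use key in auto)
qed

end

section \<open>Splitting fields of the standard representative\<close>

lemma splitting_field_std_rep:
  "splitting_field K (std_rep a1 a2) = generate_field \<Omega> (K \<union> {z. poly [:a2, a1, 1:] z = 0})"
proof -
  have "{u $ 1 / u $ 2 | u. u $ 2 \<noteq> 0 \<and> disc_form (std_rep a1 a2) u = 0} = {z. poly [:a2, a1, 1:] z = 0}"
  proof (intro equalityI subsetI)
    fix z assume "z \<in> {u $ 1 / u $ 2 | u. u $ 2 \<noteq> 0 \<and> disc_form (std_rep a1 a2) u = 0}"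
    then obtain u :: "'a^2" where u: "u $ 2 \<noteq> 0" "disc_form (std_rep a1 a2) u = 0" "z = u $ 1 / u $ 2" by blast
    have "poly [:a2, a1, 1:] z * (u $ 2)\<^sup>2 = disc_form (std_rep a1 a2) u"
      using u(1) by (simp add: u(3) disc_form_std_rep power2_eq_square field_simps)
    then show "z \<in> {z. poly [:a2, a1, 1:] z = 0}" using u by simp
  next
    fix z assume z: "z \<in> {z. poly [:a2, a1, 1:] z = 0}"
    define u :: "'a^2" where "u = vector [z, 1]"
    have "u $ 1 = z" "u $ 2 = 1" by (simp_all add: u_def)
    then show "z \<in> {u $ 1 / u $ 2 | u. u $ 2 \<noteq> 0 \<and> disc_form (std_rep a1 a2) u = 0}"
      using z by (intro CollectI exI[of _ u]) (simp add: disc_form_std_rep power2_eq_square algebra_simps)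
  qed
  then show ?thesis by (simp add: splitting_field_def)
qed

text \<open>A field containing \<open>K\<close> and \<alpha> contains both roots, hence
  \<open>M\<close>. So \<alpha> lies outside \<open>K\<close>, and if it were in \<open>L\<close>,
  it would generate both quadratic extensions and make them equal.\<close>

lemma ramified_pair_std_rep:
  fixes av :: "'a::field_char_0 \<Rightarrow> real"
  assumes KL: "discrete_quad av K p R L (quad_conj K L)" and l: "l \<in> L" "av l ^ 2 = av p"
    and eis: "eisenstein av K a1 a2" and root: "poly [:a2, a1, 1:] \<alpha> = 0"
    and M: "M = splitting_field K (std_rep a1 a2)" "quadratic_ext K M" "M \<noteq> L"
  shows "ramified_pair av K p R L M l \<alpha> a1 a2"
    and "ext_splitting_field K L (std_rep a1 a2) = ramified_pair.E L \<alpha>"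
proof -
  interpret KL: discrete_quad av K p R L "quad_conj K L" by (rule KL)
  interpret KM: quad_conjugation K M "quad_conj K M" by (rule quad_conjugation_quadratic_ext[OF M(2)])
  note a12 = KL.eisensteinD[OF eis]
  have "a2 + a1 * \<alpha> + \<alpha> * \<alpha> = 0" using root by (simp add: algebra_simps)
  then have root': "\<alpha> * \<alpha> = - a1 * \<alpha> - a2" by (simp add: eq_diff_eq eq_neg_iff_add_eq_0 ac_simps)
  have Meq: "M = generate_field \<Omega> (K \<union> {z. poly [:a2, a1, 1:] z = 0})"
    unfolding M(1) by (rule splitting_field_std_rep)
  have \<alpha>M: "\<alpha> \<in> M" unfolding Meq using root by (intro generate_field.incl) simp
  have roots: "z = \<alpha> \<or> z = - a1 - \<alpha>" if "poly [:a2, a1, 1:] z = 0" for z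
  proof -
    have "(z - \<alpha>) * (z - (- a1 - \<alpha>)) = (z * z + a1 * z) - (\<alpha> * \<alpha> + a1 * \<alpha>)" by (simp add: algebra_simps)
    also have "\<dots> = poly [:a2, a1, 1:] z" unfolding root' by (simp add: algebra_simps)
    finally show ?thesis using that by simp
  qed
  have sub: "M \<subseteq> F" if "subfield F \<Omega>" "K \<subseteq> F" "\<alpha> \<in> F" for F
    unfolding Meq
  proof (rule generate_field_subset[OF that(1)])
    have "- a1 - \<alpha> \<in> F" using that a12 subfield_closed(5,6)[OF that(1)] by auto
    then show "K \<union> {z. poly [:a2, a1, 1:] z = 0} \<subseteq> F" using that roots by blast
  qed
  have \<alpha>K: "\<alpha> \<notin> K" using sub[OF KL.subfield_base order_refl] KM.base_subset KM.base_neq by blast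
  have \<alpha>L: "\<alpha> \<notin> L"
  proof
    assume "\<alpha> \<in> L"
    then have "L = M" using KL.ext_eq[OF _ \<alpha>K] KM.ext_eq[OF \<alpha>M \<alpha>K] by simp
    then show False using M(3) by simp
  qed
  show rp: "ramified_pair av K p R L M l \<alpha> a1 a2"
    by (rule ramified_pair.intro[OF KL.discrete_valued_axioms KL.quad_conjugation_axioms
          KM.quad_conjugation_axioms ramified_pair_axioms.intro[OF KL.two l \<alpha>M \<alpha>L a12 root']])
  interpret P: ramified_pair av K p R L M l \<alpha> a1 a2 by (rule rp)
  show "ext_splitting_field K L (std_rep a1 a2) = P.E"
  proof
    show "ext_splitting_field K L (std_rep a1 a2) \<subseteq> P.E"
      unfolding ext_splitting_field_def M(1)[symmetric]
      by (rule generate_field_subset[OF P.LE.subfield_ext]) (use P.LE.base_in P.ME.base_in in blast)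
    show "P.E \<subseteq> ext_splitting_field K L (std_rep a1 a2)"
    proof
      fix x assume "x \<in> P.E"
      then obtain c d where cd: "c \<in> L" "d \<in> L" "x = c + d * \<alpha>" by (auto simp: P.E_def)
      have "c \<in> ext_splitting_field K L (std_rep a1 a2)" "d \<in> ext_splitting_field K L (std_rep a1 a2)"
        "\<alpha> \<in> ext_splitting_field K L (std_rep a1 a2)"
        unfolding ext_splitting_field_def M(1)[symmetric] using cd \<alpha>M by (auto intro: generate_field.incl)
      moreover have "subfield (ext_splitting_field K L (std_rep a1 a2)) \<Omega>"
        unfolding ext_splitting_field_def by (rule subfield_generate_field)
      ultimately show "x \<in> ext_splitting_field K L (std_rep a1 a2)"
        unfolding cd(3) by (simp add: subfield_closed)
    qed
  qed
qed

theorem proposition4p2: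
  fixes av :: "'a::{alg_closed_field, field_char_0} \<Rightarrow> real"
    and k kt kv ktv :: "'a set"
    and a1 a2 \<alpha> :: 'a
    and x :: "'a mat2 \<times> 'a mat2"
    and \<delta> :: nat
    and \<mu> :: "'a measure"
  assumes "nonarch_abs_value av"
    and "number_field k"
    and "quadratic_ext k kt"
    and "local_field av kv"
    and "k \<subseteq> kv"
    and "Metric_space.mtopology kv (av_dist av) closure_of k = kv"
    and "2 \<in> max_ideal av kv"
    and "ktv = generate_field \<Omega> (kt \<union> kv)"
    and "quadratic_ext kv ktv"
    and "\<not> unramified av kv ktv"
    and "discriminant av kv ktv = max_ideal_pow av kv \<delta>"
    and "eisenstein av kv a1 a2"
    and "poly [:a2, a1, 1:] \<alpha> = 0"
    and "x = std_rep a1 a2"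
    and "normalized_haar av (ext_splitting_field kv ktv x) \<mu>"
  shows "(type_rm_rm_ur av kv ktv x \<longrightarrow>
            stab_vol \<mu> \<alpha> (max_compact av kv ktv \<inter> stabilizer_0 kv ktv x) =
              inverse (1 + inverse (real (residue_card av kv))) *
              real (residue_card av kv) powi (- int \<delta>)) \<and>
         (type_rm_rm_rm av kv ktv x \<longrightarrow>
            stab_vol \<mu> \<alpha> (max_compact av kv ktv \<inter> stabilizer_0 kv ktv x) =
              real (residue_card av kv) powi (- int (level av kv (splitting_field kv x) ktv)))"
proof -
  obtain p R where dv: "discrete_valued av kv p R" and R: "card R = residue_card av kv"
    using local_field_discrete_valued[OF assms(1,4)] by blast
  interpret KL: discrete_quad av kv p R ktv "quad_conj kv ktv"
    by (intro discrete_quad.intro discrete_quad_axioms.intro dv quad_conjugation_quadratic_ext assms(9))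
      (use assms(7) in \<open>simp add: max_ideal_def\<close>)
  obtain l where l: "l \<in> ktv" "av l ^ 2 = av p" using KL.ramified_uniformizer[OF assms(10)] by blast
  have q: "0 < card R" using KL.reps_nonempty KL.reps_finite by (simp add: card_gt_0_iff)
  let ?M = "splitting_field kv x"
  let ?vol = "stab_vol \<mu> \<alpha> (max_compact av kv ktv \<inter> stabilizer_0 kv ktv x)"
  show ?thesis
  proof (intro conjI impI)
    assume ty: "type_rm_rm_ur av kv ktv x"
    then have "quadratic_ext kv ?M" "?M \<noteq> ktv" by (auto simp: type_rm_rm_ur_def)
    note rp = ramified_pair_std_rep[OF KL.discrete_quad_axioms l assms(12,13) refl this[unfolded assms(14)]]
    interpret P: ramified_pair av kv p R ktv "splitting_field kv (std_rep a1 a2)" l \<alpha> a1 a2 by (rule rp(1))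
    have "unramified av ktv P.E" using ty rp(2) assms(14) by (simp add: type_rm_rm_ur_def)
    then obtain \<xi> where \<xi>: "\<xi> \<in> P.E" "av \<xi> = 1" "\<And>a. a \<in> ktv \<Longrightarrow> 1 \<le> av (\<xi> - a)"
      using P.LE.unramified_generator by blast
    have haar: "normalized_haar av P.E \<mu>" using assms(14,15) rp(2) by simp
    from P.stab_vol_eq[OF P.LE.unramified_integral_basis[OF \<xi>] haar, folded assms(14)]
    obtain a b j where j: "a \<in> ktv" "b \<in> ktv" "\<alpha> = a + b * \<xi>" "av b = av l ^ j" "0 < j"
      "?vol = 1 / (card R ^ j + (if av \<xi> = 1 then card R ^ (j - 1) else 0))" .
    have "j = \<delta>" by (rule P.conductor_unramified[OF \<xi> j(1-4) assms(11)])
    then obtain m where m: "j = Suc m" "\<delta> = Suc m" using j(5) by (cases j) auto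
    \<comment> \<open>With Q = q and P = q^(j - 1), this turns the index q^j + q^(j - 1) into q^j (1
      + 1/q).\<close>
    have sum_inv: "1 / (Q * P + P) = inverse (1 + inverse Q) * inverse (Q * P)" if "0 < Q" for P Q :: real
    proof -
      have "(1 + inverse Q) * (Q * P) = Q * P + P" using that by (simp add: field_simps)
      then show ?thesis by (metis inverse_eq_divide inverse_mult_distrib)
    qed
    have "?vol = 1 / (real (card R) ^ Suc m + real (card R) ^ m)" using j(6) \<xi>(2) m by simp
    also have "\<dots> = inverse (1 + inverse (real (card R))) * inverse (real (card R) ^ Suc m)"
      using sum_inv[of "real (card R)" "real (card R) ^ m"] q by simp
    finally show "?vol = inverse (1 + inverse (real (residue_card av kv))) *
        real (residue_card av kv) powi (- int \<delta>)"
      by (simp only: R m power_int_minus power_int_of_nat)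
  next
    assume ty: "type_rm_rm_rm av kv ktv x"
    then have "quadratic_ext kv ?M" "?M \<noteq> ktv" by (auto simp: type_rm_rm_rm_def)
    note rp = ramified_pair_std_rep[OF KL.discrete_quad_axioms l assms(12,13) refl this[unfolded assms(14)]]
    interpret P: ramified_pair av kv p R ktv "splitting_field kv (std_rep a1 a2)" l \<alpha> a1 a2 by (rule rp(1))
    have "\<not> unramified av ktv P.E" using ty rp(2) assms(14) by (simp add: type_rm_rm_rm_def)
    then obtain t where t: "t \<in> P.E" "av t ^ 2 = av l"
      using P.LE.ramified_uniformizer by blast
    have haar: "normalized_haar av P.E \<mu>" using assms(14,15) rp(2) by simp
    from P.stab_vol_eq[OF P.LE.ramified_integral_basis[OF t] haar, folded assms(14)]
    obtain a b j where j: "a \<in> ktv" "b \<in> ktv" "\<alpha> = a + b * t" "av b = av l ^ j" "0 < j"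
      "?vol = 1 / (card R ^ j + (if av t = 1 then card R ^ (j - 1) else 0))" .
    have "level av kv ?M ktv = j"
      unfolding assms(14)
      by (rule P.level_eq[OF t j(1-5) assms(12) splitting_field_std_rep[symmetric]])
    \<comment> \<open>Here |t| < 1, so the second summand of the index is 0.\<close>
    moreover have "?vol = inverse (real (card R) ^ j)"
      using j(6) P.LE.ramified_gt(2)[OF t(2)] by (simp add: divide_inverse)
    ultimately show "?vol = real (residue_card av kv) powi (- int (level av kv ?M ktv))"
      by (simp only: R power_int_minus power_int_of_nat)
  qed
qed

end
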